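(* Let $1<p<\infty$. There exists a constant $C$ such that for every $f\in W^{1,p}(K)$ and all $x,y\in K$, \[ |f(x)-f(y)|\le C\,d(x,y)^{\alpha_p}\,\big(g_f(x)+g_f(y)\big), \] where \[ g_f(x)=\sup_{r>0}\frac1{\mu(B(x,r))^{1/p}}\Big(\int_{B(x,r)\cap\mathcal S}|\partial f|^p\,d\nu\Big)^{1/p}\in[0,+\infty]. \]
   Context: Vicsek set. In $\mathbb R^2$ let $q_1=(-\sqrt2/2,\sqrt2/2)$, $q_2=(\sqrt2/2,\sqrt2/2)$, $q_3=(\sqrt2/2,-\sqrt2/2)$, $q_4=(-\sqrt2/2,-\sqrt2/2)$, $q_5=(0,0)$ and $\psi_i(z)=\frac13(z-q_i)+q_i$, $1\le i\le5$. $K$ is the unique non-empty compact set with $K=\bigcup_{i=1}^5\psi_i(K)$. Cable systems. $V_0=\{q_1,\dots,q_5\}$, $\bar V_0$ is the union of the four segments (edges) $[q_5,q_i]$, $1\le i\le4$; $V_{n+1}=\bigcup_i\psi_i(V_n)$, $\bar V_{n+1}=\bigcup_i\psi_i(\bar V_n)$. The edges of $\bar V_n$ are the images of the edges of $\bar V_0$ under the maps $\psi_{i_1}\circ\cdots\circ\psi_{i_n}$; they have length $3^{-n}$, and $\bar V_n$ is a tree with vertex set $V_n$. Vertices $u,v\in V_n$ are adjacent if they are joined by an edge of $\bar V_n$, denoted $\mathbf e(u,v)$. The skeleton is $\mathcal S=\bigcup_n\bar V_n$, which is dense in $K$. $d$ is the geodesic distance: for $x,y\in\bar V_n$, $d(x,y)$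 is the length of the path in $\bar V_n$ from $x$ to $y$, extended by continuity to $K\times K$. For adjacent $u,v$ one writes $u\le v$ if $d(q_5,u)<d(q_5,v)$. $B(x,r)=\{y\in K:d(x,y)\le r\}$. $\mu$ is the Borel probability measure on $K$ with $\mu(\psi_{i_1}\circ\cdots\circ\psi_{i_n}(K))=5^{-n}$; $d_h=\log5/\log3$, $\alpha_p=1-\frac1p+\frac{d_h}p$. $\nu$ is the ($\sigma$-finite) Lebesgue (length) measure on $\mathcal S$: $\nu(\mathbf e)=3^{-n}$ for every edge $\mathbf e$ of $\bar V_n$. $W^{1,p}(K)$ is the set of $f\in L^p(K,\mu)$ with \[\limsup_{r\to0^+}\frac1{r^{\alpha_p}}\Big(\int_K\int_{B(x,r)}\frac{|f(y)-f(x)|^p}{\mu(B(x,r))}d\mu(y)d\mu(x)\Big)^{1/p}<\infty;\] for $p>1$ its elements have continuous representatives, and $W^{1,p}(K)$ is regarded as a subspace of $C(K)$. For $f\in W^{1,p}(K)$, $\partial f$ denotes the unique function in $L^p(\mathcal S,\nu)$ (which exists) such that $f(v)-f(u)=\int_{\mathbf e(u,v)}\partial f\,d\nu$ for every $n$ and all adjacent $u,v\in V_n$ with $u\le v$. For $x=y$ the convention $0\cdot\infty=0$ is used. *)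

theory Defs
  imports "HOL-Probability.Probability"
begin

type_synonym pt = "real \<times> real"

definition vicsek_pt :: "nat \<Rightarrow> pt" where
  "vicsek_pt i =
    (if i = 1 then (- sqrt 2 / 2, sqrt 2 / 2)
     else if i = 2 then (sqrt 2 / 2, sqrt 2 / 2)
     else if i = 3 then (sqrt 2 / 2, - sqrt 2 / 2)
     else if i = 4 then (- sqrt 2 / 2, - sqrt 2 / 2)
     else (0, 0))"

definition vicsek_map :: "nat \<Rightarrow> pt \<Rightarrow> pt" where
  "vicsek_map i z = (1/3) *\<^sub>R (z - vicsek_pt i) + vicsek_pt i"

definition vicsek_set :: "pt set" where
  "vicsek_set = (THE K. compact K \<and> K \<noteq> {} \<and> K = (\<Union>i\<in>{1..5}. vicsek_map i ` K))"

primrec vertices :: "nat \<Rightarrow> pt set" where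
  "vertices 0 = vicsek_pt ` {1..5}"
| "vertices (Suc n) = (\<Union>i\<in>{1..5}. vicsek_map i ` vertices n)"

primrec edges :: "nat \<Rightarrow> pt set set" where
  "edges 0 = (\<lambda>i. closed_segment (vicsek_pt 5) (vicsek_pt i)) ` {1..4}"
| "edges (Suc n) = (\<Union>i\<in>{1..5}. (\<lambda>e. vicsek_map i ` e) ` edges n)"

primrec cable :: "nat \<Rightarrow> pt set" where
  "cable 0 = \<Union> (edges 0)"
| "cable (Suc n) = (\<Union>i\<in>{1..5}. vicsek_map i ` cable n)"

definition adjacent :: "nat \<Rightarrow> pt \<Rightarrow> pt \<Rightarrow> bool" where
  "adjacent n u v \<longleftrightarrow> u \<in> vertices n \<and> v \<in> vertices n \<and> closed_segment u v \<in> edges n"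

definition skeleton :: "pt set" where
  "skeleton = (\<Union>n. cable n)"

(* cable_length n A is the total length of the part of A lying on the edges of level n.
   At level 0 the edge from 0 to vicsek_pt i is parametrized by t *\<^sub>R vicsek_pt i, t in [0,1];
   this is the arc length parametrization because vicsek_pt i has norm 1 for i = 1, ..., 4.
   The maps vicsek_map i contract lengths by 1/3, and distinct edges of the same level have
   at most one point in common. *)
primrec cable_length :: "nat \<Rightarrow> pt set \<Rightarrow> ennreal" where
  "cable_length 0 A = (\<Sum>i\<in>{1..4}. emeasure lborel {t\<in>{0..1::real}. t *\<^sub>R vicsek_pt i \<in> A})"
| "cable_length (Suc n) A = (\<Sum>i\<in>{1..5}. ennreal (1/3) * cable_length n (vicsek_map i -` A))"

(* The cable systems increase with n, so the supremum is an increasing limit; it gives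
   every edge of level n the mass 3^(-n). *)
definition length_measure :: "pt measure" where
  "length_measure = measure_of skeleton (sets (restrict_space borel skeleton))
     (\<lambda>A. SUP n. cable_length n A)"

(* The cable systems form an increasing sequence of trees, so for x \<noteq> y the image of the arc g
   does not depend on the choice of g (nor on n): it is the path from x to y.
   The case x = y is separate because constant paths are not arcs. *)
definition skeleton_dist :: "pt \<Rightarrow> pt \<Rightarrow> real" where
  "skeleton_dist x y =
    (if x = y then 0
     else measure length_measure (path_image (SOME g. arc g \<and> (\<exists>n. path_image g \<subseteq> cable n) \<and>
            pathstart g = x \<and> pathfinish g = y)))"

(* The continuous extension of skeleton_dist to pairs of points of vicsek_set. *)
definition vicsek_dist :: "pt \<Rightarrow> pt \<Rightarrow> real" where
  "vicsek_dist x y = Lim (at (x, y) within skeleton \<times> skeleton) (\<lambda>(a, b). skeleton_dist a b)"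

definition vicsek_ball :: "pt \<Rightarrow> real \<Rightarrow> pt set" where
  "vicsek_ball x r = {y \<in> vicsek_set. vicsek_dist x y \<le> r}"

(* For w = [i1, ..., in], foldr vicsek_map w is the composition
   vicsek_map i1 \<circ> ... \<circ> vicsek_map in. *)
definition vicsek_measure :: "pt measure" where
  "vicsek_measure = (THE M. prob_space M \<and> sets M = sets (restrict_space borel vicsek_set) \<and>
     (\<forall>w. set w \<subseteq> {1..5} \<longrightarrow> measure M (foldr vicsek_map w ` vicsek_set) = (1/5) ^ length w))"

definition hausdorff_dim :: real where
  "hausdorff_dim = ln 5 / ln 3"

definition sobolev_exponent :: "real \<Rightarrow> real" where
  "sobolev_exponent p = 1 - 1 / p + hausdorff_dim / p"

definition Lp_functions :: "real \<Rightarrow> 'a measure \<Rightarrow> ('a \<Rightarrow> real) set" where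
  "Lp_functions p M = {f \<in> borel_measurable M. integrable M (\<lambda>x. \<bar>f x\<bar> powr p)}"

definition besov_quotient :: "real \<Rightarrow> (pt \<Rightarrow> real) \<Rightarrow> real \<Rightarrow> real" where
  "besov_quotient p f r =
     1 / r powr sobolev_exponent p *
     (LINT x|vicsek_measure. (LINT y:vicsek_ball x r|vicsek_measure.
        \<bar>f y - f x\<bar> powr p / measure vicsek_measure (vicsek_ball x r))) powr (1 / p)"

(* Elements are represented by their continuous versions (p > 1); for such f the integrals
   in besov_quotient are finite. Only the values of f on vicsek_set matter. *)
definition sobolev_space :: "real \<Rightarrow> (pt \<Rightarrow> real) set" where
  "sobolev_space p =
     {f. continuous_on vicsek_set f \<and> f \<in> Lp_functions p vicsek_measure \<and>
         Limsup (at_right 0) (\<lambda>r. ereal (besov_quotient p f r)) < \<infinity>}"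

(* Determined by f up to a length_measure-null set. *)
definition vicsek_deriv :: "real \<Rightarrow> (pt \<Rightarrow> real) \<Rightarrow> pt \<Rightarrow> real" where
  "vicsek_deriv p f = (SOME g. g \<in> Lp_functions p length_measure \<and>
     (\<forall>n u v. adjacent n u v \<and> vicsek_dist (vicsek_pt 5) u < vicsek_dist (vicsek_pt 5) v \<longrightarrow>
        f v - f u = (LINT z:closed_segment u v|length_measure. g z)))"

(* For each r > 0 the quantity inside the supremum is finite since the derivative is in L^p
   and balls have positive measure; the supremum itself may be infinite. *)
definition maximal_gradient :: "real \<Rightarrow> (pt \<Rightarrow> real) \<Rightarrow> pt \<Rightarrow> ennreal" where
  "maximal_gradient p f x =
     (SUP r\<in>{0<..}. ennreal (1 / measure vicsek_measure (vicsek_ball x r) powr (1 / p) *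
        (LINT z:vicsek_ball x r \<inter> skeleton|length_measure. \<bar>vicsek_deriv p f z\<bar> powr p) powr (1 / p)))"

end

theory Submission
  imports Defs
begin

text \<open>
  Membership in the Sobolev space bounds the p-energies of the averages of f over the cells of level n;
  telescoping the averages over cells shrinking to a vertex turns this into a uniform bound on the
  discrete p-energies of f along the edges of level n. The corresponding edgewise constant slopes form a
  bounded martingale in L^p, which converges by uniform convexity; the limit is the derivative of f.
  For the estimate itself no geodesics are needed: the centers of nested cells are joined by edges whose
  lengths decay geometrically, so Hoelder's inequality on each edge bounds the oscillation of f on a cell
  of level n by a constant times 3^(-n(1-1/p)) times the L^p-norm of the derivative on that cell. Given
  distinct points x and y, a deepest level n at which their cells coincide or share a corner has
  3^(-n) comparable to d(x, y), and both cells lie in the ball of radius 4 / 3^n around x, whose measure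
  is at most a constant times 5^(-n).
\<close>

section \<open>Geometry of the cells and the Vicsek set\<close>

text \<open>Most notions are given by descriptions (\<open>THE\<close>, \<open>SOME\<close>,
  \<open>Lim\<close>) that say nothing until existence is proved, and this shapes the proof. The
  geodesic distance extends to K only because Euclidean closeness forces geodesic closeness on the
  skeleton. A derivative can be picked only after one has been built, and its sign convention
  d(q_5,u) < d(q_5,v) requires that the distance from q_5 changes at unit speed along every edge.
  The measure is realised as the image of Lebesgue measure on [0,1) under base 5 coding. The radius
  4 / 3^n comes from cell diameters: every point of the skeleton is within distance 1 of q_5, so a
  cell of level n has geodesic diameter at most 2 / 3^n, and two cells with a common corner together
  at most 4 / 3^n. The exponent arises as 3^(-n(1-1/p)) from Hoelder times 5^(-n/p) from the measure
  of the ball; the product is 3^(-n \<alpha>_p) since 5 = 3^d_h.\<close>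

definition half_side :: real where "half_side = sqrt 2 / 2"

lemma half_side_pos: "half_side > 0"
  by (simp add: half_side_def)

text \<open>Coordinates of q_i in units of \<open>half_side\<close>, kept as integers so that cell
  centres can later be placed on an integer lattice.\<close>

definition sgx :: "nat \<Rightarrow> int" where
  "sgx i = (if i = 1 \<or> i = 4 then -1 else if i = 2 \<or> i = 3 then 1 else 0)"

definition sgy :: "nat \<Rightarrow> int" where
  "sgy i = (if i = 1 \<or> i = 2 then 1 else if i = 3 \<or> i = 4 then -1 else 0)"

lemma vicsek_pt_eq: "vicsek_pt i = (half_side * of_int (sgx i), half_side * of_int (sgy i))"
  by (auto simp: vicsek_pt_def half_side_def sgx_def sgy_def)

lemma vicsek_pt_5 [simp]: "vicsek_pt 5 = 0"
  by (simp add: vicsek_pt_def zero_prod_def)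

lemma indices_5: "i \<in> {1..5::nat} \<longleftrightarrow> i = 1 \<or> i = 2 \<or> i = 3 \<or> i = 4 \<or> i = 5"
  by auto

lemma indices_4: "i \<in> {1..4::nat} \<longleftrightarrow> i = 1 \<or> i = 2 \<or> i = 3 \<or> i = 4"
  by auto

text \<open>The diagonally opposite corner. The corner cell i hangs on the central cell by its own
  corner \<open>opp i\<close>.\<close>

definition opp :: "nat \<Rightarrow> nat" where
  "opp i = (if i = 1 then 3 else if i = 2 then 4 else if i = 3 then 1 else if i = 4 then 2 else i)"

lemma opp_in_4: "i \<in> {1..4} \<Longrightarrow> opp i \<in> {1..4}"
  by (auto simp: opp_def)

lemma opp_in_5: "i \<in> {1..5} \<Longrightarrow> opp i \<in> {1..5}"
  by (auto simp: opp_def)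

lemma opp_neq: "i \<in> {1..4} \<Longrightarrow> opp i \<noteq> i"
  by (auto simp: opp_def)

lemma vicsek_pt_opp: "i \<in> {1..4} \<Longrightarrow> vicsek_pt (opp i) = - vicsek_pt i"
  unfolding indices_4 by (elim disjE) (auto simp: vicsek_pt_eq opp_def sgx_def sgy_def)

lemma norm_vicsek_pt: "i \<in> {1..4} \<Longrightarrow> norm (vicsek_pt i) = 1"
  unfolding indices_4 by (elim disjE) (auto simp: vicsek_pt_def norm_Pair power_divide)

lemma vicsek_pt_nonzero: "i \<in> {1..4} \<Longrightarrow> vicsek_pt i \<noteq> 0"
  using norm_vicsek_pt[of i] by auto

lemma vicsek_map_eq: "vicsek_map i z = (1/3) *\<^sub>R z + (2/3) *\<^sub>R vicsek_pt i"
  by (simp add: vicsek_map_def prod_eq_iff field_simps)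

lemma vicsek_map_fixed [simp]: "vicsek_map i (vicsek_pt i) = vicsek_pt i"
  by (simp add: vicsek_map_def)

text \<open>Both sides are q_i / 3, the single point where the corner cell i touches the central
  cell.\<close>

lemma vicsek_map_opp: "i \<in> {1..4} \<Longrightarrow> vicsek_map i (vicsek_pt (opp i)) = vicsek_map 5 (vicsek_pt i)"
  by (simp add: vicsek_map_eq vicsek_pt_opp flip: scaleR_left_distrib scaleR_minus_left)

lemma vicsek_map_inj: "inj (vicsek_map i)"
  by (auto simp: inj_def vicsek_map_eq)

lemma continuous_on_vicsek_map [continuous_intros]:
  "continuous_on A g \<Longrightarrow> continuous_on A (\<lambda>x. vicsek_map i (g x))"
  unfolding vicsek_map_eq by (intro continuous_intros)

lemma dist_vicsek_map: "dist (vicsek_map i x) (vicsek_map i y) = dist x y / 3"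
proof -
  have "vicsek_map i x - vicsek_map i y = (1/3) *\<^sub>R (x - y)"
    by (simp add: vicsek_map_eq scaleR_diff_right)
  then show ?thesis by (simp add: dist_norm)
qed

lemma vicsek_map_segment: "vicsek_map i ` closed_segment x y = closed_segment (vicsek_map i x) (vicsek_map i y)"
proof -
  have "vicsek_map i ` closed_segment x y = (+) ((2/3) *\<^sub>R vicsek_pt i) ` (\<lambda>z. (1/3) *\<^sub>R z) ` closed_segment x y"
    by (simp add: vicsek_map_eq image_image add.commute)
  also have "(\<lambda>z. (1/3) *\<^sub>R z) ` closed_segment x y = closed_segment ((1/3) *\<^sub>R x) ((1/3) *\<^sub>R y)"
    by (rule closed_segment_linear_image[symmetric]) simp
  finally have e: "vicsek_map i ` closed_segment x y
      = (+) ((2/3) *\<^sub>R vicsek_pt i) ` closed_segment ((1/3) *\<^sub>R x) ((1/3) *\<^sub>R y)" .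
  show ?thesis
    unfolding e closed_segment_translation[symmetric] by (simp add: vicsek_map_eq add.commute)
qed

lemma fst_vicsek_map: "fst (vicsek_map i z) = (fst z + 2 * half_side * of_int (sgx i)) / 3"
  and snd_vicsek_map: "snd (vicsek_map i z) = (snd z + 2 * half_side * of_int (sgy i)) / 3"
  by (simp_all add: vicsek_map_eq vicsek_pt_eq add_divide_distrib)

section \<open>The bounding square and how its images meet\<close>

definition vicsek_square :: "pt set" where
  "vicsek_square = {z. \<bar>fst z\<bar> \<le> half_side \<and> \<bar>snd z\<bar> \<le> half_side}"

lemma sgx_cases: "sgx i = 1 \<or> sgx i = 0 \<or> sgx i = -1"
  and sgy_cases: "sgy i = 1 \<or> sgy i = 0 \<or> sgy i = -1"
  by (auto simp: sgx_def sgy_def)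

lemma vicsek_map_square: "z \<in> vicsek_square \<Longrightarrow> vicsek_map i z \<in> vicsek_square"
  unfolding vicsek_square_def mem_Collect_eq fst_vicsek_map snd_vicsek_map
  using half_side_pos sgx_cases[of i] sgy_cases[of i] by auto

lemma vicsek_pt_square: "vicsek_pt i \<in> vicsek_square"
  using half_side_pos sgx_cases[of i] sgy_cases[of i]
  by (auto simp: vicsek_square_def vicsek_pt_eq)

lemma vicsek_square_eq: "vicsek_square = {-half_side..half_side} \<times> {-half_side..half_side}"
  by (auto simp: vicsek_square_def abs_le_iff)

lemma convex_vicsek_square: "convex vicsek_square"
  unfolding vicsek_square_eq by (intro convex_Times) auto

lemma closed_vicsek_square: "closed vicsek_square"
  unfolding vicsek_square_eq by (intro closed_Times) auto

lemma bounded_vicsek_square: "bounded vicsek_square"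
  unfolding vicsek_square_eq by (intro bounded_Times) auto

text \<open>With h = \<open>half_side\<close>, the equation reads x = y + 2 h s in each coordinate,
  where s = 1 or s = -1 and |x|, |y| \<le> h. This leaves only the extreme values x = h s and y = -h
  s.\<close>

lemma square_center_inter:
  assumes "i \<in> {1..4}" "x \<in> vicsek_square" "y \<in> vicsek_square" "vicsek_map 5 x = vicsek_map i y"
  shows "x = vicsek_pt i" "y = vicsek_pt (opp i)"
proof -
  have e: "fst x = fst y + 2 * half_side * of_int (sgx i)" "snd x = snd y + 2 * half_side * of_int (sgy i)"
    using arg_cong[OF assms(4), of fst] arg_cong[OF assms(4), of snd]
    by (simp_all add: fst_vicsek_map snd_vicsek_map sgx_def[of 5] sgy_def[of 5])
  have b: "\<bar>fst x\<bar> \<le> half_side" "\<bar>snd x\<bar> \<le> half_side" "\<bar>fst y\<bar> \<le> half_side" "\<bar>snd y\<bar> \<le> half_side"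
    using assms by (auto simp: vicsek_square_def)
  have s: "sgx i = 1 \<or> sgx i = -1" "sgy i = 1 \<or> sgy i = -1"
    using assms(1) unfolding indices_4 by (auto simp: sgx_def sgy_def)
  show x: "x = vicsek_pt i"
    using e b s by (auto simp: vicsek_pt_eq prod_eq_iff)
  have "y = - vicsek_pt i"
    using e b s by (auto simp: vicsek_pt_eq prod_eq_iff)
  then show "y = vicsek_pt (opp i)" using assms(1) by (simp add: vicsek_pt_opp)
qed

text \<open>Distinct corners have opposite signs in some coordinate. There x and y would differ by 4
  h, with h = \<open>half_side\<close>, although both lie in an interval of length 2 h.\<close>

lemma square_corner_disjoint:
  assumes "i \<in> {1..4}" "j \<in> {1..4}" "i \<noteq> j" "x \<in> vicsek_square" "y \<in> vicsek_square"
  shows "vicsek_map i x \<noteq> vicsek_map j y"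
proof
  assume eq: "vicsek_map i x = vicsek_map j y"
  have e: "fst x + 2 * half_side * of_int (sgx i) = fst y + 2 * half_side * of_int (sgx j)"
    "snd x + 2 * half_side * of_int (sgy i) = snd y + 2 * half_side * of_int (sgy j)"
    using arg_cong[OF eq, of fst] arg_cong[OF eq, of snd]
    by (simp_all add: fst_vicsek_map snd_vicsek_map)
  have b: "\<bar>fst x\<bar> \<le> half_side" "\<bar>snd x\<bar> \<le> half_side" "\<bar>fst y\<bar> \<le> half_side" "\<bar>snd y\<bar> \<le> half_side"
    using assms by (auto simp: vicsek_square_def)
  have s: "sgx i = 1 \<and> sgx j = -1 \<or> sgx i = -1 \<and> sgx j = 1 \<or> sgy i = 1 \<and> sgy j = -1 \<or> sgy i = -1 \<and> sgy j = 1"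
    using assms(1-3) unfolding indices_4 by (auto simp: sgx_def sgy_def)
  show False using e b s half_side_pos by auto
qed

lemma square_inter_cases:
  assumes "i \<in> {1..5}" "j \<in> {1..5}" "i \<noteq> j" "x \<in> vicsek_square" "y \<in> vicsek_square" "vicsek_map i x = vicsek_map j y"
  shows "x \<in> vicsek_pt ` {1..4} \<and> y \<in> vicsek_pt ` {1..4} \<and> (i = 5 \<or> j = 5)"
proof (cases "i = 5 \<or> j = 5")
  case True
  then show ?thesis
  proof
    assume "i = 5"
    then have "j \<in> {1..4}" using assms by auto
    then show ?thesis using square_center_inter[of j x y] assms \<open>i = 5\<close> opp_in_4 by auto
  next
    assume "j = 5"
    then have "i \<in> {1..4}" using assms by auto
    then show ?thesis using square_center_inter[of i y x] assms \<open>j = 5\<close> opp_in_4 by auto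
  qed
next
  case False
  then have "i \<in> {1..4}" "j \<in> {1..4}" using assms by auto
  then show ?thesis using square_corner_disjoint assms by blast
qed

text \<open>Distinct cells of the first level meet in at most one point. This makes overlaps
  negligible both for length and for \<mu>.\<close>

lemma square_inter_same:
  assumes "i \<in> {1..5}" "j \<in> {1..5}" "i \<noteq> j" "x \<in> vicsek_square" "y \<in> vicsek_square" "vicsek_map i x = vicsek_map j y"
    "x' \<in> vicsek_square" "y' \<in> vicsek_square" "vicsek_map i x' = vicsek_map j y'"
  shows "x' = x"
proof -
  consider "i = 5" "j \<in> {1..4}" | "j = 5" "i \<in> {1..4}"
    using square_inter_cases[OF assms(1-6)] assms(1-3) by auto
  then show ?thesis
  proof cases
    case 1
    then show ?thesis using square_center_inter(1)[of j x y] square_center_inter(1)[of j x' y'] assms by auto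
  next
    case 2
    then show ?thesis using square_center_inter(2)[of i y x] square_center_inter(2)[of i y' x'] assms by auto
  qed
qed

section \<open>Words, cells and the cable systems\<close>

definition words :: "nat \<Rightarrow> nat list set" where
  "words n = {w. set w \<subseteq> {1..5} \<and> length w = n}"

abbreviation word_map :: "nat list \<Rightarrow> pt \<Rightarrow> pt" where
  "word_map \<equiv> foldr vicsek_map"

lemma finite_words [simp, intro]: "finite (words n)"
  unfolding words_def by (rule finite_lists_length_eq) simp

lemma card_words: "card (words n) = 5 ^ n"
  unfolding words_def by (subst card_lists_length_eq) auto

lemma words_0 [simp]: "words 0 = {[]}"
  by (auto simp: words_def)

lemma words_Suc: "words (Suc n) = (\<lambda>(i, w). i # w) ` ({1..5} \<times> words n)"
proof (intro set_eqI iffI)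
  fix w assume "w \<in> words (Suc n)"
  then obtain i v where "w = i # v" "i \<in> {1..5}" "v \<in> words n"
    by (cases w) (auto simp: words_def)
  then show "w \<in> (\<lambda>(i, w). i # w) ` ({1..5} \<times> words n)"
    by (intro image_eqI[of _ _ "(i, v)"]) auto
qed (auto simp: words_def)

lemma words_append: "w \<in> words n \<Longrightarrow> v \<in> words m \<Longrightarrow> w @ v \<in> words (n + m)"
  by (auto simp: words_def)

lemma words_snoc: "w \<in> words n \<Longrightarrow> i \<in> {1..5} \<Longrightarrow> w @ [i] \<in> words (Suc n)"
  by (auto simp: words_def)

lemma words_length: "w \<in> words n \<Longrightarrow> length w = n"
  by (auto simp: words_def)

lemma words_SucE:
  assumes "w \<in> words (Suc n)"
  obtains i v where "w = i # v" "i \<in> {1..5}" "v \<in> words n"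
  using assms by (auto simp: words_Suc)

lemma UN_words_Suc: "(\<Union>w\<in>words (Suc n). F w) = (\<Union>i\<in>{1..5}. \<Union>w\<in>words n. F (i # w))"
  unfolding words_Suc by auto

lemma image_words_Times: "(\<lambda>(w, j). G w j) ` (A \<times> J) = (\<Union>w\<in>A. G w ` J)"
  by auto

lemma image_words_Suc:
  "(\<lambda>(w, j). G w j) ` (words (Suc n) \<times> J) = (\<Union>i\<in>{1..5}. (\<lambda>(w, j). G (i # w) j) ` (words n \<times> J))"
  unfolding image_words_Times UN_words_Suc by simp

lemma sum_words_Suc: "(\<Sum>w\<in>words (Suc n). F w) = (\<Sum>i\<in>{1..5}. \<Sum>w\<in>words n. F (i # w))"
proof -
  have "(\<Sum>w\<in>words (Suc n). F w) = (\<Sum>x\<in>{1..5} \<times> words n. F (fst x # snd x))"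
    unfolding words_Suc by (subst sum.reindex) (auto simp: inj_on_def case_prod_beta)
  also have "\<dots> = (\<Sum>i\<in>{1..5}. \<Sum>w\<in>words n. F (i # w))"
    by (simp add: sum.cartesian_product case_prod_beta)
  finally show ?thesis .
qed

lemma word_map_affine: "word_map w z = word_map w 0 + (1/3) ^ length w *\<^sub>R z"
  by (induction w) (simp_all add: vicsek_map_eq scaleR_add_right)

lemma continuous_on_word_map [continuous_intros]:
  "continuous_on A g \<Longrightarrow> continuous_on A (\<lambda>x. word_map w (g x))"
  by (induction w) (auto intro!: continuous_intros)

lemma inj_word_map: "inj (word_map w)"
proof (rule injI)
  fix x y assume "word_map w x = word_map w y"
  then show "x = y" using word_map_affine[of w x] word_map_affine[of w y] by simp
qed

lemma word_map_square: "z \<in> vicsek_square \<Longrightarrow> word_map w z \<in> vicsek_square"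
  by (induction w) (auto intro: vicsek_map_square)

lemma word_map_segment: "word_map w ` closed_segment x y = closed_segment (word_map w x) (word_map w y)"
proof (induction w)
  case (Cons i w)
  have "word_map (i # w) ` closed_segment x y = vicsek_map i ` (word_map w ` closed_segment x y)"
    by (simp add: image_image)
  then show ?case by (simp add: Cons vicsek_map_segment)
qed simp

abbreviation arm :: "nat \<Rightarrow> pt set" where
  "arm i \<equiv> closed_segment 0 (vicsek_pt i)"

lemma arm_eq: "arm i = (\<lambda>t. t *\<^sub>R vicsek_pt i) ` {0..1}"
  by (auto simp: closed_segment_def)

lemma arm_square: "arm i \<subseteq> vicsek_square"
proof (rule closed_segment_subset)
  show "0 \<in> vicsek_square" using vicsek_pt_square[of 5] by simp
qed (auto intro: vicsek_pt_square convex_vicsek_square)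

lemma cable_0: "cable 0 = (\<Union>i\<in>{1..4}. arm i)"
  by simp

lemma edges_conv: "edges n = (\<lambda>(w, i). word_map w ` arm i) ` (words n \<times> {1..4})"
proof (induction n)
  case (Suc n)
  show ?case unfolding edges.simps Suc image_words_Suc by (simp add: image_image case_prod_beta)
next
  case 0
  show ?case unfolding image_words_Times by simp
qed

lemma cable_conv: "cable n = (\<Union>w\<in>words n. word_map w ` cable 0)"
proof (induction n)
  case (Suc n)
  have "(\<Union>w\<in>words (Suc n). word_map w ` cable 0) = (\<Union>i\<in>{1..5}. \<Union>w\<in>words n. vicsek_map i ` word_map w ` cable 0)"
    unfolding UN_words_Suc by (simp add: image_image del: cable.simps(1))
  also have "\<dots> = cable (Suc n)"
    unfolding cable.simps(2) Suc by (simp only: image_UN)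
  finally show ?case by (rule sym)
qed simp

lemma vertices_conv: "vertices n = (\<lambda>(w, i). word_map w (vicsek_pt i)) ` (words n \<times> {1..5})"
proof (induction n)
  case (Suc n)
  show ?case unfolding vertices.simps(2) Suc image_words_Suc by (simp add: image_image case_prod_beta)
next
  case 0
  show ?case unfolding image_words_Times by simp
qed

lemma cable_square: "cable n \<subseteq> vicsek_square"
proof -
  have "cable 0 \<subseteq> vicsek_square" unfolding cable_0 using arm_square by auto
  then show ?thesis unfolding cable_conv[of n] using word_map_square by blast
qed

lemma compact_cable: "compact (cable n)"
proof (induction n)
  case (Suc n)
  then show ?case unfolding cable.simps(2)
    by (intro compact_UN compact_continuous_image continuous_intros) auto
qed (auto simp: cable_0 simp del: cable.simps)

text \<open>The arm is cut at one third and two thirds of its length. The outer two thirds belong to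
  the corner cell i, whose centre is 2/3 q_i; the middle third therefore runs backwards from that
  centre, as its arm \<open>opp i\<close>.\<close>

lemma arm_subdivision:
  assumes "i \<in> {1..4}"
  shows "arm i = vicsek_map 5 ` arm i \<union> vicsek_map i ` arm (opp i) \<union> vicsek_map i ` arm i"
proof -
  have e: "vicsek_map 5 ` arm i = closed_segment 0 ((1/3) *\<^sub>R vicsek_pt i)"
    "vicsek_map i ` arm (opp i) = closed_segment ((2/3) *\<^sub>R vicsek_pt i) ((1/3) *\<^sub>R vicsek_pt i)"
    "vicsek_map i ` arm i = closed_segment ((2/3) *\<^sub>R vicsek_pt i) (vicsek_pt i)"
    unfolding vicsek_map_segment vicsek_map_opp[OF assms] vicsek_map_fixed
    by (simp_all add: vicsek_map_eq)
  have m: "(1/3) *\<^sub>R vicsek_pt i \<in> closed_segment 0 (vicsek_pt i)"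
    unfolding arm_eq by (intro image_eqI[where x = "1/3"]) auto
  have m2: "(2/3) *\<^sub>R vicsek_pt i \<in> closed_segment ((1/3) *\<^sub>R vicsek_pt i) (vicsek_pt i)"
    unfolding closed_segment_def by (rule CollectI, rule exI[of _ "1/2"]) (simp flip: scaleR_left_distrib)
  show ?thesis unfolding e
    using Un_closed_segment[OF m] Un_closed_segment[OF m2] by (simp add: closed_segment_commute Un_assoc)
qed

lemma cable_mono_Suc: "cable n \<subseteq> cable (Suc n)"
proof (induction n)
  case 0
  have "arm i \<subseteq> cable (Suc 0)" if "i \<in> {1..4}" for i
  proof -
    have "arm i \<subseteq> cable 0" "arm (opp i) \<subseteq> cable 0" "i \<in> {1..5}" "5 \<in> {1..5::nat}"
      using that opp_in_4[OF that] unfolding cable_0 by auto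
    then have "vicsek_map 5 ` arm i \<union> vicsek_map i ` arm (opp i) \<union> vicsek_map i ` arm i \<subseteq> cable (Suc 0)"
      unfolding cable.simps(2) by blast
    then show ?thesis by (rule ord_eq_le_trans[OF arm_subdivision[OF that]])
  qed
  then show ?case unfolding cable_0 by blast
next
  case (Suc n)
  have "cable (Suc n) = (\<Union>i\<in>{1..5}. vicsek_map i ` cable n)" by simp
  also have "\<dots> \<subseteq> (\<Union>i\<in>{1..5}. vicsek_map i ` cable (Suc n))"
    using Suc by (intro UN_mono image_mono) auto
  also have "\<dots> = cable (Suc (Suc n))" by simp
  finally show ?case .
qed

lemma cable_mono: "m \<le> n \<Longrightarrow> cable m \<subseteq> cable n"
  using lift_Suc_mono_le[of cable] cable_mono_Suc by blast

lemma vicsek_pt_cable: "i \<in> {1..5} \<Longrightarrow> vicsek_pt i \<in> cable n"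
proof -
  assume "i \<in> {1..5}"
  then have "vicsek_pt i \<in> cable 0" unfolding cable_0
    by (cases "i = 5") (auto intro: bexI[of _ i])
  then show ?thesis using cable_mono[of 0 n] by auto
qed

lemma cable_skeleton: "cable n \<subseteq> skeleton"
  by (auto simp: skeleton_def)

lemma vicsek_pt_skeleton: "i \<in> {1..5} \<Longrightarrow> vicsek_pt i \<in> skeleton"
  using vicsek_pt_cable cable_skeleton by blast

lemma skeleton_square: "skeleton \<subseteq> vicsek_square"
  using cable_square by (auto simp: skeleton_def)

lemma skeleton_selfsim: "skeleton = (\<Union>i\<in>{1..5}. vicsek_map i ` skeleton)"
proof -
  have "skeleton = (\<Union>n. cable (Suc n))"
    unfolding skeleton_def using cable_mono_Suc by blast
  also have "\<dots> = (\<Union>i\<in>{1..5}. vicsek_map i ` skeleton)"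
    unfolding skeleton_def cable.simps(2) by blast
  finally show ?thesis .
qed

lemma skeleton_words: "skeleton = (\<Union>w\<in>words n. word_map w ` skeleton)"
proof (induction n)
  case (Suc n)
  have "(\<Union>w\<in>words (Suc n). word_map w ` skeleton) = (\<Union>i\<in>{1..5}. \<Union>w\<in>words n. vicsek_map i ` word_map w ` skeleton)"
    unfolding UN_words_Suc by (simp add: image_image)
  also have "\<dots> = (\<Union>i\<in>{1..5}. vicsek_map i ` (\<Union>w\<in>words n. word_map w ` skeleton))"
    by (simp only: image_UN)
  also have "\<dots> = skeleton"
    unfolding Suc[symmetric] by (rule skeleton_selfsim[symmetric])
  finally show ?case by simp
qed simp

lemma word_map_skeleton: "w \<in> words n \<Longrightarrow> z \<in> skeleton \<Longrightarrow> word_map w z \<in> skeleton"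
  using skeleton_words[of n] by blast

lemma skeleton_borel [measurable]: "skeleton \<in> sets borel"
  unfolding skeleton_def using compact_cable by (intro sets.countable_UN') (auto intro: borel_compact)

text \<open>A point of B is the image of another point z of B, and the nearest point of K to z is
  carried into K by the same map. So the distance to K shrinks by 1/3 with each level and must
  vanish. The asymmetric hypotheses let it serve both inclusions in the uniqueness of K and the
  range of the coding map.\<close>

lemma selfsim_contraction:
  assumes "bounded B" "closed K" "K \<noteq> {}" "(\<Union>i\<in>I. vicsek_map i ` K) \<subseteq> K" "B \<subseteq> (\<Union>i\<in>I. vicsek_map i ` B)"
  shows "B \<subseteq> K"
proof (rule subsetI)
  fix x assume "x \<in> B"
  obtain k where k: "k \<in> K" using assms by auto
  obtain D where D: "\<And>y. y \<in> B \<Longrightarrow> dist k y \<le> D"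
    using assms(1) unfolding bounded_any_center[of B k] by auto
  have "\<forall>y\<in>B. infdist y K \<le> (1/3) ^ n * D" for n
  proof (induction n)
    case 0
    show ?case using D infdist_le[OF k] by (fastforce simp: dist_commute intro: order_trans)
  next
    case (Suc n)
    show ?case
    proof
      fix y assume "y \<in> B"
      then obtain i z where i: "i \<in> I" "z \<in> B" "y = vicsek_map i z" using assms(5) by blast
      obtain u where u: "u \<in> K" "infdist z K = dist z u"
        using infdist_attains_inf[OF assms(2,3)] by blast
      have "vicsek_map i u \<in> K" using assms(4) i u by blast
      then have "infdist y K \<le> dist y (vicsek_map i u)" by (rule infdist_le)
      also have "\<dots> = infdist z K / 3" using u i by (simp add: dist_vicsek_map)
      also have "\<dots> \<le> (1/3)^n * D / 3" using Suc i by auto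
      finally show "infdist y K \<le> (1/3) ^ Suc n * D" by simp
    qed
  qed
  moreover have "(\<lambda>n. (1/3) ^ n * D) \<longlonglongrightarrow> 0 * D"
    by (intro tendsto_intros LIMSEQ_realpow_zero) auto
  ultimately have "infdist x K \<le> 0"
    using \<open>x \<in> B\<close> by (intro LIMSEQ_le_const[where x = 0]) auto
  then have "infdist x K = 0" using infdist_nonneg[of x K] by linarith
  then show "x \<in> K" using assms in_closed_iff_infdist_zero by blast
qed

lemma closure_UN_finite: "finite I \<Longrightarrow> closure (\<Union>i\<in>I. A i) = (\<Union>i\<in>I. closure (A i))"
  by (induction I rule: finite_induct) auto

text \<open>The closure is invariant because closing commutes with finite unions and with each
  \<open>vicsek_map i\<close>. Uniqueness is the contraction argument in both directions.\<close>

lemma vicsek_set_eq: "vicsek_set = closure skeleton"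
  unfolding vicsek_set_def
proof (rule the_equality)
  have cl: "closure (vicsek_map i ` skeleton) = vicsek_map i ` closure skeleton" for i
  proof -
    have b: "bounded skeleton" using bounded_vicsek_square skeleton_square bounded_subset by blast
    have "compact (vicsek_map i ` closure skeleton)"
      using b by (intro compact_continuous_image continuous_intros) (simp add: compact_closure)
    then have "closure (vicsek_map i ` skeleton) \<subseteq> vicsek_map i ` closure skeleton"
      by (intro closure_minimal image_mono closure_subset compact_imp_closed)
    moreover have "vicsek_map i ` closure skeleton \<subseteq> closure (vicsek_map i ` skeleton)"
      by (rule continuous_image_closure_subset[of UNIV]) (auto intro!: continuous_intros)
    ultimately show ?thesis by blast
  qed
  have "closure skeleton = closure (\<Union>i\<in>{1..5}. vicsek_map i ` skeleton)"
    by (rule arg_cong[OF skeleton_selfsim])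
  also have "\<dots> = (\<Union>i\<in>{1..5}. vicsek_map i ` closure skeleton)"
    unfolding cl[symmetric] by (simp add: closure_UN_finite)
  finally have inv: "closure skeleton = (\<Union>i\<in>{1..5}. vicsek_map i ` closure skeleton)" .
  moreover have c: "compact (closure skeleton)"
    using bounded_vicsek_square skeleton_square bounded_subset compact_closure by blast
  moreover have ne: "closure skeleton \<noteq> {}"
    using vicsek_pt_skeleton[of 5] closure_subset by force
  ultimately show "compact (closure skeleton) \<and> closure skeleton \<noteq> {} \<and>
      closure skeleton = (\<Union>i\<in>{1..5}. vicsek_map i ` closure skeleton)" by blast
  fix K assume K: "compact K \<and> K \<noteq> {} \<and> K = (\<Union>i\<in>{1..5}. vicsek_map i ` K)"
  then have K1: "K \<subseteq> (\<Union>i\<in>{1..5}. vicsek_map i ` K)" and K2: "(\<Union>i\<in>{1..5}. vicsek_map i ` K) \<subseteq> K"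
    by (metis order_refl)+
  show "K = closure skeleton"
  proof
    show "K \<subseteq> closure skeleton"
      by (rule selfsim_contraction[OF _ _ ne equalityD2[OF inv] K1]) (use K in \<open>blast intro: compact_imp_bounded closed_closure\<close>)+
    show "closure skeleton \<subseteq> K"
      by (rule selfsim_contraction[OF _ _ _ K2 equalityD1[OF inv]]) (use K c in \<open>blast intro: compact_imp_bounded compact_imp_closed\<close>)+
  qed
qed

lemma compact_vicsek_set: "compact vicsek_set"
  unfolding vicsek_set_eq
  using bounded_vicsek_square skeleton_square bounded_subset compact_closure by blast

lemma skeleton_vicsek_set: "skeleton \<subseteq> vicsek_set"
  unfolding vicsek_set_eq by (rule closure_subset)

lemma vicsek_set_square: "vicsek_set \<subseteq> vicsek_square"
  unfolding vicsek_set_eq using skeleton_square closed_vicsek_square by (rule closure_minimal)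

lemma closure_word_map_skeleton: "closure (word_map w ` skeleton) = word_map w ` vicsek_set"
proof
  have "compact (word_map w ` vicsek_set)"
    using compact_vicsek_set by (intro compact_continuous_image continuous_intros)
  then show "closure (word_map w ` skeleton) \<subseteq> word_map w ` vicsek_set"
    by (intro closure_minimal image_mono skeleton_vicsek_set compact_imp_closed)
  show "word_map w ` vicsek_set \<subseteq> closure (word_map w ` skeleton)"
    unfolding vicsek_set_eq
    by (rule continuous_image_closure_subset[of UNIV]) (auto intro!: continuous_intros)
qed

lemma vicsek_set_words: "vicsek_set = (\<Union>w\<in>words n. word_map w ` vicsek_set)"
proof -
  have "vicsek_set = closure (\<Union>w\<in>words n. word_map w ` skeleton)"
    unfolding vicsek_set_eq by (rule arg_cong[OF skeleton_words])
  also have "\<dots> = (\<Union>w\<in>words n. closure (word_map w ` skeleton))"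
    by (simp add: closure_UN_finite)
  finally show ?thesis by (simp add: closure_word_map_skeleton)
qed

lemma word_map_vicsek_set: "w \<in> words n \<Longrightarrow> z \<in> vicsek_set \<Longrightarrow> word_map w z \<in> vicsek_set"
  using vicsek_set_words[of n] by blast

lemma vicsek_map_vicsek_set: "i \<in> {1..5} \<Longrightarrow> z \<in> vicsek_set \<Longrightarrow> vicsek_map i z \<in> vicsek_set"
  using word_map_vicsek_set[of "[i]" 1 z] by (simp add: words_def)

lemma vicsek_pt_vicsek_set: "i \<in> {1..5} \<Longrightarrow> vicsek_pt i \<in> vicsek_set"
  using vicsek_pt_skeleton skeleton_vicsek_set by blast

section \<open>The length measure\<close>

lemma sum_5: "(\<Sum>i\<in>{1..5::nat}. F i) = (\<Sum>i\<in>{1..4}. F i) + F 5" for F :: "nat \<Rightarrow> 'a::comm_monoid_add"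
proof -
  have "{1..5::nat} = insert 5 {1..4}" by auto
  then show ?thesis by (simp add: add.commute)
qed

lemma borel_vimage_vicsek_map [measurable]: "A \<in> sets borel \<Longrightarrow> vicsek_map i -` A \<in> sets borel"
proof -
  assume A: "A \<in> sets borel"
  have "vicsek_map i \<in> borel_measurable borel"
    by (intro borel_measurable_continuous_onI continuous_intros)
  from measurable_sets[OF this A] show ?thesis by simp
qed

lemma borel_arm_param [measurable]: "A \<in> sets borel \<Longrightarrow> {t\<in>{0..1::real}. t *\<^sub>R x \<in> A} \<in> sets borel"
  for x :: pt
proof -
  assume A: "A \<in> sets borel"
  have "(\<lambda>t. t *\<^sub>R x) \<in> borel_measurable borel" for x :: pt
    by (intro borel_measurable_continuous_onI continuous_intros)
  from measurable_sets[OF this A, of x] have "(\<lambda>t. t *\<^sub>R x) -` A \<in> sets borel" by simp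
  then have "{0..1} \<inter> (\<lambda>t. t *\<^sub>R x) -` A \<in> sets borel" by (intro sets.Int) auto
  also have "{0..1} \<inter> (\<lambda>t. t *\<^sub>R x) -` A = {t\<in>{0..1::real}. t *\<^sub>R x \<in> A}" by auto
  finally show ?thesis .
qed

text \<open>All that \<open>cable_length n\<close> sees of \<open>A\<close> is its trace on
  \<open>cable n\<close>. This lets preimages of arms be replaced by unions of arms later
  on.\<close>

lemma cable_length_mono:
  assumes "A \<inter> cable n \<subseteq> B" "B \<in> sets borel"
  shows "cable_length n A \<le> cable_length n B"
  using assms
proof (induction n arbitrary: A B)
  case 0
  have "{t\<in>{0..1::real}. t *\<^sub>R vicsek_pt i \<in> A} \<subseteq> {t\<in>{0..1::real}. t *\<^sub>R vicsek_pt i \<in> B}" if "i \<in> {1..4}" for i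
  proof (rule subsetI, clarify)
    fix t assume t: "t \<in> {0..1::real}" "t *\<^sub>R vicsek_pt i \<in> A"
    then have "t *\<^sub>R vicsek_pt i \<in> arm i" by (auto simp: arm_eq)
    then have "t *\<^sub>R vicsek_pt i \<in> cable 0" using that unfolding cable_0 by blast
    then show "t *\<^sub>R vicsek_pt i \<in> B" using 0 t by auto
  qed
  then show ?case using 0 unfolding cable_length.simps
    by (intro sum_mono emeasure_mono) auto
next
  case (Suc n)
  have "cable_length n (vicsek_map i -` A) \<le> cable_length n (vicsek_map i -` B)" if "i \<in> {1..5}" for i
  proof (rule Suc.IH)
    show "vicsek_map i -` A \<inter> cable n \<subseteq> vicsek_map i -` B" using Suc.prems(1) that unfolding cable.simps(2) by blast
  qed (use Suc.prems in measurable)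
  then show ?case unfolding cable_length.simps by (intro sum_mono mult_left_mono) auto
qed

lemma cable_length_null:
  assumes "A \<inter> cable n \<subseteq> {x}"
  shows "cable_length n A = 0"
  using assms
proof (induction n arbitrary: A x)
  case 0
  have "emeasure lborel {t\<in>{0..1::real}. t *\<^sub>R vicsek_pt i \<in> A} = 0" if i: "i \<in> {1..4}" for i
  proof -
    have "t = s" if "t \<in> {0..1::real}" "t *\<^sub>R vicsek_pt i \<in> A" "s \<in> {0..1::real}" "s *\<^sub>R vicsek_pt i \<in> A" for s t
    proof -
      have "t *\<^sub>R vicsek_pt i \<in> cable 0" "s *\<^sub>R vicsek_pt i \<in> cable 0"
        using that i unfolding cable_0 arm_eq by blast+
      then have "t *\<^sub>R vicsek_pt i = s *\<^sub>R vicsek_pt i" using 0 that(2,4) by blast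
      then show ?thesis using vicsek_pt_nonzero[OF i] by simp
    qed
    \<comment> \<open>If the set on the left is empty, the description denotes an arbitrary number
      and the inclusion still holds.\<close>
    then have "{t\<in>{0..1::real}. t *\<^sub>R vicsek_pt i \<in> A} \<subseteq> {THE t. t \<in> {0..1} \<and> t *\<^sub>R vicsek_pt i \<in> A}"
      by (auto intro!: the_equality[symmetric])
    then have "emeasure lborel {t\<in>{0..1::real}. t *\<^sub>R vicsek_pt i \<in> A} \<le> emeasure lborel {THE t. t \<in> {0..1::real} \<and> t *\<^sub>R vicsek_pt i \<in> A}"
      by (rule emeasure_mono) simp
    then show ?thesis by simp
  qed
  then show ?case by simp
next
  case (Suc n)
  have "cable_length n (vicsek_map i -` A) = 0" if "i \<in> {1..5}" for i
  proof -
    have "\<exists>y. vicsek_map i -` A \<inter> cable n \<subseteq> {y}"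
    proof (cases "vicsek_map i -` A \<inter> cable n = {}")
      case False
      then obtain y where y: "vicsek_map i y \<in> A" "y \<in> cable n" by blast
      have "z = y" if z: "vicsek_map i z \<in> A" "z \<in> cable n" for z
      proof -
        have "vicsek_map i y \<in> cable (Suc n)" "vicsek_map i z \<in> cable (Suc n)"
          using y z \<open>i \<in> {1..5}\<close> unfolding cable.simps(2) by blast+
        then have "vicsek_map i z = vicsek_map i y" using y z Suc.prems by blast
        then show ?thesis using vicsek_map_inj by (simp add: inj_eq)
      qed
      then show ?thesis by (intro exI[of _ y]) auto
    qed auto
    then show ?thesis using Suc.IH by blast
  qed
  then show ?case by simp
qed

lemma cable_length_countably_additive:
  assumes "range A \<subseteq> sets borel" "disjoint_family A"
  shows "(\<Sum>k. cable_length n (A k)) = cable_length n (\<Union>k. A k)"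
  using assms
proof (induction n arbitrary: A)
  case 0
  have "(\<Sum>k. emeasure lborel {t\<in>{0..1::real}. t *\<^sub>R vicsek_pt i \<in> A k})
      = emeasure lborel {t\<in>{0..1::real}. t *\<^sub>R vicsek_pt i \<in> (\<Union>k. A k)}" for i
  proof -
    have "(\<Sum>k. emeasure lborel {t\<in>{0..1::real}. t *\<^sub>R vicsek_pt i \<in> A k})
      = emeasure lborel (\<Union>k. {t\<in>{0..1::real}. t *\<^sub>R vicsek_pt i \<in> A k})"
      using 0 by (intro suminf_emeasure) (auto simp: disjoint_family_on_def)
    also have "(\<Union>k. {t\<in>{0..1::real}. t *\<^sub>R vicsek_pt i \<in> A k}) = {t\<in>{0..1::real}. t *\<^sub>R vicsek_pt i \<in> (\<Union>k. A k)}"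
      by auto
    finally show ?thesis .
  qed
  then show ?case by (simp add: suminf_sum)
next
  case (Suc n)
  have "(\<Sum>k. cable_length n (vicsek_map i -` A k)) = cable_length n (vicsek_map i -` (\<Union>k. A k))" for i
    unfolding vimage_UN using Suc.prems
    by (intro Suc.IH) (auto simp: disjoint_family_on_def simp flip: vimage_Int)
  then show ?case by (simp add: suminf_sum ennreal_suminf_cmult)
qed

lemma cable_length_Un:
  assumes "A \<in> sets borel" "B \<in> sets borel"
  shows "cable_length n (A \<union> B) \<le> cable_length n A + cable_length n B"
  using assms
proof (induction n arbitrary: A B)
  case 0
  have "emeasure lborel {t\<in>{0..1::real}. t *\<^sub>R x \<in> A \<union> B}
     \<le> emeasure lborel {t\<in>{0..1::real}. t *\<^sub>R x \<in> A} + emeasure lborel {t\<in>{0..1::real}. t *\<^sub>R x \<in> B}" for x :: pt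
  proof -
    have "{t\<in>{0..1::real}. t *\<^sub>R x \<in> A \<union> B} = {t\<in>{0..1::real}. t *\<^sub>R x \<in> A} \<union> {t\<in>{0..1::real}. t *\<^sub>R x \<in> B}"
      by auto
    then show ?thesis using 0 by (simp add: emeasure_subadditive)
  qed
  then show ?case unfolding cable_length.simps sum.distrib[symmetric] by (rule sum_mono)
next
  case (Suc n)
  have "ennreal (1/3) * cable_length n (vicsek_map i -` (A \<union> B))
     \<le> ennreal (1/3) * cable_length n (vicsek_map i -` A) + ennreal (1/3) * cable_length n (vicsek_map i -` B)" for i
    unfolding distrib_left[symmetric] vimage_Un using Suc by (intro mult_left_mono Suc.IH) auto
  then show ?case unfolding cable_length.simps sum.distrib[symmetric] by (rule sum_mono)
qed

lemma emeasure_lborel_real_affine: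
  fixes B :: "real set"
  assumes "B \<in> sets borel" "c \<noteq> 0"
  shows "emeasure lborel B = ennreal \<bar>c\<bar> * emeasure lborel {t. a + c * t \<in> B}"
proof -
  have "emeasure lborel B = (\<integral>\<^sup>+x. indicator B x \<partial>lborel)" using assms by simp
  also have "\<dots> = ennreal \<bar>c\<bar> * (\<integral>\<^sup>+x. indicator B (a + c * x) \<partial>lborel)"
    using assms by (intro nn_integral_real_affine) auto
  also have "(\<integral>\<^sup>+x. indicator B (a + c * x) \<partial>lborel) = (\<integral>\<^sup>+x. indicator {t. a + c * t \<in> B} x \<partial>lborel)"
    by (intro nn_integral_cong) (auto simp: indicator_def)
  also have "\<dots> = emeasure lborel {t. a + c * t \<in> B}"
  proof -
    have "(\<lambda>t. a + c * t) \<in> borel_measurable borel" by measurable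
    from measurable_sets[OF this assms(1)] have "{t. a + c * t \<in> B} \<in> sets borel"
      by (simp add: vimage_def)
    then show ?thesis by simp
  qed
  finally show ?thesis .
qed

text \<open>Measure form of \<open>arm_subdivision\<close>. The three thirds are parametrised by
  t/3, 2/3 - t/3 and 2/3 + t/3, the minus sign again coming from the middle third that runs
  backwards. An inequality suffices here, so the shared end points cause no trouble.\<close>

lemma arm_param_subdivision:
  assumes "i \<in> {1..4}" "A \<in> sets borel"
  shows "emeasure lborel {t\<in>{0..1::real}. t *\<^sub>R vicsek_pt i \<in> A} \<le>
     ennreal (1/3) * emeasure lborel {t\<in>{0..1::real}. t *\<^sub>R vicsek_pt i \<in> vicsek_map 5 -` A}
   + (ennreal (1/3) * emeasure lborel {t\<in>{0..1::real}. t *\<^sub>R vicsek_pt (opp i) \<in> vicsek_map i -` A}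
   + ennreal (1/3) * emeasure lborel {t\<in>{0..1::real}. t *\<^sub>R vicsek_pt i \<in> vicsek_map i -` A})"
proof -
  define T where "T = {t\<in>{0..1::real}. t *\<^sub>R vicsek_pt i \<in> A}"
  have T[measurable]: "T \<in> sets borel" unfolding T_def using assms by measurable
  have m: "vicsek_map 5 (t *\<^sub>R vicsek_pt i) = (0 + (1/3) * t) *\<^sub>R vicsek_pt i"
    "vicsek_map i (t *\<^sub>R vicsek_pt (opp i)) = (2/3 + (-1/3) * t) *\<^sub>R vicsek_pt i"
    "vicsek_map i (t *\<^sub>R vicsek_pt i) = (2/3 + (1/3) * t) *\<^sub>R vicsek_pt i" for t
    by (simp_all add: vicsek_map_eq vicsek_pt_opp[OF assms(1)] prod_eq_iff algebra_simps)
  have "T = (T \<inter> {0..1/3}) \<union> ((T \<inter> {1/3..2/3}) \<union> (T \<inter> {2/3..1}))"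
    unfolding T_def by auto
  then have "emeasure lborel T = emeasure lborel ((T \<inter> {0..1/3}) \<union> ((T \<inter> {1/3..2/3}) \<union> (T \<inter> {2/3..1})))"
    by (rule arg_cong)
  also have "\<dots> \<le> emeasure lborel (T \<inter> {0..1/3}) + emeasure lborel ((T \<inter> {1/3..2/3}) \<union> (T \<inter> {2/3..1}))"
    by (rule emeasure_subadditive) auto
  also have "\<dots> \<le> emeasure lborel (T \<inter> {0..1/3}) + (emeasure lborel (T \<inter> {1/3..2/3}) + emeasure lborel (T \<inter> {2/3..1}))"
    by (intro add_left_mono emeasure_subadditive) auto
  finally have "emeasure lborel T \<le> emeasure lborel (T \<inter> {0..1/3}) + (emeasure lborel (T \<inter> {1/3..2/3}) + emeasure lborel (T \<inter> {2/3..1}))" .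
  moreover have "emeasure lborel (T \<inter> {0..1/3}) = ennreal (1/3) * emeasure lborel {t. 0 + (1/3) * t \<in> T \<inter> {0..1/3}}"
    using emeasure_lborel_real_affine[of "T \<inter> {0..1/3}" "1/3" 0] by simp
  moreover have "{t. 0 + (1/3) * t \<in> T \<inter> {0..1/3}} = {t\<in>{0..1::real}. t *\<^sub>R vicsek_pt i \<in> vicsek_map 5 -` A}"
    unfolding T_def vimage_def mem_Collect_eq m by auto
  moreover have "emeasure lborel (T \<inter> {1/3..2/3}) = ennreal (1/3) * emeasure lborel {t. 2/3 + (-1/3) * t \<in> T \<inter> {1/3..2/3}}"
    using emeasure_lborel_real_affine[of "T \<inter> {1/3..2/3}" "-1/3" "2/3"] by simp
  moreover have "{t. 2/3 + (-1/3) * t \<in> T \<inter> {1/3..2/3}} = {t\<in>{0..1::real}. t *\<^sub>R vicsek_pt (opp i) \<in> vicsek_map i -` A}"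
    unfolding T_def vimage_def mem_Collect_eq m by auto
  moreover have "emeasure lborel (T \<inter> {2/3..1}) = ennreal (1/3) * emeasure lborel {t. 2/3 + (1/3) * t \<in> T \<inter> {2/3..1}}"
    using emeasure_lborel_real_affine[of "T \<inter> {2/3..1}" "1/3" "2/3"] by simp
  moreover have "{t. 2/3 + (1/3) * t \<in> T \<inter> {2/3..1}} = {t\<in>{0..1::real}. t *\<^sub>R vicsek_pt i \<in> vicsek_map i -` A}"
    unfolding T_def vimage_def mem_Collect_eq m by auto
  ultimately show ?thesis unfolding T_def[symmetric] by simp
qed

text \<open>At level 0 the three thirds of arm i are the terms (5, i), (i, opp i) and (i, i) of the
  sum over cells and arms of level 1. No term is used twice and the remaining ones are nonnegative.
  Higher levels follow by applying this inside each cell.\<close>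

lemma cable_length_incr:
  assumes "A \<in> sets borel"
  shows "cable_length n A \<le> cable_length (Suc n) A"
  using assms
proof (induction n arbitrary: A)
  case 0
  define F where "F i j = ennreal (1/3) * emeasure lborel {t\<in>{0..1::real}. t *\<^sub>R vicsek_pt j \<in> vicsek_map i -` A}" for i j
  have "cable_length 0 A \<le> (\<Sum>i\<in>{1..4}. F 5 i + (F i (opp i) + F i i))"
    unfolding cable_length.simps F_def using 0 by (intro sum_mono arm_param_subdivision)
  also have "\<dots> \<le> (\<Sum>i\<in>{1..4}. F 5 i + (\<Sum>j\<in>{1..4}. F i j))"
  proof (intro sum_mono add_left_mono)
    fix i :: nat assume i: "i \<in> {1..4}"
    have "F i (opp i) + F i i = (\<Sum>j\<in>{opp i, i}. F i j)" using opp_neq[OF i] by simp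
    also have "\<dots> \<le> (\<Sum>j\<in>{1..4}. F i j)" using i opp_in_4[OF i] by (intro sum_mono2) auto
    finally show "F i (opp i) + F i i \<le> (\<Sum>j\<in>{1..4}. F i j)" .
  qed
  also have "\<dots> = (\<Sum>i\<in>{1..5}. \<Sum>j\<in>{1..4}. F i j)"
    unfolding sum_5 by (simp add: sum.distrib add.commute)
  also have "\<dots> = cable_length (Suc 0) A"
    by (simp add: F_def sum_distrib_left)
  finally show ?case .
next
  case (Suc n)
  have "ennreal (1/3) * cable_length n (vicsek_map i -` A) \<le> ennreal (1/3) * cable_length (Suc n) (vicsek_map i -` A)" for i
    using Suc by (intro mult_left_mono Suc.IH) auto
  then have "(\<Sum>i\<in>{1..5}. ennreal (1/3) * cable_length n (vicsek_map i -` A))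
    \<le> (\<Sum>i\<in>{1..5}. ennreal (1/3) * cable_length (Suc n) (vicsek_map i -` A))" by (rule sum_mono)
  then show ?case by (simp only: cable_length.simps(2)[symmetric])
qed

lemma incseq_cable_length: "A \<in> sets borel \<Longrightarrow> incseq (\<lambda>n. cable_length n A)"
  by (intro incseq_SucI cable_length_incr)

section \<open>The length measure as an increasing limit, and its self-similarity\<close>

lemma sets_length_measure [measurable_cong]: "sets length_measure = sets (restrict_space borel skeleton)"
proof -
  have "sets (restrict_space borel skeleton) \<subseteq> Pow skeleton"
    by (auto simp: sets_restrict_space)
  moreover have "sigma_sets skeleton (sets (restrict_space borel skeleton)) = sets (restrict_space borel skeleton)"
    using sets.sigma_sets_eq[of "restrict_space borel skeleton"] by (simp add: space_restrict_space)
  ultimately show ?thesis unfolding length_measure_def by (simp add: sets_measure_of)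
qed

lemma sets_length_measure_iff: "A \<in> sets length_measure \<longleftrightarrow> A \<in> sets borel \<and> A \<subseteq> skeleton"
  unfolding sets_length_measure by (subst sets_restrict_space_iff) auto

text \<open>Countable additivity survives the supremum because the levels increase, so that the
  supremum may be exchanged with the series. Without it \<open>measure_of\<close> would default to
  the zero measure.\<close>

lemma emeasure_length_measure_eq:
  assumes "A \<in> sets length_measure"
  shows "emeasure length_measure A = (SUP n. cable_length n A)"
proof -
  have "countably_additive (sets length_measure) (\<lambda>A. SUP n. cable_length n A)"
  proof (rule countably_additiveI)
    fix A :: "nat \<Rightarrow> pt set" assume A: "range A \<subseteq> sets length_measure" "disjoint_family A"
    then have b: "range A \<subseteq> sets borel" by (auto simp: sets_length_measure_iff)
    have "(\<Sum>k. SUP n. cable_length n (A k)) = (SUP n. \<Sum>k. cable_length n (A k))"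
      using b by (intro ennreal_suminf_SUP_eq incseq_cable_length) auto
    also have "\<dots> = (SUP n. cable_length n (\<Union>k. A k))"
      using cable_length_countably_additive[OF b A(2)] by simp
    finally show "(\<Sum>k. SUP n. cable_length n (A k)) = (SUP n. cable_length n (\<Union>k. A k))" .
  qed
  moreover have "positive (sets length_measure) (\<lambda>A. SUP n. cable_length n A)"
    by (auto simp: positive_def cable_length_null)
  ultimately show ?thesis
    by (intro emeasure_measure_of[OF length_measure_def]) (use assms in \<open>auto simp: sets_restrict_space\<close>)
qed

lemma emeasure_length_measure:
  assumes "A \<in> sets borel"
  shows "emeasure length_measure (A \<inter> skeleton) = (SUP n. cable_length n A)"
proof -
  have "cable_length n (A \<inter> skeleton) = cable_length n A" for n
    using assms cable_skeleton[of n] by (intro antisym cable_length_mono) auto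
  then show ?thesis
    using assms by (subst emeasure_length_measure_eq) (auto simp: sets_length_measure_iff)
qed

lemma cable_length_LIMSEQ:
  assumes "A \<in> sets borel"
  shows "(\<lambda>n. cable_length n A) \<longlonglongrightarrow> emeasure length_measure (A \<inter> skeleton)"
  unfolding emeasure_length_measure[OF assms] using incseq_cable_length[OF assms] by (rule LIMSEQ_SUP)

text \<open>The recursion defining \<open>cable_length\<close>, passed to the limit: shifting the
  level by one does not change the limit on the left.\<close>

lemma length_measure_selfsim:
  assumes "A \<in> sets borel"
  shows "emeasure length_measure (A \<inter> skeleton) =
    (\<Sum>i\<in>{1..5}. ennreal (1/3) * emeasure length_measure (vicsek_map i -` A \<inter> skeleton))"
proof (rule LIMSEQ_unique)
  show "(\<lambda>n. cable_length (Suc n) A) \<longlonglongrightarrow> emeasure length_measure (A \<inter> skeleton)"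
    by (rule LIMSEQ_Suc[OF cable_length_LIMSEQ[OF assms]])
  show "(\<lambda>n. cable_length (Suc n) A) \<longlonglongrightarrow>
    (\<Sum>i\<in>{1..5}. ennreal (1/3) * emeasure length_measure (vicsek_map i -` A \<inter> skeleton))"
    unfolding cable_length.simps using assms
    by (intro tendsto_sum ennreal_tendsto_cmult cable_length_LIMSEQ) auto
qed

lemma length_measure_singleton:
  assumes "A \<subseteq> {x}"
  shows "emeasure length_measure A = 0"
proof (cases "A \<subseteq> skeleton")
  case True
  have "A = {} \<or> A = {x}" using assms by auto
  then have "A \<in> sets length_measure" using True by (auto simp: sets_length_measure_iff)
  moreover have "cable_length n A = 0" for n using assms by (intro cable_length_null[of _ _ x]) auto
  ultimately show ?thesis by (simp add: emeasure_length_measure_eq)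
next
  case False
  then have "A \<notin> sets length_measure" by (auto simp: sets_length_measure_iff)
  then show ?thesis by (rule emeasure_notin_sets)
qed

lemma borel_image_vicsek_map:
  assumes "A \<in> sets borel" shows "vicsek_map i ` A \<in> sets borel"
proof -
  have "(\<lambda>z. 3 *\<^sub>R z - 2 *\<^sub>R vicsek_pt i) \<in> borel_measurable borel"
    by (intro borel_measurable_continuous_onI continuous_intros)
  from measurable_sets[OF this assms] have "(\<lambda>z. 3 *\<^sub>R z - 2 *\<^sub>R vicsek_pt i) -` A \<in> sets borel" by simp
  also have "(\<lambda>z. 3 *\<^sub>R z - 2 *\<^sub>R vicsek_pt i) -` A = vicsek_map i ` A"
  proof (intro set_eqI iffI)
    fix z assume "z \<in> (\<lambda>z. 3 *\<^sub>R z - 2 *\<^sub>R vicsek_pt i) -` A"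
    moreover have "z = vicsek_map i (3 *\<^sub>R z - 2 *\<^sub>R vicsek_pt i)"
      by (simp add: vicsek_map_eq prod_eq_iff field_simps)
    ultimately show "z \<in> vicsek_map i ` A" by blast
  next
    fix z assume "z \<in> vicsek_map i ` A"
    then obtain y where "y \<in> A" "z = vicsek_map i y" by auto
    moreover have "3 *\<^sub>R vicsek_map i y - 2 *\<^sub>R vicsek_pt i = y"
      by (simp add: vicsek_map_eq prod_eq_iff field_simps)
    ultimately show "z \<in> (\<lambda>z. 3 *\<^sub>R z - 2 *\<^sub>R vicsek_pt i) -` A" by simp
  qed
  finally show ?thesis .
qed

lemma vicsek_map_skeleton: "i \<in> {1..5} \<Longrightarrow> z \<in> skeleton \<Longrightarrow> vicsek_map i z \<in> skeleton"
  using skeleton_selfsim by blast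

text \<open>In the self-similarity formula for the image, the term j = i returns A itself, while
  every other preimage has at most one point and is null.\<close>

lemma length_measure_vicsek_map:
  assumes "i \<in> {1..5}" "A \<in> sets length_measure"
  shows "vicsek_map i ` A \<in> sets length_measure"
    "emeasure length_measure (vicsek_map i ` A) = ennreal (1/3) * emeasure length_measure A"
proof -
  have A: "A \<in> sets borel" "A \<subseteq> skeleton" using assms by (auto simp: sets_length_measure_iff)
  have B: "vicsek_map i ` A \<in> sets borel" using borel_image_vicsek_map A by blast
  have sub: "vicsek_map i ` A \<subseteq> skeleton" using A assms(1) vicsek_map_skeleton by auto
  show "vicsek_map i ` A \<in> sets length_measure" using B sub by (simp add: sets_length_measure_iff)
  have "emeasure length_measure (vicsek_map i ` A) = emeasure length_measure (vicsek_map i ` A \<inter> skeleton)"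
    using sub by (simp add: Int_absorb2)
  also have "\<dots> = (\<Sum>j\<in>{1..5}. ennreal (1/3) * emeasure length_measure (vicsek_map j -` vicsek_map i ` A \<inter> skeleton))"
    by (rule length_measure_selfsim[OF B])
  also have "\<dots> = (\<Sum>j\<in>{1..5}. if j = i then ennreal (1/3) * emeasure length_measure A else 0)"
  proof (rule sum.cong)
    fix j :: nat assume j: "j \<in> {1..5}"
    show "ennreal (1/3) * emeasure length_measure (vicsek_map j -` vicsek_map i ` A \<inter> skeleton)
      = (if j = i then ennreal (1/3) * emeasure length_measure A else 0)"
    proof (cases "j = i")
      case True
      have "vicsek_map i -` vicsek_map i ` A \<inter> skeleton = A"
        using A vicsek_map_inj by (auto simp: inj_vimage_image_eq)
      then show ?thesis using True by simp
    next
      case False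
      have "\<exists>x. vicsek_map j -` vicsek_map i ` A \<inter> skeleton \<subseteq> {x}"
      proof (cases "vicsek_map j -` vicsek_map i ` A \<inter> skeleton = {}")
        case False
        then obtain x where "x \<in> vicsek_map j -` vicsek_map i ` A \<inter> skeleton" by blast
        then have "x \<in> skeleton" "vicsek_map j x \<in> vicsek_map i ` A" by simp_all
        then obtain y where x: "x \<in> skeleton" "y \<in> A" "vicsek_map j x = vicsek_map i y"
          by (elim imageE) blast
        have "x' = x" if "x' \<in> vicsek_map j -` vicsek_map i ` A \<inter> skeleton" for x'
        proof -
          have "x' \<in> skeleton" "vicsek_map j x' \<in> vicsek_map i ` A" using that by simp_all
          then obtain y' where x': "x' \<in> skeleton" "y' \<in> A" "vicsek_map j x' = vicsek_map i y'"
            by (elim imageE) blast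
          show ?thesis
            using square_inter_same[OF j assms(1) \<open>j \<noteq> i\<close> _ _ x(3) _ _ x'(3)] x x' A skeleton_square by blast
        qed
        then show ?thesis by blast
      qed auto
      then show ?thesis using False length_measure_singleton by auto
    qed
  qed simp
  also have "\<dots> = ennreal (1/3) * emeasure length_measure A" using assms(1) by simp
  finally show "emeasure length_measure (vicsek_map i ` A) = ennreal (1/3) * emeasure length_measure A" .
qed

lemma length_measure_word_map:
  assumes "w \<in> words n" "A \<in> sets length_measure"
  shows "word_map w ` A \<in> sets length_measure"
    "emeasure length_measure (word_map w ` A) = ennreal ((1/3) ^ n) * emeasure length_measure A"
proof -
  have "word_map w ` A \<in> sets length_measure \<and>
    emeasure length_measure (word_map w ` A) = ennreal ((1/3) ^ n) * emeasure length_measure A"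
    using assms(1)
  proof (induction n arbitrary: w)
    case (Suc n)
    obtain i v where w: "w = i # v" "i \<in> {1..5}" "v \<in> words n" using Suc.prems by (rule words_SucE)
    have e: "word_map w ` A = vicsek_map i ` word_map v ` A" unfolding w by (simp add: image_image)
    have "ennreal (1/3) * ennreal ((1/3) ^ n) = ennreal ((1/3) ^ Suc n)"
      by (subst ennreal_mult[symmetric]) auto
    then show ?case unfolding e using length_measure_vicsek_map[OF w(2)] Suc.IH[OF w(3)]
      by (simp add: mult.assoc[symmetric])
  qed (use assms in simp)
  then show "word_map w ` A \<in> sets length_measure"
    "emeasure length_measure (word_map w ` A) = ennreal ((1/3) ^ n) * emeasure length_measure A" by auto
qed

section \<open>Lengths of arms and edges\<close>

lemma scaleR_pt_square:
  assumes "i \<in> {1..4}" "t *\<^sub>R vicsek_pt i \<in> vicsek_square" shows "\<bar>t\<bar> \<le> 1"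
proof -
  have "sgx i = 1 \<or> sgx i = -1" using assms(1) unfolding indices_4 by (auto simp: sgx_def)
  then have "\<bar>t\<bar> * half_side \<le> 1 * half_side" using assms(2) half_side_pos
    by (auto simp: vicsek_square_def vicsek_pt_eq abs_mult)
  then show ?thesis using half_side_pos by (subst (asm) mult_le_cancel_right_pos)
qed

lemma vicsek_pt_arm_iff:
  assumes "i \<in> {1..4}" "j \<in> {1..4}" "vicsek_pt j \<in> arm i" shows "i = j"
proof -
  obtain t where t: "t \<in> {0..1}" "vicsek_pt j = t *\<^sub>R vicsek_pt i" using assms(3) by (auto simp: arm_eq)
  have "t = 1" using arg_cong[OF t(2), of norm] t(1) norm_vicsek_pt assms by simp
  then have "vicsek_pt j = vicsek_pt i" using t by simp
  then show ?thesis using assms(1,2) half_side_pos unfolding indices_4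
    by (auto simp: vicsek_pt_eq sgx_def sgy_def)
qed

lemma arm_inter:
  assumes "i \<in> {1..4}" "j \<in> {1..4}" "i \<noteq> j"
  shows "arm i \<inter> arm j \<subseteq> {0}"
proof
  fix z assume "z \<in> arm i \<inter> arm j"
  then obtain s t where st: "s \<in> {0..1}" "t \<in> {0..1}" "z = s *\<^sub>R vicsek_pt i" "z = t *\<^sub>R vicsek_pt j" by (auto simp: arm_eq)
  have "norm (s *\<^sub>R vicsek_pt i) = norm (t *\<^sub>R vicsek_pt j)" using st by simp
  then have e: "s = t" using st(1,2) unfolding norm_scaleR norm_vicsek_pt[OF assms(1)] norm_vicsek_pt[OF assms(2)] by auto
  show "z \<in> {0}"
  proof (cases "t = 0")
    case False
    then have "vicsek_pt i = vicsek_pt j" using st e by simp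
    then have "vicsek_pt j \<in> arm i" by (metis ends_in_segment(2))
    then show ?thesis using vicsek_pt_arm_iff[OF assms(1,2)] assms(3) by simp
  qed (use st in simp)
qed

text \<open>Together with the next two lemmas a converse of \<open>arm_subdivision\<close>: these
  determine which part of the square is sent into an arm by each map. The upper bound for the length
  of an arm depends on it.\<close>

lemma vimage_arm_center:
  assumes "i \<in> {1..4}" shows "vicsek_map 5 -` arm i \<inter> vicsek_square \<subseteq> arm i"
proof
  fix z assume "z \<in> vicsek_map 5 -` arm i \<inter> vicsek_square"
  then obtain t where t: "t \<in> {0..1}" "vicsek_map 5 z = t *\<^sub>R vicsek_pt i" "z \<in> vicsek_square" by (auto simp: arm_eq)
  have z: "z = (3 * t) *\<^sub>R vicsek_pt i" using t(2) by (simp add: vicsek_map_eq prod_eq_iff)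
  then have "3 * t \<le> 1" using scaleR_pt_square[OF assms, of "3 * t"] t by auto
  then show "z \<in> arm i" using z t unfolding arm_eq by auto
qed

lemma vimage_arm_same:
  assumes "i \<in> {1..4}" shows "vicsek_map i -` arm i \<inter> vicsek_square \<subseteq> arm i \<union> arm (opp i)"
proof
  fix z assume "z \<in> vicsek_map i -` arm i \<inter> vicsek_square"
  then obtain t where t: "t \<in> {0..1}" "vicsek_map i z = t *\<^sub>R vicsek_pt i" "z \<in> vicsek_square" by (auto simp: arm_eq)
  have z: "z = (3 * t - 2) *\<^sub>R vicsek_pt i" using t(2) by (simp add: vicsek_map_eq prod_eq_iff field_simps)
  then have b: "\<bar>3 * t - 2\<bar> \<le> 1" using scaleR_pt_square[OF assms, of "3 * t - 2"] t by auto
  show "z \<in> arm i \<union> arm (opp i)"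
  proof (cases "3 * t - 2 \<ge> 0")
    case True
    then have "z \<in> arm i" unfolding arm_eq z using b by (intro imageI) auto
    then show ?thesis by simp
  next
    case False
    have "z = (2 - 3 * t) *\<^sub>R vicsek_pt (opp i)" unfolding z vicsek_pt_opp[OF assms] by (simp add: prod_eq_iff algebra_simps)
    then have "z \<in> arm (opp i)" unfolding arm_eq using b False by (intro image_eqI[of _ _ "2 - 3 * t"]) auto
    then show ?thesis by simp
  qed
qed

lemma vimage_arm_other:
  assumes "i \<in> {1..4}" "j \<in> {1..4}" "j \<noteq> i" shows "vicsek_map j -` arm i \<inter> vicsek_square = {}"
proof (rule ccontr)
  assume "vicsek_map j -` arm i \<inter> vicsek_square \<noteq> {}"
  then obtain z where z: "z \<in> vicsek_square" "vicsek_map j z \<in> arm i" by blast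
  from z(2) have "vicsek_map j z \<in> vicsek_map 5 ` arm i \<union> vicsek_map i ` arm (opp i) \<union> vicsek_map i ` arm i"
    by (rule subsetD[OF equalityD1[OF arm_subdivision[OF assms(1)]]])
  then consider y where "y \<in> arm i" "vicsek_map j z = vicsek_map 5 y"
    | y where "y \<in> arm (opp i)" "vicsek_map j z = vicsek_map i y"
    | y where "y \<in> arm i" "vicsek_map j z = vicsek_map i y"
    by (elim UnE imageE) blast+
  then consider y where "y \<in> arm i" "vicsek_map j z = vicsek_map 5 y"
    | y where "y \<in> vicsek_square" "vicsek_map j z = vicsek_map i y"
    using arm_square[of i] arm_square[of "opp i"] by (metis subsetD)
  then show False
  proof cases
    case 1
    have "y \<in> vicsek_square" using 1(1) arm_square by blast
    then have "y = vicsek_pt j" by (rule square_center_inter(1)[OF assms(2) _ z(1) 1(2)[symmetric]])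
    then show ?thesis using vicsek_pt_arm_iff[of i j] 1 assms by simp
  next
    case 2
    then show ?thesis using square_corner_disjoint[of j i z y] assms z by auto
  qed
qed

lemma arm_borel [measurable]: "arm i \<in> sets borel"
  by (intro borel_compact compact_segment)

text \<open>The central cell contributes one arm, the corner cell i contributes two, all other cells
  nothing, and 1/3 * 1 + 1/3 * 2 = 1 closes the induction.\<close>

lemma cable_length_arm_le: "i \<in> {1..4} \<Longrightarrow> cable_length n (arm i) \<le> 1"
proof (induction n arbitrary: i)
  case 0
  have "emeasure lborel {t\<in>{0..1::real}. t *\<^sub>R vicsek_pt j \<in> arm i} \<le> (if j = i then 1 else 0)" if j: "j \<in> {1..4}" for j
  proof (cases "j = i")
    case True
    have "emeasure lborel {t\<in>{0..1::real}. t *\<^sub>R vicsek_pt j \<in> arm i} \<le> emeasure lborel {0..1::real}"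
      by (rule emeasure_mono) auto
    then show ?thesis using True by simp
  next
    case False
    have "{t\<in>{0..1::real}. t *\<^sub>R vicsek_pt j \<in> arm i} \<subseteq> {0}"
    proof (clarify, rule ccontr)
      fix t assume t: "t \<in> {0..1::real}" "t *\<^sub>R vicsek_pt j \<in> arm i" "t \<noteq> 0"
      then have "t *\<^sub>R vicsek_pt j \<in> arm j \<inter> arm i" by (auto simp: arm_eq)
      then have "t *\<^sub>R vicsek_pt j = 0" using arm_inter[OF j 0 False] by blast
      then show False using t vicsek_pt_nonzero[OF j] by simp
    qed
    then have "emeasure lborel {t\<in>{0..1::real}. t *\<^sub>R vicsek_pt j \<in> arm i} \<le> emeasure lborel {0::real}"
      by (rule emeasure_mono) auto
    then show ?thesis using False by simp
  qed
  then have "cable_length 0 (arm i) \<le> (\<Sum>j\<in>{1..4}. if j = i then 1 else 0)"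
    unfolding cable_length.simps by (rule sum_mono)
  then show ?case using 0 by simp
next
  case (Suc n)
  have sq: "A \<inter> cable n \<subseteq> A \<inter> vicsek_square" for A using cable_square by blast
  have c: "cable_length n (vicsek_map 5 -` arm i) \<le> 1"
    using cable_length_mono[of "vicsek_map 5 -` arm i" n "arm i"] sq vimage_arm_center[OF Suc.prems] Suc.IH[OF Suc.prems]
    by (meson arm_borel order_trans)
  have d: "cable_length n (vicsek_map j -` arm i) \<le> (if j = i then 2 else 0)" if "j \<in> {1..4}" for j
  proof (cases "j = i")
    case True
    have "cable_length n (vicsek_map i -` arm i) \<le> cable_length n (arm i \<union> arm (opp i))"
      using sq vimage_arm_same[OF Suc.prems] by (intro cable_length_mono) (blast, measurable)
    also have "\<dots> \<le> cable_length n (arm i) + cable_length n (arm (opp i))"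
      by (intro cable_length_Un) measurable
    also have "\<dots> \<le> 1 + 1" using Suc opp_in_4 by (intro add_mono) auto
    finally show ?thesis using True by simp
  next
    case False
    have "vicsek_map j -` arm i \<inter> cable n \<subseteq> {0}"
      using sq[of "vicsek_map j -` arm i"] vimage_arm_other[OF Suc.prems that False] by blast
    then show ?thesis using False by (simp add: cable_length_null)
  qed
  have "cable_length (Suc n) (arm i) \<le> (\<Sum>j\<in>{1..4}. ennreal (1/3) * (if j = i then 2 else 0)) + ennreal (1/3) * 1"
    unfolding cable_length.simps sum_5 using c d by (intro add_mono sum_mono mult_left_mono) auto
  also have "(\<Sum>j\<in>{1..4}. ennreal (1/3) * (if j = i then 2 else 0)) = ennreal (1/3) * 2"
    using Suc.prems by (subst sum.remove[of _ i]) (auto intro!: sum.neutral)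
  also have "ennreal (1/3) * 2 + ennreal (1/3) * 1 = ennreal (1/3) * ennreal 3"
    by (simp only: distrib_left[symmetric]) simp
  also have "\<dots> = 1" by (subst ennreal_mult[symmetric]) auto
  finally show ?case .
qed

text \<open>Level 0 already bounds the supremum over all levels from below.\<close>

lemma length_measure_param_ge:
  assumes "i \<in> {1..4}" "T \<in> sets borel" "T \<subseteq> {0..1}" "(\<lambda>t. t *\<^sub>R vicsek_pt i) ` T \<subseteq> A" "A \<in> sets length_measure"
  shows "emeasure lborel T \<le> emeasure length_measure A"
proof -
  have A: "A \<in> sets borel" using assms by (simp add: sets_length_measure_iff)
  have "emeasure lborel T \<le> emeasure lborel {t\<in>{0..1::real}. t *\<^sub>R vicsek_pt i \<in> A}"
    using assms A by (intro emeasure_mono) auto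
  also have "\<dots> \<le> cable_length 0 A"
    unfolding cable_length.simps using assms(1) by (intro member_le_sum) auto
  also have "\<dots> \<le> emeasure length_measure A"
    unfolding emeasure_length_measure_eq[OF assms(5)] by (rule SUP_upper) simp
  finally show ?thesis .
qed

lemma sets_length_measure_compact: "compact A \<Longrightarrow> A \<subseteq> skeleton \<Longrightarrow> A \<in> sets length_measure"
  by (simp add: sets_length_measure_iff borel_compact)

lemma arm_skeleton: "i \<in> {1..4} \<Longrightarrow> arm i \<subseteq> skeleton"
  using cable_skeleton[of 0] unfolding cable_0 by blast

text \<open>A squeeze: the initial piece has length at least s, the rest of the arm at least 1 - s,
  and the whole arm at most 1.\<close>

lemma length_measure_initial:
  assumes i: "i \<in> {1..4}" and s: "0 \<le> s" "s \<le> 1"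
  shows "emeasure length_measure (closed_segment 0 (s *\<^sub>R vicsek_pt i)) = ennreal s"
proof -
  have e: "closed_segment 0 (s *\<^sub>R vicsek_pt i) = (\<lambda>t. t *\<^sub>R vicsek_pt i) ` {0..s}"
  proof -
    have "closed_segment 0 (s *\<^sub>R vicsek_pt i) = (\<lambda>x. x *\<^sub>R vicsek_pt i) ` closed_segment 0 s"
      by (subst closed_segment_linear_image[symmetric]) auto
    then show ?thesis using s by (simp add: closed_segment_eq_real_ivl)
  qed
  define A where "A = closed_segment 0 (s *\<^sub>R vicsek_pt i)"
  have sub: "A \<subseteq> arm i" unfolding A_def e arm_eq using s by auto
  have A: "A \<in> sets length_measure"
    unfolding A_def using sub arm_skeleton[OF i] by (intro sets_length_measure_compact) (auto simp: A_def)
  have arm: "arm i \<in> sets length_measure" using arm_skeleton[OF i] by (intro sets_length_measure_compact) auto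
  have le1: "emeasure length_measure (arm i) \<le> 1"
    unfolding emeasure_length_measure_eq[OF arm] using cable_length_arm_le[OF i] by (intro SUP_least)
  have ge1: "ennreal s \<le> emeasure length_measure A"
    using length_measure_param_ge[OF i, of "{0..s}" A] A s unfolding A_def e by auto
  have ge2: "ennreal (1 - s) \<le> emeasure length_measure (arm i - A)"
  proof -
    have "(\<lambda>t. t *\<^sub>R vicsek_pt i) ` {s<..1} \<subseteq> arm i - A"
      unfolding A_def e arm_eq using s vicsek_pt_nonzero[OF i] by auto
    then have "emeasure lborel {s<..1} \<le> emeasure length_measure (arm i - A)"
      using A arm s by (intro length_measure_param_ge[OF i]) auto
    then show ?thesis using s by simp
  qed
  have "emeasure length_measure A + emeasure length_measure (arm i - A) = emeasure length_measure (arm i)"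
    using A arm sub by (subst plus_emeasure) (auto intro!: arg_cong[of _ _ "emeasure length_measure"])
  then have sum: "emeasure length_measure A + emeasure length_measure (arm i - A) \<le> 1" using le1 by simp
  have fin: "ennreal (1 - s) \<noteq> top" by simp
  have "emeasure length_measure A + ennreal (1 - s) \<le> ennreal s + ennreal (1 - s)"
    using order_trans[OF add_left_mono[OF ge2] sum] s by (simp flip: ennreal_plus)
  then have "emeasure length_measure A \<le> ennreal s"
    using ennreal_add_left_cancel_le[of "ennreal (1 - s)" "emeasure length_measure A" "ennreal s"] by (simp add: add.commute)
  then show ?thesis using ge1 unfolding A_def by (rule antisym)
qed

lemma length_measure_arm: "i \<in> {1..4} \<Longrightarrow> emeasure length_measure (arm i) = 1"
  using length_measure_initial[of i 1] by simp

lemma arm_sets: "i \<in> {1..4} \<Longrightarrow> arm i \<in> sets length_measure"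
  using arm_skeleton by (intro sets_length_measure_compact) auto

lemma edge_sets: "w \<in> words n \<Longrightarrow> i \<in> {1..4} \<Longrightarrow> word_map w ` arm i \<in> sets length_measure"
  using length_measure_word_map(1)[of w n "arm i"] arm_sets by blast

lemma length_measure_edge:
  "w \<in> words n \<Longrightarrow> i \<in> {1..4} \<Longrightarrow> emeasure length_measure (word_map w ` arm i) = ennreal ((1/3) ^ n)"
  using length_measure_word_map(2)[of w n "arm i"] length_measure_arm[of i] arm_sets by simp

lemma cable_sets: "cable n \<in> sets length_measure"
  using compact_cable cable_skeleton by (rule sets_length_measure_compact)

lemma length_measure_cable_finite: "emeasure length_measure (cable n) < \<infinity>"
proof -
  have e: "cable n = (\<Union>(w, i)\<in>words n \<times> {1..4}. word_map w ` arm i)"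
    unfolding cable_conv[of n] cable_0 by auto
  have "emeasure length_measure (cable n) \<le> (\<Sum>x\<in>words n \<times> {1..4}. emeasure length_measure (case x of (w, i) \<Rightarrow> word_map w ` arm i))"
    unfolding e by (rule emeasure_subadditive_finite) (auto intro: edge_sets)
  also have "\<dots> = (\<Sum>x\<in>words n \<times> {1..4::nat}. ennreal ((1/3) ^ n))"
    by (rule sum.cong) (auto simp: length_measure_edge)
  also have "\<dots> < \<infinity>" by (simp add: ennreal_sum_less_top del: sum_constant)
  finally show ?thesis .
qed

section \<open>Projection to lines: length dominates Euclidean distance\<close>

lemma emeasure_lborel_affine_image:
  fixes T :: "real set"
  assumes "compact T"
  shows "emeasure lborel ((\<lambda>t. c * t + a) ` T) = ennreal \<bar>c\<bar> * emeasure lborel T"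
proof -
  have "compact ((\<lambda>t. c * t + a) ` T)" using assms by (intro compact_continuous_image continuous_intros)
  then have "emeasure lborel ((\<lambda>t. c * t + a) ` T) = emeasure lebesgue ((\<lambda>t. c *\<^sub>R t + a) ` T)"
    by (simp add: borel_compact)
  also have "\<dots> = ennreal \<bar>c\<bar> * emeasure lebesgue T"
    by (subst emeasure_lebesgue_affine) simp
  finally show ?thesis using assms by (simp add: borel_compact)
qed

text \<open>Projection to a line does not increase length: this is clear on the straight arms, and
  each cell scales lengths and projections by the same factor 1/3.\<close>

lemma projection_le_cable_length:
  assumes "compact P" "P \<subseteq> cable n" "norm e \<le> 1"
  shows "emeasure lborel ((\<lambda>z. z \<bullet> e) ` P) \<le> cable_length n P"
  using assms(1,2)
proof (induction n arbitrary: P)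
  case 0
  define T where "T i = {t\<in>{0..1::real}. t *\<^sub>R vicsek_pt i \<in> P}" for i
  have T: "compact (T i)" for i
  proof -
    have "closed ({0..1} \<inter> (\<lambda>t. t *\<^sub>R vicsek_pt i) -` P)"
      using 0 by (intro continuous_closed_preimage continuous_intros) (auto simp: compact_imp_closed)
    moreover have "T i = {0..1} \<inter> (\<lambda>t. t *\<^sub>R vicsek_pt i) -` P" by (auto simp: T_def)
    ultimately show ?thesis by (auto simp: compact_eq_bounded_closed intro: bounded_subset[of "{0..1}"])
  qed
  have "(\<lambda>z. z \<bullet> e) ` P \<subseteq> (\<Union>i\<in>{1..4}. (\<lambda>t. (vicsek_pt i \<bullet> e) * t + 0) ` T i)"
  proof
    fix y assume "y \<in> (\<lambda>z. z \<bullet> e) ` P"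
    then obtain z where z: "z \<in> P" "y = z \<bullet> e" by auto
    then have "z \<in> cable 0" using 0 by auto
    then obtain i t where "i \<in> {1..4}" "t \<in> {0..1}" "z = t *\<^sub>R vicsek_pt i"
      unfolding cable_0 arm_eq by auto
    then show "y \<in> (\<Union>i\<in>{1..4}. (\<lambda>t. (vicsek_pt i \<bullet> e) * t + 0) ` T i)"
      using z by (auto simp: T_def intro!: bexI[of _ i] image_eqI[of _ _ t])
  qed
  then have "emeasure lborel ((\<lambda>z. z \<bullet> e) ` P) \<le> emeasure lborel (\<Union>i\<in>{1..4}. (\<lambda>t. (vicsek_pt i \<bullet> e) * t + 0) ` T i)"
    using T by (intro emeasure_mono) (auto intro!: borel_compact compact_continuous_image continuous_intros)
  also have "\<dots> \<le> (\<Sum>i\<in>{1..4}. emeasure lborel ((\<lambda>t. (vicsek_pt i \<bullet> e) * t + 0) ` T i))"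
    using T by (intro emeasure_subadditive_finite) (auto intro!: borel_compact compact_continuous_image continuous_intros)
  also have "\<dots> \<le> (\<Sum>i\<in>{1..4}. emeasure lborel (T i))"
  proof (rule sum_mono)
    fix i :: nat assume i: "i \<in> {1..4}"
    \<comment> \<open>The arm is a unit segment, so its projection is scaled by |q_i . e|; the
      factor is 0 for an arm orthogonal to e.\<close>
    have "\<bar>vicsek_pt i \<bullet> e\<bar> \<le> norm (vicsek_pt i) * norm e" by (rule Cauchy_Schwarz_ineq2)
    then have "\<bar>vicsek_pt i \<bullet> e\<bar> \<le> 1" using norm_vicsek_pt[OF i] assms(3) by simp
    then have "ennreal \<bar>vicsek_pt i \<bullet> e\<bar> * emeasure lborel (T i) \<le> 1 * emeasure lborel (T i)"
      by (intro mult_right_mono) (auto simp: ennreal_le_1)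
    then show "emeasure lborel ((\<lambda>t. (vicsek_pt i \<bullet> e) * t + 0) ` T i) \<le> emeasure lborel (T i)"
      using emeasure_lborel_affine_image[OF T, of "vicsek_pt i \<bullet> e" 0 i] by simp
  qed
  finally show ?case by (simp add: T_def)
next
  case (Suc n)
  define T where "T i = vicsek_map i -` P \<inter> cable n" for i
  have T: "compact (T i)" for i
  proof -
    have "closed (vicsek_map i -` P)"
      using Suc by (intro closed_vimage continuous_intros) (auto simp: compact_imp_closed)
    then show ?thesis unfolding T_def using compact_cable by (simp add: closed_Int_compact)
  qed
  have cT: "compact ((\<lambda>z. z \<bullet> e) ` T i)" for i
    using T by (intro compact_continuous_image continuous_intros)
  have "(\<lambda>z. z \<bullet> e) ` P \<subseteq> (\<Union>i\<in>{1..5}. (\<lambda>t. (1/3) * t + (2/3) * (vicsek_pt i \<bullet> e)) ` (\<lambda>z. z \<bullet> e) ` T i)"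
  proof
    fix y assume "y \<in> (\<lambda>z. z \<bullet> e) ` P"
    then obtain z where z: "z \<in> P" "y = z \<bullet> e" by auto
    then have "z \<in> cable (Suc n)" using Suc.prems by blast
    then obtain i u where i: "i \<in> {1..5}" "u \<in> cable n" "z = vicsek_map i u"
      unfolding cable.simps(2) by blast
    then have "u \<in> T i" using z by (simp add: T_def)
    moreover have "y = (1/3) * (u \<bullet> e) + (2/3) * (vicsek_pt i \<bullet> e)"
      unfolding z i vicsek_map_eq by (simp add: inner_add_left)
    ultimately show "y \<in> (\<Union>i\<in>{1..5}. (\<lambda>t. (1/3) * t + (2/3) * (vicsek_pt i \<bullet> e)) ` (\<lambda>z. z \<bullet> e) ` T i)"
      using i(1) by blast
  qed
  then have "emeasure lborel ((\<lambda>z. z \<bullet> e) ` P) \<le> emeasure lborel (\<Union>i\<in>{1..5}. (\<lambda>t. (1/3) * t + (2/3) * (vicsek_pt i \<bullet> e)) ` (\<lambda>z. z \<bullet> e) ` T i)"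
    using cT by (intro emeasure_mono) (auto intro!: borel_compact compact_continuous_image[of "(\<lambda>z. z \<bullet> e) ` _"] continuous_intros simp del: image_image)
  also have "\<dots> \<le> (\<Sum>i\<in>{1..5}. emeasure lborel ((\<lambda>t. (1/3) * t + (2/3) * (vicsek_pt i \<bullet> e)) ` (\<lambda>z. z \<bullet> e) ` T i))"
    using cT by (intro emeasure_subadditive_finite) (auto intro!: borel_compact compact_continuous_image[of "(\<lambda>z. z \<bullet> e) ` _"] continuous_intros simp del: image_image)
  also have "\<dots> \<le> (\<Sum>i\<in>{1..5}. ennreal (1/3) * cable_length n (vicsek_map i -` P))"
  proof (rule sum_mono)
    fix i :: nat assume i: "i \<in> {1..5}"
    have P: "vicsek_map i -` P \<in> sets borel" using Suc borel_compact by (intro borel_vimage_vicsek_map) auto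
    have "emeasure lborel ((\<lambda>z. z \<bullet> e) ` T i) \<le> cable_length n (T i)"
      using T by (intro Suc.IH) (auto simp: T_def)
    also have "\<dots> \<le> cable_length n (vicsek_map i -` P)"
      using P by (intro cable_length_mono) (auto simp: T_def)
    finally have "ennreal (1/3) * emeasure lborel ((\<lambda>z. z \<bullet> e) ` T i) \<le> ennreal (1/3) * cable_length n (vicsek_map i -` P)"
      by (rule mult_left_mono) simp
    then show "emeasure lborel ((\<lambda>t. (1/3) * t + (2/3) * (vicsek_pt i \<bullet> e)) ` (\<lambda>z. z \<bullet> e) ` T i) \<le> ennreal (1/3) * cable_length n (vicsek_map i -` P)"
      using emeasure_lborel_affine_image[OF cT, of "1/3" "(2/3) * (vicsek_pt i \<bullet> e)" i] by simp
  qed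
  finally show ?case by simp
qed

text \<open>Project to the line through x and y. A connected set that contains both points covers an
  interval of length \<open>dist x y\<close> there.\<close>

lemma dist_le_length_measure:
  assumes "compact P" "P \<subseteq> cable n" "connected P" "x \<in> P" "y \<in> P"
  shows "dist x y \<le> measure length_measure P"
proof -
  \<comment> \<open>The unit vector from x towards y, or 0 if the points coincide.\<close>
  define e where "e = sgn (y - x)"
  have e: "norm e \<le> 1" by (simp add: e_def norm_sgn)
  have d: "y \<bullet> e - x \<bullet> e = dist x y"
  proof -
    have "y \<bullet> e - x \<bullet> e = (y - x) \<bullet> sgn (y - x)" by (simp add: e_def inner_diff_left)
    also have "\<dots> = norm (y - x)" by (cases "y = x") (simp_all add: sgn_div_norm power2_norm_eq_inner[symmetric] power2_eq_square)
    finally show ?thesis by (simp add: dist_norm norm_minus_commute)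
  qed
  have P: "P \<in> sets length_measure" using assms cable_skeleton by (intro sets_length_measure_compact) auto
  have "connected ((\<lambda>z. z \<bullet> e) ` P)" using assms by (intro connected_continuous_image continuous_intros)
  then have "{x \<bullet> e .. y \<bullet> e} \<subseteq> (\<lambda>z. z \<bullet> e) ` P"
    by (rule connected_contains_Icc) (use assms in auto)
  moreover have "compact ((\<lambda>z. z \<bullet> e) ` P)" using assms by (intro compact_continuous_image continuous_intros)
  ultimately have "emeasure lborel {x \<bullet> e .. y \<bullet> e} \<le> emeasure lborel ((\<lambda>z. z \<bullet> e) ` P)"
    by (intro emeasure_mono) (auto simp: borel_compact)
  moreover have "emeasure lborel {x \<bullet> e .. y \<bullet> e} = ennreal (dist x y)"
    using d by (subst emeasure_lborel_Icc) (auto, smt (verit) zero_le_dist)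
  moreover have "emeasure lborel ((\<lambda>z. z \<bullet> e) ` P) \<le> emeasure length_measure P"
    using projection_le_cable_length[OF assms(1,2) e]
    by (subst emeasure_length_measure_eq[OF P]) (meson SUP_upper UNIV_I order_trans)
  moreover have "emeasure length_measure P < \<infinity>"
    using emeasure_mono[OF assms(2) cable_sets] length_measure_cable_finite[of n] by (rule le_less_trans)
  ultimately show ?thesis
    by (simp add: measure_def enn2real_mono enn2real_leI ennreal_enn2real_if) 
       (metis (no_types, lifting) enn2real_ennreal enn2real_mono order_trans zero_le_dist less_top)
qed

section \<open>Arcs and the geodesic distance\<close>

lemma arm_mem: "t \<in> {0..1} \<Longrightarrow> t *\<^sub>R vicsek_pt i \<in> arm i"
  unfolding arm_eq by (rule imageI)

text \<open>The uniqueness half of being a tree. It concerns images only, since reparametrised arcs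
  are different functions; existence of arcs comes separately from path connectedness.\<close>

definition unique_arcs :: "'a::topological_space set \<Rightarrow> bool" where
  "unique_arcs X \<longleftrightarrow> (\<forall>g h. arc g \<and> arc h \<and> path_image g \<subseteq> X \<and> path_image h \<subseteq> X \<and>
     pathstart g = pathstart h \<and> pathfinish g = pathfinish h \<longrightarrow> path_image g = path_image h)"

lemma unique_arcsD:
  "unique_arcs X \<Longrightarrow> arc g \<Longrightarrow> arc h \<Longrightarrow> path_image g \<subseteq> X \<Longrightarrow> path_image h \<subseteq> X \<Longrightarrow>
   pathstart g = pathstart h \<Longrightarrow> pathfinish g = pathfinish h \<Longrightarrow> path_image g = path_image h"
  unfolding unique_arcs_def by blast

text \<open>The image of [s,t] is connected and covered by two closed sets that it meets both, so it
  contains a common point of them, which can only be c.\<close>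

lemma arc_meets_gate:
  fixes g :: "real \<Rightarrow> 'a::t2_space"
  assumes "closed A" "closed B" "A \<inter> B \<subseteq> {c}" "arc g" "path_image g \<subseteq> A \<union> B"
    and s: "0 \<le> s" "s \<le> t" "t \<le> 1" and "g s \<in> A \<and> g t \<in> B \<or> g s \<in> B \<and> g t \<in> A"
  shows "\<exists>r\<in>{s..t}. g r = c \<and> c \<in> A \<and> c \<in> B"
proof -
  have "continuous_on {s..t} g" using assms(4) s unfolding arc_def path_def
    by (auto intro: continuous_on_subset)
  then have "connected (g ` {s..t})" by (rule connected_continuous_image) simp
  moreover have "g ` {s..t} \<subseteq> A \<union> B" using assms(5) s unfolding path_image_def by (force simp: image_subset_iff)
  moreover have "A \<inter> g ` {s..t} \<noteq> {}" "B \<inter> g ` {s..t} \<noteq> {}" using assms(9) s by force+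
  ultimately have "A \<inter> B \<inter> g ` {s..t} \<noteq> {}"
    using assms(1,2) unfolding connected_closed by blast
  then show ?thesis using assms(3) by blast
qed

text \<open>Leaving A and returning to it would pass the gate c twice, which injectivity of the arc
  forbids.\<close>

lemma arc_stays:
  fixes g :: "real \<Rightarrow> 'a::t2_space"
  assumes "closed A" "closed B" "A \<inter> B \<subseteq> {c}" "arc g" "path_image g \<subseteq> A \<union> B" "pathstart g \<in> A" "pathfinish g \<in> A"
  shows "path_image g \<subseteq> A"
proof (rule ccontr)
  assume "\<not> path_image g \<subseteq> A"
  then obtain t where t: "t \<in> {0..1}" "g t \<notin> A" unfolding path_image_def by blast
  then have B: "g t \<in> B" using assms(5) unfolding path_image_def by blast
  obtain r where r: "r \<in> {0..t}" "g r = c" "c \<in> A"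
    using arc_meets_gate[OF assms(1-5), of 0 t] t B assms(6) by (auto simp: pathstart_def)
  obtain r' where r': "r' \<in> {t..1}" "g r' = c"
    using arc_meets_gate[OF assms(1-5), of t 1] t B assms(7) by (auto simp: pathfinish_def)
  have "r = r'" using r r' t assms(4) unfolding arc_def by (auto dest: inj_onD)
  then have "g t = c" using r r' by auto
  then show False using t r by simp
qed

text \<open>The arc is cut at the parameter where it passes c. Neither end point lies in both sets,
  so the cut is interior and both pieces are arcs; each stays on its side by
  \<open>arc_stays\<close>.\<close>

lemma arc_through_gate:
  fixes g :: "real \<Rightarrow> 'a::real_normed_vector"
  assumes "closed A" "closed B" "A \<inter> B \<subseteq> {c}" "arc g" "path_image g \<subseteq> A \<union> B"
    "pathstart g \<in> A" "pathstart g \<notin> B" "pathfinish g \<in> B" "pathfinish g \<notin> A"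
  obtains g1 g2 where "arc g1" "arc g2" "path_image g1 \<subseteq> A" "path_image g2 \<subseteq> B" "pathstart g1 = pathstart g"
    "pathfinish g1 = c" "pathstart g2 = c" "pathfinish g2 = pathfinish g" "path_image g = path_image g1 \<union> path_image g2"
proof -
  obtain r where r: "r \<in> {0..1}" "g r = c" "c \<in> A" "c \<in> B"
    using arc_meets_gate[OF assms(1-5), of 0 1] assms(6-) by (auto simp: pathstart_def pathfinish_def)
  have r01: "r \<noteq> 0" "r \<noteq> 1" using r assms(6-) by (auto simp: pathstart_def pathfinish_def)
  have a: "arc (subpath 0 r g)" "arc (subpath r 1 g)" using r r01 assms(4) by (auto intro!: arc_subpath_arc)
  have im: "path_image (subpath 0 r g) = g ` {0..r}" "path_image (subpath r 1 g) = g ` {r..1}"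
    using r by (auto simp: path_image_subpath)
  have sub: "path_image (subpath 0 r g) \<subseteq> A \<union> B" "path_image (subpath r 1 g) \<subseteq> A \<union> B"
    using assms(5) r by (auto simp: im path_image_def[of g] image_subset_iff)
  have "path_image g = g ` ({0..r} \<union> {r..1})" unfolding path_image_def using r by (intro arg_cong[of _ _ "(`) g"]) auto
  then have un: "path_image g = path_image (subpath 0 r g) \<union> path_image (subpath r 1 g)"
    unfolding im image_Un .
  have "path_image (subpath 0 r g) \<subseteq> A"
    using r assms(6) by (intro arc_stays[OF assms(1-3) a(1) sub(1)]) (auto simp: pathstart_def pathfinish_def subpath_def)
  moreover have "path_image (subpath r 1 g) \<subseteq> B"
    using r assms(3,8) sub(2) by (intro arc_stays[OF assms(2,1) _ a(2), of c]) (auto simp: pathfinish_def pathstart_def subpath_def)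
  ultimately show ?thesis
    using that[OF a] un r by (simp add: pathstart_def pathfinish_def subpath_def)
qed

text \<open>Two trees joined at one point form a tree: an arc either stays in one of them or splits
  at c into an arc in each.\<close>

lemma unique_arcs_glue:
  fixes A :: "'a::real_normed_vector set"
  assumes "closed A" "closed B" "A \<inter> B \<subseteq> {c}" "unique_arcs A" "unique_arcs B"
  shows "unique_arcs (A \<union> B)"
proof -
  \<comment> \<open>Stated for arbitrary A and B so that it can be used with the two sets
    exchanged.\<close>
  have cross: "path_image g = path_image h"
    if hyp: "closed A" "closed B" "A \<inter> B \<subseteq> {c}" "unique_arcs A" "unique_arcs B"
      "arc g" "arc h" "path_image g \<subseteq> A \<union> B" "path_image h \<subseteq> A \<union> B" "pathstart g = pathstart h" "pathfinish g = pathfinish h"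
      "pathstart g \<in> A" "pathstart g \<notin> B" "pathfinish g \<in> B" "pathfinish g \<notin> A"
    for A B :: "'a set" and g h
  proof -
    obtain g1 g2 where g: "arc g1" "arc g2" "path_image g1 \<subseteq> A" "path_image g2 \<subseteq> B" "pathstart g1 = pathstart g"
    "pathfinish g1 = c" "pathstart g2 = c" "pathfinish g2 = pathfinish g" "path_image g = path_image g1 \<union> path_image g2"
      by (rule arc_through_gate[OF hyp(1-3) hyp(6) hyp(8) hyp(12-15)])
    obtain h1 h2 where h: "arc h1" "arc h2" "path_image h1 \<subseteq> A" "path_image h2 \<subseteq> B" "pathstart h1 = pathstart h"
    "pathfinish h1 = c" "pathstart h2 = c" "pathfinish h2 = pathfinish h" "path_image h = path_image h1 \<union> path_image h2"
      by (rule arc_through_gate[OF hyp(1-3) hyp(7) hyp(9)]) (use hyp in auto)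
    have "path_image g1 = path_image h1" using g h hyp by (intro unique_arcsD[OF hyp(4)]) auto
    moreover have "path_image g2 = path_image h2" using g h hyp by (intro unique_arcsD[OF hyp(5)]) auto
    ultimately show ?thesis using g h by simp
  qed
  show ?thesis unfolding unique_arcs_def
  proof (intro allI impI, elim conjE)
    fix g h assume gh: "arc g" "arc h" "path_image g \<subseteq> A \<union> B" "path_image h \<subseteq> A \<union> B" "pathstart g = pathstart h" "pathfinish g = pathfinish h"
    have BA: "B \<inter> A \<subseteq> {c}" "path_image g \<subseteq> B \<union> A" "path_image h \<subseteq> B \<union> A" using assms gh by auto
    have e: "pathstart g \<in> A \<union> B" "pathfinish g \<in> A \<union> B"
      using gh(3) by (auto simp: subset_iff)
    consider "pathstart g \<in> A" "pathfinish g \<in> A" | "pathstart g \<in> B" "pathfinish g \<in> B"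
      | "pathstart g \<in> A" "pathstart g \<notin> B" "pathfinish g \<in> B" "pathfinish g \<notin> A"
      | "pathstart g \<in> B" "pathstart g \<notin> A" "pathfinish g \<in> A" "pathfinish g \<notin> B"
      using e by blast
    then show "path_image g = path_image h"
    proof cases
      case 1
      have "path_image g \<subseteq> A" "path_image h \<subseteq> A"
        using arc_stays[OF assms(1-3)] gh 1 by metis+
      then show ?thesis using gh by (intro unique_arcsD[OF assms(4)]) auto
    next
      case 2
      have "path_image g \<subseteq> B" "path_image h \<subseteq> B"
        using arc_stays[OF assms(2,1) BA(1)] gh BA 2 by metis+
      then show ?thesis using gh by (intro unique_arcsD[OF assms(5)]) auto
    next
      case 3
      then show ?thesis using cross[OF assms gh] by blast
    next
      case 4
      then show ?thesis using cross[OF assms(2,1) BA(1) assms(5,4) gh(1,2) BA(2,3) gh(5,6)] by blast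
    qed
  qed
qed

text \<open>The pieces B i are glued one after another to the centre A. That distinct pieces meet
  only inside A ensures that a new piece meets everything glued so far in its own gate
  alone.\<close>

lemma unique_arcs_star:
  fixes A :: "'a::real_normed_vector set"
  assumes "finite I" "closed A" "unique_arcs A"
    "\<And>i. i \<in> I \<Longrightarrow> closed (B i)" "\<And>i. i \<in> I \<Longrightarrow> unique_arcs (B i)" "\<And>i. i \<in> I \<Longrightarrow> A \<inter> B i \<subseteq> {c i}"
    "\<And>i j. i \<in> I \<Longrightarrow> j \<in> I \<Longrightarrow> i \<noteq> j \<Longrightarrow> B i \<inter> B j \<subseteq> A"
  shows "unique_arcs (A \<union> (\<Union>i\<in>I. B i))"
  using assms(1,4-)
proof (induction I rule: finite_induct)
  case (insert k I)
  have "unique_arcs ((A \<union> (\<Union>i\<in>I. B i)) \<union> B k)"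
  proof (rule unique_arcs_glue[where c = "c k"])
    show "closed (A \<union> (\<Union>i\<in>I. B i))" using insert.prems(1) insert.hyps assms(2) by auto
    have "B i \<inter> B k \<subseteq> A" if "i \<in> I" for i using insert.prems(4)[of i k] insert.hyps that by auto
    then show "(A \<union> (\<Union>i\<in>I. B i)) \<inter> B k \<subseteq> {c k}" using insert.prems(3)[of k] by blast
    show "unique_arcs (A \<union> (\<Union>i\<in>I. B i))" using insert by (intro insert.IH) auto
  qed (use insert.prems in auto)
  then show ?case by (simp add: Un_ac)
qed (use assms in simp)

lemma unique_arcs_singleton: "unique_arcs {c}"
  unfolding unique_arcs_def
proof (intro allI impI, elim conjE)
  fix g h :: "real \<Rightarrow> 'a" assume "arc g" "path_image g \<subseteq> {c}"
  then have "pathstart g = pathfinish g" by (metis pathfinish_in_path_image pathstart_in_path_image singletonD subsetD)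
  then show "path_image g = path_image h" using arc_distinct_ends[OF \<open>arc g\<close>] by simp
qed

text \<open>The coordinate along v turns an arc into a continuous injective real function. Its image
  is the interval between its end values, which depends on the end points only.\<close>

lemma unique_arcs_segment:
  fixes v :: "'a::euclidean_space"
  assumes "v \<noteq> 0"
  shows "unique_arcs (closed_segment 0 v)"
proof -
  define \<phi> where "\<phi> z = (z \<bullet> v) / (v \<bullet> v)" for z
  have inv: "\<phi> z *\<^sub>R v = z" if "z \<in> closed_segment 0 v" for z
    using that assms by (auto simp: closed_segment_def \<phi>_def)
  have key: "path_image g = (\<lambda>r. r *\<^sub>R v) ` closed_segment (\<phi> (pathstart g)) (\<phi> (pathfinish g))"
    if g: "arc g" "path_image g \<subseteq> closed_segment 0 v" for g
  proof -
    have im: "g ` {0..1} \<subseteq> closed_segment 0 v" using g(2) unfolding path_image_def .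
    have "continuous_on (closed_segment 0 (1::real)) (\<lambda>t. \<phi> (g t))"
      using g(1) assms unfolding arc_def path_def \<phi>_def
      by (intro continuous_intros) (auto simp: closed_segment_eq_real_ivl)
    moreover have "inj_on (\<lambda>t. \<phi> (g t)) (closed_segment 0 (1::real))"
    proof (rule inj_onI)
      fix s t :: real assume st: "s \<in> closed_segment 0 1" "t \<in> closed_segment 0 1" "\<phi> (g s) = \<phi> (g t)"
      then have "g s = g t" using inv im by (metis closed_segment_eq_real_ivl image_subset_iff zero_le_one)
      then show "s = t" using g(1) st unfolding arc_def by (auto dest: inj_onD simp: closed_segment_eq_real_ivl)
    qed
    ultimately have "(\<lambda>t. \<phi> (g t)) ` closed_segment 0 1 = closed_segment (\<phi> (g 0)) (\<phi> (g 1))"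
      by (rule continuous_injective_image_segment_1)
    then have "closed_segment (\<phi> (g 0)) (\<phi> (g 1)) = (\<lambda>t. \<phi> (g t)) ` {0..1}"
      by (simp add: closed_segment_eq_real_ivl[of 0 1])
    then have "(\<lambda>r. r *\<^sub>R v) ` closed_segment (\<phi> (pathstart g)) (\<phi> (pathfinish g)) = (\<lambda>t. \<phi> (g t) *\<^sub>R v) ` {0..1}"
      unfolding pathstart_def pathfinish_def by (simp only: image_image)
    also have "\<dots> = g ` {0..1}" using im by (intro image_cong refl inv) blast
    finally show ?thesis by (simp add: path_image_def)
  qed
  show ?thesis unfolding unique_arcs_def using key by metis
qed

lemma unique_arcs_vicsek_map:
  assumes "unique_arcs X" shows "unique_arcs (vicsek_map i ` X)"
proof -
  define \<phi> where "\<phi> z = 3 *\<^sub>R z - 2 *\<^sub>R vicsek_pt i" for z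
  have \<phi>1: "\<phi> (vicsek_map i z) = z" and \<phi>2: "vicsek_map i (\<phi> z) = z" for z
    by (simp_all add: \<phi>_def vicsek_map_eq prod_eq_iff field_simps)
  have arc: "arc (\<phi> \<circ> g)" "path_image (\<phi> \<circ> g) \<subseteq> X" "path_image g = vicsek_map i ` path_image (\<phi> \<circ> g)"
    if "arc g" "path_image g \<subseteq> vicsek_map i ` X" for g
  proof -
    show "arc (\<phi> \<circ> g)" unfolding arc_def path_def comp_def
    proof
      show "continuous_on {0..1} (\<lambda>x. \<phi> (g x))"
        using that(1) unfolding \<phi>_def arc_def path_def by (intro continuous_intros) auto
      show "inj_on (\<lambda>x. \<phi> (g x)) {0..1}"
        using that(1) \<phi>2 unfolding arc_def inj_on_def by metis
    qed
    show "path_image (\<phi> \<circ> g) \<subseteq> X"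
      unfolding path_image_compose
    proof (rule image_subsetI)
      fix z assume "z \<in> path_image g"
      with that(2) obtain x where "x \<in> X" "z = vicsek_map i x" by blast
      then show "\<phi> z \<in> X" by (simp add: \<phi>1)
    qed
    show "path_image g = vicsek_map i ` path_image (\<phi> \<circ> g)"
      unfolding path_image_compose image_image \<phi>2 by simp
  qed
  show ?thesis unfolding unique_arcs_def
  proof (intro allI impI, elim conjE)
    fix g h assume gh: "arc g" "arc h" "path_image g \<subseteq> vicsek_map i ` X" "path_image h \<subseteq> vicsek_map i ` X"
      "pathstart g = pathstart h" "pathfinish g = pathfinish h"
    have "path_image (\<phi> \<circ> g) = path_image (\<phi> \<circ> h)"
      using arc[OF gh(1,3)] arc[OF gh(2,4)] gh by (intro unique_arcsD[OF assms]) (auto simp: pathstart_compose pathfinish_compose)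
    then show "path_image g = path_image h" using arc(3)[OF gh(1,3)] arc(3)[OF gh(2,4)] by simp
  qed
qed

lemma cable_Suc_star: "cable (Suc n) = vicsek_map 5 ` cable n \<union> (\<Union>i\<in>{1..4}. vicsek_map i ` cable n)"
proof -
  have "{1..5::nat} = insert 5 {1..4}" by auto
  then show ?thesis by simp
qed

lemma closed_vicsek_map_cable: "closed (vicsek_map i ` cable n)"
  using compact_cable by (intro compact_imp_closed compact_continuous_image continuous_intros)

text \<open>Both the level 0 cable (four arms at the origin) and every later one (four corner copies
  at the central copy) are stars in the sense of \<open>unique_arcs_star\<close>.\<close>

lemma unique_arcs_cable: "unique_arcs (cable n)"
proof (induction n)
  case 0
  have "unique_arcs ({0} \<union> (\<Union>i\<in>{1..4}. arm i))"
  proof (rule unique_arcs_star[where c = "\<lambda>_. 0"])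
    show "unique_arcs (arm i)" if "i \<in> {1..4}" for i by (rule unique_arcs_segment[OF vicsek_pt_nonzero[OF that]])
    fix i j :: nat assume ij: "i \<in> {1..4}" "j \<in> {1..4}" "i \<noteq> j"
    show "arm i \<inter> arm j \<subseteq> {0}" by (rule arm_inter[OF ij])
  qed (auto intro: unique_arcs_singleton)
  moreover have "0 \<in> (\<Union>i\<in>{1..4}. arm i)" by (rule UN_I[of 1]) simp_all
  then have "{0} \<union> (\<Union>i\<in>{1..4}. arm i) = cable 0" unfolding cable_0 by blast
  ultimately show ?case by simp
next
  case (Suc n)
  show ?case unfolding cable_Suc_star
  proof (rule unique_arcs_star[where c = "\<lambda>i. vicsek_map 5 (vicsek_pt i)"])
    fix i :: nat assume i: "i \<in> {1..4}"
    show "vicsek_map 5 ` cable n \<inter> vicsek_map i ` cable n \<subseteq> {vicsek_map 5 (vicsek_pt i)}"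
    proof (rule subsetI, elim IntE imageE)
      fix z x y assume z: "z = vicsek_map 5 x" "x \<in> cable n" "z = vicsek_map i y" "y \<in> cable n"
      have "x = vicsek_pt i" using z i cable_square[of n] square_center_inter(1)[of i x y] by auto
      then show "z \<in> {vicsek_map 5 (vicsek_pt i)}" using z by simp
    qed
    fix j :: nat assume j: "j \<in> {1..4}" "i \<noteq> j"
    show "vicsek_map i ` cable n \<inter> vicsek_map j ` cable n \<subseteq> vicsek_map 5 ` cable n"
    proof (rule subsetI, elim IntE imageE)
      fix z x y assume z: "z = vicsek_map i x" "x \<in> cable n" "z = vicsek_map j y" "y \<in> cable n"
      then show "z \<in> vicsek_map 5 ` cable n" using square_corner_disjoint[OF i j, of x y] cable_square[of n] by auto
    qed
  qed (use Suc in \<open>auto intro: unique_arcs_vicsek_map closed_vicsek_map_cable\<close>)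
qed

lemma path_connected_cable: "path_connected (cable n)"
proof (induction n)
  case 0
  have "path_connected (\<Union>i\<in>{1..4}. arm i)"
  proof (rule path_connected_UNION)
    show "\<And>i. i \<in> {1..4} \<Longrightarrow> path_connected (arm i)" by (simp add: convex_imp_path_connected)
    show "\<And>i. i \<in> {1..4} \<Longrightarrow> 0 \<in> arm i" by simp
  qed
  then show ?case unfolding cable_0 .
next
  case (Suc n)
  have pc: "path_connected (vicsek_map i ` cable n)" for i
    using Suc by (intro path_connected_continuous_image continuous_intros)
  have "path_connected (\<Union>i\<in>{1..4}. vicsek_map 5 ` cable n \<union> vicsek_map i ` cable n)"
  proof (rule path_connected_UNION)
    fix i :: nat assume i: "i \<in> {1..4}"
    have "vicsek_map 5 (vicsek_pt i) \<in> vicsek_map 5 ` cable n"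
      using i vicsek_pt_cable[of i n] by auto
    moreover have "vicsek_map 5 (vicsek_pt i) \<in> vicsek_map i ` cable n"
      unfolding vicsek_map_opp[OF i, symmetric] using opp_in_4[OF i] vicsek_pt_cable[of "opp i" n] by auto
    ultimately have "vicsek_map 5 ` cable n \<inter> vicsek_map i ` cable n \<noteq> {}" by blast
    then show "path_connected (vicsek_map 5 ` cable n \<union> vicsek_map i ` cable n)"
      using pc by (intro path_connected_Un) auto
    show "vicsek_map 5 0 \<in> vicsek_map 5 ` cable n \<union> vicsek_map i ` cable n"
      using vicsek_pt_cable[of 5 n] by simp
  qed
  moreover have "(\<Union>i\<in>{1..4}. vicsek_map 5 ` cable n \<union> vicsek_map i ` cable n) = cable (Suc n)"
    unfolding cable_Suc_star by fastforce
  ultimately show ?case by simp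
qed

section \<open>The geodesic distance on the skeleton\<close>

lemma skeleton_dist_arc:
  assumes "arc g" "path_image g \<subseteq> cable n"
  shows "skeleton_dist (pathstart g) (pathfinish g) = measure length_measure (path_image g)"
proof -
  define P where "P h \<longleftrightarrow> arc h \<and> (\<exists>n. path_image h \<subseteq> cable n) \<and> pathstart h = pathstart g \<and> pathfinish h = pathfinish g" for h
  have "P g" using assms unfolding P_def by blast
  then have "P (SOME h. P h)" by (rule someI[of P])
  then obtain m where m: "arc (SOME h. P h)" "path_image (SOME h. P h) \<subseteq> cable m"
    "pathstart (SOME h. P h) = pathstart g" "pathfinish (SOME h. P h) = pathfinish g" unfolding P_def by blast
  \<comment> \<open>The chosen arc and g may live at different levels; both lie in the cable of
    level \<open>max m n\<close>, where arcs with given ends have a unique image.\<close>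
  have "path_image (SOME h. P h) = path_image g"
    using m assms cable_mono[of n "max m n"] cable_mono[of m "max m n"]
    by (intro unique_arcsD[OF unique_arcs_cable[of "max m n"]]) auto
  then show ?thesis unfolding skeleton_dist_def P_def[symmetric] using arc_distinct_ends[OF assms(1)] by simp
qed

lemma skeleton_dist_refl [simp]: "skeleton_dist x x = 0"
  by (simp add: skeleton_dist_def)

lemma skeleton_dist_nonneg: "skeleton_dist x y \<ge> 0"
  by (simp add: skeleton_dist_def)

lemma skeleton_dist_arcE:
  assumes "path_connected X" "X \<subseteq> cable n" "x \<in> X" "y \<in> X" "x \<noteq> y"
  obtains g where "arc g" "path_image g \<subseteq> X" "pathstart g = x" "pathfinish g = y"
    "skeleton_dist x y = measure length_measure (path_image g)"
proof -
  obtain g where "arc g" "path_image g \<subseteq> X" "pathstart g = x" "pathfinish g = y"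
    using assms unfolding path_connected_arcwise by blast
  then show ?thesis using that skeleton_dist_arc[of g n] assms by auto
qed

lemma compact_cable_sets: "compact P \<Longrightarrow> P \<subseteq> cable n \<Longrightarrow> P \<in> sets length_measure"
  using cable_skeleton by (intro sets_length_measure_compact) auto

lemma compact_cable_fmeasurable: "compact P \<Longrightarrow> P \<subseteq> cable n \<Longrightarrow> P \<in> fmeasurable length_measure"
  using compact_cable_sets emeasure_mono[OF _ cable_sets, of P n] length_measure_cable_finite[of n]
  by (intro fmeasurableI) (auto intro: le_less_trans)

text \<open>The arc between the points can be found inside X, so its length is at most that of X.
  Upper bounds for the distance thus need no explicit arcs.\<close>

lemma skeleton_dist_le:
  assumes "path_connected X" "compact X" "X \<subseteq> cable n" "x \<in> X" "y \<in> X"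
  shows "skeleton_dist x y \<le> measure length_measure X"
proof (cases "x = y")
  case False
  obtain g where g: "arc g" "path_image g \<subseteq> X" "skeleton_dist x y = measure length_measure (path_image g)"
    using skeleton_dist_arcE[OF assms(1,3,4,5) False] by metis
  show ?thesis unfolding g(3)
    using g assms by (intro measure_mono_fmeasurable compact_cable_fmeasurable compact_cable_sets) (auto intro: compact_arc_image)
qed simp

lemma skeleton_dist_sym:
  assumes "x \<in> cable n" "y \<in> cable n"
  shows "skeleton_dist x y = skeleton_dist y x"
proof (cases "x = y")
  case False
  obtain g where g: "arc g" "path_image g \<subseteq> cable n" "pathstart g = x" "pathfinish g = y"
    "skeleton_dist x y = measure length_measure (path_image g)"
    using skeleton_dist_arcE[OF path_connected_cable order_refl assms False] by metis
  then show ?thesis using skeleton_dist_arc[of "reversepath g" n] by (auto simp: arc_reversepath)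
qed simp

text \<open>The concatenation of the two arcs may fail to be an arc, but their union is compact and
  path connected, so \<open>skeleton_dist_le\<close> applies to it.\<close>

lemma skeleton_dist_triangle_cable:
  assumes "x \<in> cable n" "y \<in> cable n" "z \<in> cable n"
  shows "skeleton_dist x z \<le> skeleton_dist x y + skeleton_dist y z"
proof (cases "x = y \<or> y = z")
  case False
  obtain g where g: "arc g" "path_image g \<subseteq> cable n" "pathstart g = x" "pathfinish g = y"
    "skeleton_dist x y = measure length_measure (path_image g)"
    using skeleton_dist_arcE[OF path_connected_cable order_refl assms(1,2)] False by metis
  obtain h where h: "arc h" "path_image h \<subseteq> cable n" "pathstart h = y" "pathfinish h = z"
    "skeleton_dist y z = measure length_measure (path_image h)"
    using skeleton_dist_arcE[OF path_connected_cable order_refl assms(2,3)] False by metis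
  have c: "compact (path_image g)" "compact (path_image h)"
    using g h by (auto simp: compact_arc_image)
  have y: "y \<in> path_image g" "y \<in> path_image h" "x \<in> path_image g" "z \<in> path_image h"
    using g h by (metis pathstart_in_path_image pathfinish_in_path_image)+
  have "skeleton_dist x z \<le> measure length_measure (path_image g \<union> path_image h)"
  proof (rule skeleton_dist_le)
    show "path_connected (path_image g \<union> path_image h)"
      using g h y by (intro path_connected_Un) (auto simp: path_connected_path_image arc_imp_path)
  qed (use g h c y in auto)
  also have "\<dots> \<le> measure length_measure (path_image g) + measure length_measure (path_image h)"
    using c g h by (intro measure_Un_le compact_cable_sets) auto
  finally show ?thesis using g h by simp
qed (auto simp: skeleton_dist_nonneg)

text \<open>At a gate the concatenation is again an arc, and the common point has length zero, so
  the lengths add exactly.\<close>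

lemma skeleton_dist_add:
  assumes "path_connected X" "path_connected Y" "X \<subseteq> cable n" "Y \<subseteq> cable n" "X \<inter> Y \<subseteq> {c}"
    "c \<in> X" "c \<in> Y" "x \<in> X" "z \<in> Y"
  shows "skeleton_dist x z = skeleton_dist x c + skeleton_dist c z"
proof (cases "x = c \<or> c = z")
  case False
  obtain g where g: "arc g" "path_image g \<subseteq> X" "pathstart g = x" "pathfinish g = c"
    "skeleton_dist x c = measure length_measure (path_image g)"
    using skeleton_dist_arcE[OF assms(1,3,8,6)] False by metis
  obtain h where h: "arc h" "path_image h \<subseteq> Y" "pathstart h = c" "pathfinish h = z"
    "skeleton_dist c z = measure length_measure (path_image h)"
    using skeleton_dist_arcE[OF assms(2,4,7,9)] False by metis
  have int: "path_image g \<inter> path_image h \<subseteq> {c}" using g h assms by blast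
  have c: "compact (path_image g)" "compact (path_image h)"
    using g h by (auto simp: compact_arc_image)
  have fm: "path_image g \<in> fmeasurable length_measure" "path_image h \<in> fmeasurable length_measure"
    using g h assms c compact_cable_fmeasurable by (metis order_trans)+
  have "arc (g +++ h)" using g h int by (intro arc_join) auto
  moreover have im: "path_image (g +++ h) = path_image g \<union> path_image h" using g h by (simp add: path_image_join)
  moreover have "path_image (g +++ h) \<subseteq> cable n" unfolding im using g h assms by blast
  ultimately have "skeleton_dist x z = measure length_measure (path_image g \<union> path_image h)"
    using skeleton_dist_arc[of "g +++ h" n] g h by simp
  also have "\<dots> = measure length_measure (path_image g) + measure length_measure (path_image h)"
    using fm length_measure_singleton[OF int] 
    by (intro measure_Un3[THEN trans]) (auto simp: measure_def)
  finally show ?thesis using g h by simp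
qed auto

lemma skeleton_dist_vicsek_map_cable:
  assumes "x \<in> cable n" "y \<in> cable n" "i \<in> {1..5}"
  shows "skeleton_dist (vicsek_map i x) (vicsek_map i y) = skeleton_dist x y / 3"
proof (cases "x = y")
  case False
  obtain g where g: "arc g" "path_image g \<subseteq> cable n" "pathstart g = x" "pathfinish g = y"
    "skeleton_dist x y = measure length_measure (path_image g)"
    using skeleton_dist_arcE[OF path_connected_cable order_refl assms(1,2) False] by metis
  have a: "arc (vicsek_map i \<circ> g)"
    using g(1) inj_on_subset[OF vicsek_map_inj subset_UNIV] unfolding arc_def path_def
    by (intro conjI comp_inj_on continuous_on_compose continuous_intros) (auto intro: continuous_on_vicsek_map continuous_on_id)
  have "path_image (vicsek_map i \<circ> g) \<subseteq> cable (Suc n)"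
    unfolding path_image_compose cable.simps(2) using g(2) assms(3) by blast
  then have "skeleton_dist (vicsek_map i x) (vicsek_map i y) = measure length_measure (vicsek_map i ` path_image g)"
    using skeleton_dist_arc[OF a, of "Suc n"] g(3,4)
    by (simp add: pathstart_compose pathfinish_compose path_image_compose del: cable.simps)
  also have "\<dots> = measure length_measure (path_image g) / 3"
    using length_measure_vicsek_map(2)[OF assms(3) compact_cable_sets[OF compact_arc_image[OF g(1)] g(2)]]
    by (simp add: measure_def enn2real_mult)
  finally show ?thesis using g by simp
qed simp

lemma skeleton_common_cable:
  assumes "x \<in> skeleton" "y \<in> skeleton" "z \<in> skeleton"
  obtains n where "x \<in> cable n" "y \<in> cable n" "z \<in> cable n"
proof -
  obtain i j k where ijk: "x \<in> cable i" "y \<in> cable j" "z \<in> cable k" using assms by (auto simp: skeleton_def)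
  define m where "m = max i (max j k)"
  have "i \<le> m" "j \<le> m" "k \<le> m" by (auto simp: m_def)
  then show ?thesis using ijk cable_mono that[of m] by blast
qed

lemma skeleton_dist_triangle:
  assumes "x \<in> skeleton" "y \<in> skeleton" "z \<in> skeleton"
  shows "skeleton_dist x z \<le> skeleton_dist x y + skeleton_dist y z"
  using skeleton_common_cable[OF assms] skeleton_dist_triangle_cable by metis

lemma skeleton_dist_commute:
  assumes "x \<in> skeleton" "y \<in> skeleton"
  shows "skeleton_dist x y = skeleton_dist y x"
  using skeleton_common_cable[OF assms assms(1)] skeleton_dist_sym by metis

lemma skeleton_dist_vicsek_map:
  assumes "x \<in> skeleton" "y \<in> skeleton" "i \<in> {1..5}"
  shows "skeleton_dist (vicsek_map i x) (vicsek_map i y) = skeleton_dist x y / 3"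
  using skeleton_common_cable[OF assms(1,2,1)] skeleton_dist_vicsek_map_cable[OF _ _ assms(3)] by metis

lemma skeleton_dist_word_map:
  assumes "x \<in> skeleton" "y \<in> skeleton" "w \<in> words n"
  shows "skeleton_dist (word_map w x) (word_map w y) = (1/3) ^ n * skeleton_dist x y"
  using assms(3)
proof (induction n arbitrary: w)
  case (Suc n)
  obtain i v where w: "w = i # v" "i \<in> {1..5}" "v \<in> words n" using Suc.prems by (rule words_SucE)
  then show ?case using Suc.IH[OF w(3)] word_map_skeleton[OF w(3)] assms(1,2) by (simp add: skeleton_dist_vicsek_map)
qed simp

lemma dist_le_skeleton_dist:
  assumes "x \<in> skeleton" "y \<in> skeleton"
  shows "dist x y \<le> skeleton_dist x y"
proof (cases "x = y")
  case False
  obtain n where n: "x \<in> cable n" "y \<in> cable n" using skeleton_common_cable[OF assms assms(1)] by metis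
  obtain g where g: "arc g" "path_image g \<subseteq> cable n" "pathstart g = x" "pathfinish g = y"
    "skeleton_dist x y = measure length_measure (path_image g)"
    using skeleton_dist_arcE[OF path_connected_cable order_refl n False] by metis
  have "x \<in> path_image g" "y \<in> path_image g" using g by (metis pathstart_in_path_image pathfinish_in_path_image)+
  then show ?thesis unfolding g(5)
    using g by (intro dist_le_length_measure[of _ n]) (auto simp: compact_arc_image connected_arc_image)
qed simp

text \<open>To reach a corner cell from the centre: at most 1/3 to the shared corner, 1/3 from there
  to the centre of the cell, and 1/3 within the cell by the induction hypothesis, in all 1.\<close>

lemma skeleton_dist_center_le:
  assumes "x \<in> skeleton" shows "skeleton_dist 0 x \<le> 1"
proof -
  have "x \<in> cable n \<Longrightarrow> skeleton_dist 0 x \<le> 1" for n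
  proof (induction n arbitrary: x)
    case 0
    then obtain i where i: "i \<in> {1..4}" "x \<in> arm i" unfolding cable_0 by auto
    have "skeleton_dist 0 x \<le> measure length_measure (arm i)"
      using i by (intro skeleton_dist_le[of _ 0]) (auto simp: convex_imp_path_connected)
    then show ?case using length_measure_arm[OF i(1)] by (simp add: measure_def)
  next
    case (Suc n)
    then obtain i u where u: "i \<in> {1..5}" "u \<in> cable n" "x = vicsek_map i u" unfolding cable.simps(2) by blast
    have q: "vicsek_pt j \<in> cable n" "vicsek_pt j \<in> skeleton" "skeleton_dist 0 (vicsek_pt j) \<le> 1" if "j \<in> {1..5}" for j
      using vicsek_pt_cable[OF that] vicsek_pt_skeleton[OF that] Suc.IH by auto
    have us: "u \<in> skeleton" using u(2) cable_skeleton by blast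
    have z: "(0::pt) \<in> skeleton" using vicsek_pt_skeleton[of 5] by simp
    have z5: "vicsek_map 5 0 = 0" by (simp add: vicsek_map_eq)
    show ?case
    proof (cases "i = 5")
      case True
      then have "skeleton_dist 0 x = skeleton_dist 0 u / 3"
        using skeleton_dist_vicsek_map[OF z us, of 5] u z5 by simp
      then show ?thesis using Suc.IH[OF u(2)] by simp
    next
      case False
      then have i: "i \<in> {1..4}" using u by auto
      define c where "c = vicsek_map 5 (vicsek_pt i)"
      have o: "opp i \<in> {1..5}" using opp_in_5[OF u(1)] .
      have c2: "c = vicsek_map i (vicsek_pt (opp i))" by (simp add: c_def vicsek_map_opp[OF i])
      have cs: "c \<in> skeleton" using q(2)[OF u(1)] vicsek_map_skeleton[of 5] by (simp add: c_def)
      have "skeleton_dist 0 x \<le> skeleton_dist 0 c + skeleton_dist c x"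
        using z cs u us vicsek_map_skeleton by (intro skeleton_dist_triangle) auto
      also have "skeleton_dist 0 c = skeleton_dist 0 (vicsek_pt i) / 3"
        using skeleton_dist_vicsek_map[OF z q(2)[OF u(1)], of 5] z5 by (simp add: c_def)
      also have "skeleton_dist c x = skeleton_dist (vicsek_pt (opp i)) u / 3"
        unfolding c2 u(3) by (rule skeleton_dist_vicsek_map[OF q(2)[OF o] us u(1)])
      finally have 1: "skeleton_dist 0 x \<le> skeleton_dist 0 (vicsek_pt i) / 3 + skeleton_dist (vicsek_pt (opp i)) u / 3" .
      have "skeleton_dist (vicsek_pt (opp i)) u \<le> skeleton_dist (vicsek_pt (opp i)) 0 + skeleton_dist 0 u"
        by (rule skeleton_dist_triangle[OF q(2)[OF o] z us])
      also have "skeleton_dist (vicsek_pt (opp i)) 0 = skeleton_dist 0 (vicsek_pt (opp i))"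
        by (rule skeleton_dist_commute[OF q(2)[OF o] z])
      finally show ?thesis using 1 q(3)[OF u(1)] q(3)[OF o] Suc.IH[OF u(2)] by linarith
    qed
  qed
  then show ?thesis using assms by (auto simp: skeleton_def)
qed

lemma zero_skeleton: "(0::pt) \<in> skeleton"
  using vicsek_pt_skeleton[of 5] by simp

lemma skeleton_dist_le_2:
  assumes "x \<in> skeleton" "y \<in> skeleton" shows "skeleton_dist x y \<le> 2"
  using skeleton_dist_triangle[OF assms(1) zero_skeleton assms(2)] skeleton_dist_commute[OF assms(1) zero_skeleton]
    skeleton_dist_center_le[OF assms(1)] skeleton_dist_center_le[OF assms(2)] by simp

lemma skeleton_dist_arm:
  assumes i: "i \<in> {1..4}" and t: "t \<in> {0..1}"
  shows "skeleton_dist 0 (t *\<^sub>R vicsek_pt i) = t"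
proof (cases "t = 0")
  case False
  have sub: "closed_segment 0 (t *\<^sub>R vicsek_pt i) \<subseteq> arm i"
    by (rule closed_segment_subset) (use arm_mem[OF t] in simp_all)
  have "arm i \<subseteq> cable 0" using i unfolding cable_0 by blast
  with sub have sub0: "closed_segment 0 (t *\<^sub>R vicsek_pt i) \<subseteq> cable 0" by blast
  have "arc (linepath 0 (t *\<^sub>R vicsek_pt i))" using False vicsek_pt_nonzero[OF i] by (intro arc_linepath) simp
  from skeleton_dist_arc[OF this, of 0] sub0
  have "skeleton_dist 0 (t *\<^sub>R vicsek_pt i) = measure length_measure (closed_segment 0 (t *\<^sub>R vicsek_pt i))" by simp
  then show ?thesis using length_measure_initial[OF i, of t] t by (simp add: measure_def)
qed simp

text \<open>A path that enters a cell does so through a fixed corner of that cell.\<close>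
lemma skeleton_dist_gate:
  assumes b: "b \<in> {1..5}" and k: "k \<in> {1..5}"
  shows "\<exists>b'\<in>{1..5}. \<exists>\<gamma>. \<forall>z\<in>skeleton. skeleton_dist (vicsek_pt b) (vicsek_map k z) = \<gamma> + skeleton_dist (vicsek_pt b') z / 3"
proof -
  \<comment> \<open>X leads from the starting corner to the gate and touches the square of cell k in
    the gate only, so that \<open>skeleton_dist_add\<close> splits the distance there.\<close>
  have *: ?thesis
    if X: "path_connected X" "X \<subseteq> cable 0" "vicsek_pt b \<in> X" "b' \<in> {1..5}" "vicsek_map k (vicsek_pt b') \<in> X"
      "X \<inter> vicsek_map k ` vicsek_square \<subseteq> {vicsek_map k (vicsek_pt b')}" for X b'
  proof (intro bexI[of _ b'] exI[of _ "skeleton_dist (vicsek_pt b) (vicsek_map k (vicsek_pt b'))"] ballI)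
    fix z assume "z \<in> skeleton"
    then obtain n where n: "z \<in> cable n" by (auto simp: skeleton_def)
    have "skeleton_dist (vicsek_pt b) (vicsek_map k z) =
       skeleton_dist (vicsek_pt b) (vicsek_map k (vicsek_pt b')) + skeleton_dist (vicsek_map k (vicsek_pt b')) (vicsek_map k z)"
    proof (rule skeleton_dist_add[where X = X and Y = "vicsek_map k ` cable n"])
      show "path_connected (vicsek_map k ` cable n)"
        by (intro path_connected_continuous_image continuous_intros path_connected_cable)
      show "X \<subseteq> cable (Suc n)" using X(2) cable_mono[of 0 "Suc n"] by simp
      show "vicsek_map k ` cable n \<subseteq> cable (Suc n)" using k unfolding cable.simps(2) by blast
      show "X \<inter> vicsek_map k ` cable n \<subseteq> {vicsek_map k (vicsek_pt b')}" using X(6) cable_square[of n] by blast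
    qed (use X n vicsek_pt_cable in auto)
    also have "skeleton_dist (vicsek_map k (vicsek_pt b')) (vicsek_map k z) = skeleton_dist (vicsek_pt b') z / 3"
      using \<open>z \<in> skeleton\<close> X(4) vicsek_pt_skeleton k by (intro skeleton_dist_vicsek_map) auto
    finally show "skeleton_dist (vicsek_pt b) (vicsek_map k z) =
      skeleton_dist (vicsek_pt b) (vicsek_map k (vicsek_pt b')) + skeleton_dist (vicsek_pt b') z / 3" .
  qed (use X in auto)
  have arm0: "arm i \<subseteq> cable 0" if "i \<in> {1..4}" for i using that unfolding cable_0 by blast
  \<comment> \<open>If b = k, the start is itself a corner of the cell. The central cell is entered
    from corner b at its own corner b, through the corner cell b; a corner cell k is entered from
    the centre or from another corner at its own corner \<open>opp k\<close>.\<close>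
  consider "b = k" | "b \<noteq> k" "k = 5" | "b \<noteq> k" "k \<noteq> 5" "b = 5" | "b \<noteq> k" "k \<noteq> 5" "b \<noteq> 5" by blast
  then show ?thesis
  proof cases
    case 1
    show ?thesis
    proof (rule *[of "{vicsek_pt b}" b])
      show "{vicsek_pt b} \<subseteq> cable 0" using vicsek_pt_cable[OF b] by blast
    qed (use 1 b in auto)
  next
    case 2
    then have b4: "b \<in> {1..4}" using b by auto
    show ?thesis
    proof (rule *[of "vicsek_map 5 ` {vicsek_pt b} \<union> vicsek_map b ` (arm b \<union> arm (opp b))" b])
      have v: "vicsek_map 5 (vicsek_pt b) \<in> vicsek_map b ` arm (opp b)"
        unfolding vicsek_map_opp[OF b4, symmetric] by simp
      have "path_connected (arm b \<union> arm (opp b))"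
        by (rule path_connected_Un) (auto simp: convex_imp_path_connected)
      then have "path_connected (vicsek_map b ` (arm b \<union> arm (opp b)))"
        by (intro path_connected_continuous_image continuous_intros)
      moreover have e: "vicsek_map 5 ` {vicsek_pt b} \<union> vicsek_map b ` (arm b \<union> arm (opp b)) = vicsek_map b ` (arm b \<union> arm (opp b))"
        using v by blast
      ultimately show "path_connected (vicsek_map 5 ` {vicsek_pt b} \<union> vicsek_map b ` (arm b \<union> arm (opp b)))" by simp
      have "vicsek_map b ` (arm b \<union> arm (opp b)) \<subseteq> arm b"
        using equalityD2[OF arm_subdivision[OF b4]] by blast
      then show "vicsek_map 5 ` {vicsek_pt b} \<union> vicsek_map b ` (arm b \<union> arm (opp b)) \<subseteq> cable 0"
        using arm0[OF b4] e by simp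
      have "vicsek_map b (vicsek_pt b) \<in> vicsek_map b ` arm b" by (rule imageI) simp
      then show "vicsek_pt b \<in> vicsek_map 5 ` {vicsek_pt b} \<union> vicsek_map b ` (arm b \<union> arm (opp b))" by auto
      show "(vicsek_map 5 ` {vicsek_pt b} \<union> vicsek_map b ` (arm b \<union> arm (opp b))) \<inter> vicsek_map k ` vicsek_square \<subseteq> {vicsek_map k (vicsek_pt b)}"
        unfolding e
      proof (rule subsetI, elim IntE imageE)
        fix z x y assume z: "z = vicsek_map b x" "x \<in> arm b \<union> arm (opp b)" "z = vicsek_map k y" "y \<in> vicsek_square"
        have "x \<in> vicsek_square" using z arm_square by blast
        then have "y = vicsek_pt b" using square_center_inter(1)[OF b4 z(4)] z 2 by metis
        then show "z \<in> {vicsek_map k (vicsek_pt b)}" using z by simp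
      qed
    qed (use 2 b in auto)
  next
    case 3
    then have k4: "k \<in> {1..4}" using k by auto
    show ?thesis
    proof (rule *[of "vicsek_map 5 ` arm k" "opp k"])
      show "path_connected (vicsek_map 5 ` arm k)"
        by (intro path_connected_continuous_image continuous_intros) (simp add: convex_imp_path_connected)
      show "vicsek_map 5 ` arm k \<subseteq> cable 0"
        using equalityD2[OF arm_subdivision[OF k4]] arm0[OF k4] by blast
      have "vicsek_map 5 0 \<in> vicsek_map 5 ` arm k" by (rule imageI) simp
      then show "vicsek_pt b \<in> vicsek_map 5 ` arm k" using 3 by (simp add: vicsek_map_eq)
      show "vicsek_map k (vicsek_pt (opp k)) \<in> vicsek_map 5 ` arm k" unfolding vicsek_map_opp[OF k4] by simp
      show "vicsek_map 5 ` arm k \<inter> vicsek_map k ` vicsek_square \<subseteq> {vicsek_map k (vicsek_pt (opp k))}"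
      proof (rule subsetI, elim IntE imageE)
        fix z x y assume z: "z = vicsek_map 5 x" "x \<in> arm k" "z = vicsek_map k y" "y \<in> vicsek_square"
        have "x \<in> vicsek_square" using z arm_square by blast
        then have "y = vicsek_pt (opp k)" using square_center_inter(2)[OF k4 _ z(4)] z by metis
        then show "z \<in> {vicsek_map k (vicsek_pt (opp k))}" using z by simp
      qed
    qed (use opp_in_5[OF k] in auto)
  next
    case 4
    then have k4: "k \<in> {1..4}" and b4: "b \<in> {1..4}" using k b by auto
    show ?thesis
    proof (rule *[of "arm b \<union> vicsek_map 5 ` arm k" "opp k"])
      have 0: "0 \<in> vicsek_map 5 ` arm k"
        by (rule image_eqI[of _ _ 0]) (auto simp: vicsek_map_eq)
      have "path_connected (vicsek_map 5 ` arm k)"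
        by (intro path_connected_continuous_image continuous_intros) (simp add: convex_imp_path_connected)
      then show "path_connected (arm b \<union> vicsek_map 5 ` arm k)"
        using 0 by (intro path_connected_Un) (auto simp: convex_imp_path_connected)
      show "arm b \<union> vicsek_map 5 ` arm k \<subseteq> cable 0"
        using equalityD2[OF arm_subdivision[OF k4]] arm0[OF k4] arm0[OF b4] by blast
      have "vicsek_map 5 (vicsek_pt k) \<in> vicsek_map 5 ` arm k" by (rule imageI) simp
      then show "vicsek_map k (vicsek_pt (opp k)) \<in> arm b \<union> vicsek_map 5 ` arm k" unfolding vicsek_map_opp[OF k4] by simp
      show "(arm b \<union> vicsek_map 5 ` arm k) \<inter> vicsek_map k ` vicsek_square \<subseteq> {vicsek_map k (vicsek_pt (opp k))}"
      proof (rule subsetI, elim IntE UnE imageE)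
        fix z y assume z: "z \<in> arm b" "z = vicsek_map k y" "y \<in> vicsek_square"
        then show "z \<in> {vicsek_map k (vicsek_pt (opp k))}" using vimage_arm_other[OF b4 k4] 4 by blast
      next
        fix z x y assume z: "z = vicsek_map 5 x" "x \<in> arm k" "z = vicsek_map k y" "y \<in> vicsek_square"
        have "x \<in> vicsek_square" using z arm_square by blast
        then have "y = vicsek_pt (opp k)" using square_center_inter(2)[OF k4 _ z(4)] z by metis
        then show "z \<in> {vicsek_map k (vicsek_pt (opp k))}" using z by simp
      qed
    qed (use opp_in_5[OF k] in auto)
  qed
qed

text \<open>The distance from a vertex of V_0 grows or falls at unit speed along every edge; this
  later orients the edges. The base vertex must vary in the induction, because passing into a cell
  replaces it by the corner through which the cell is entered.\<close>

lemma skeleton_dist_affine: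
  assumes "w \<in> words n" "b \<in> {1..5}" "i \<in> {1..4}"
  shows "\<exists>\<alpha> \<sigma>. (\<sigma> = 1 \<or> \<sigma> = -1) \<and>
    (\<forall>t\<in>{0..1}. skeleton_dist (vicsek_pt b) (word_map w (t *\<^sub>R vicsek_pt i)) = \<alpha> + \<sigma> * t * (1/3) ^ n)"
  using assms(1,2)
proof (induction n arbitrary: w b)
  case 0
  have ts: "t *\<^sub>R vicsek_pt i \<in> skeleton" if "t \<in> {0..1}" for t
    using arm_mem[OF that] arm_skeleton[OF assms(3)] by blast
  consider "b = 5" | "b = i" | "b \<in> {1..4}" "b \<noteq> i" using 0 by fastforce
  then show ?case
  proof cases
    case 1
    then show ?thesis using 0 skeleton_dist_arm[OF assms(3)] by (intro exI[of _ 0] exI[of _ 1]) simp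
  next
    case 2
    have "skeleton_dist (vicsek_pt i) (t *\<^sub>R vicsek_pt i) = 1 - t" if t: "t \<in> {0..1}" for t
    proof -
      have m: "t *\<^sub>R vicsek_pt i \<in> arm i" using t by (rule arm_mem)
      \<comment> \<open>The point t q_i separates q_i from 0 on the arm, and the total distance is
        1.\<close>
      have "skeleton_dist (vicsek_pt i) 0 = skeleton_dist (vicsek_pt i) (t *\<^sub>R vicsek_pt i) + skeleton_dist (t *\<^sub>R vicsek_pt i) 0"
      proof (rule skeleton_dist_add[where X = "closed_segment (vicsek_pt i) (t *\<^sub>R vicsek_pt i)" and Y = "closed_segment (t *\<^sub>R vicsek_pt i) 0" and n = 0])
        show "closed_segment (vicsek_pt i) (t *\<^sub>R vicsek_pt i) \<inter> closed_segment (t *\<^sub>R vicsek_pt i) 0 \<subseteq> {t *\<^sub>R vicsek_pt i}"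
          using Int_closed_segment[of "t *\<^sub>R vicsek_pt i" "vicsek_pt i" 0] m by (simp add: closed_segment_commute)
        have "arm i \<subseteq> cable 0" using assms(3) unfolding cable_0 by blast
        then show "closed_segment (vicsek_pt i) (t *\<^sub>R vicsek_pt i) \<subseteq> cable 0" "closed_segment (t *\<^sub>R vicsek_pt i) 0 \<subseteq> cable 0"
          using m closed_segment_subset[of _ "arm i"] by (meson convex_closed_segment ends_in_segment order_trans)+
      qed (auto simp: convex_imp_path_connected)
      moreover have "skeleton_dist (vicsek_pt i) 0 = 1"
        using skeleton_dist_arm[OF assms(3), of 1] ts[of 1] zero_skeleton skeleton_dist_commute by simp
      moreover have "skeleton_dist (t *\<^sub>R vicsek_pt i) 0 = t"
        using skeleton_dist_arm[OF assms(3) t] ts[OF t] zero_skeleton skeleton_dist_commute by simp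
      ultimately show ?thesis by simp
    qed
    then show ?thesis using 0 2 by (intro exI[of _ 1] exI[of _ "-1"]) simp
  next
    case 3
    have "skeleton_dist (vicsek_pt b) (t *\<^sub>R vicsek_pt i) = skeleton_dist (vicsek_pt b) 0 + t" if t: "t \<in> {0..1}" for t
    proof -
      have m: "t *\<^sub>R vicsek_pt i \<in> arm i" using t by (rule arm_mem)
      have "skeleton_dist (vicsek_pt b) (t *\<^sub>R vicsek_pt i) = skeleton_dist (vicsek_pt b) 0 + skeleton_dist 0 (t *\<^sub>R vicsek_pt i)"
      proof (rule skeleton_dist_add[where X = "arm b" and Y = "arm i" and n = 0])
        show "arm b \<inter> arm i \<subseteq> {0}" by (rule arm_inter[OF 3(1) assms(3) 3(2)])
        show "arm b \<subseteq> cable 0" "arm i \<subseteq> cable 0" using 3 assms(3) unfolding cable_0 by blast+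
      qed (use m in \<open>auto simp: convex_imp_path_connected\<close>)
      then show ?thesis using skeleton_dist_arm[OF assms(3) t] by simp
    qed
    then show ?thesis using 0 by (intro exI[of _ "skeleton_dist (vicsek_pt b) 0"] exI[of _ 1]) simp
  qed
next
  case (Suc n)
  obtain k v where w: "w = k # v" "k \<in> {1..5}" "v \<in> words n" using Suc.prems(1) by (rule words_SucE)
  obtain b' \<gamma> where b': "b' \<in> {1..5}"
    "\<And>z. z \<in> skeleton \<Longrightarrow> skeleton_dist (vicsek_pt b) (vicsek_map k z) = \<gamma> + skeleton_dist (vicsek_pt b') z / 3"
    using skeleton_dist_gate[OF Suc.prems(2) w(2)] by blast
  obtain \<alpha> \<sigma> where as: "\<sigma> = 1 \<or> \<sigma> = -1"
    "\<And>t. t \<in> {0..1} \<Longrightarrow> skeleton_dist (vicsek_pt b') (word_map v (t *\<^sub>R vicsek_pt i)) = \<alpha> + \<sigma> * t * (1/3) ^ n"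
    using Suc.IH[OF w(3) b'(1)] by blast
  have "skeleton_dist (vicsek_pt b) (word_map w (t *\<^sub>R vicsek_pt i)) = (\<gamma> + \<alpha> / 3) + \<sigma> * t * (1/3) ^ Suc n" if t: "t \<in> {0..1}" for t
  proof -
    have "t *\<^sub>R vicsek_pt i \<in> skeleton" using arm_mem[OF t] arm_skeleton[OF assms(3)] by blast
    then have "word_map v (t *\<^sub>R vicsek_pt i) \<in> skeleton" by (rule word_map_skeleton[OF w(3)])
    then show ?thesis using as(2)[OF t] by (simp add: w b'(2) field_simps)
  qed
  then show ?case using as(1) by blast
qed

section \<open>The chessboard lattice and the extended distance\<close>

text \<open>With \<open>word_y\<close> the lattice position of a cell: the centre of the cell w of
  level n is 2 \<open>half_side\<close> (\<open>word_x w\<close>, \<open>word_y w\<close>) / 3^n.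
  The letters act as digits of a balanced ternary expansion.\<close>

primrec word_x :: "nat list \<Rightarrow> int" where
  "word_x [] = 0"
| "word_x (i # w) = word_x w + 3 ^ length w * sgx i"

primrec word_y :: "nat list \<Rightarrow> int" where
  "word_y [] = 0"
| "word_y (i # w) = word_y w + 3 ^ length w * sgy i"

lemma fst_word_map: "fst (word_map w z) = (fst z + 2 * half_side * of_int (word_x w)) / 3 ^ length w"
  and snd_word_map: "snd (word_map w z) = (snd z + 2 * half_side * of_int (word_y w)) / 3 ^ length w"
  by (induction w) (simp_all add: fst_vicsek_map snd_vicsek_map field_simps)

text \<open>Each letter contributes a digit pair (0,0) or (1 or -1, 1 or -1), whose sum is even.
  This is the colour of the chessboard.\<close>

lemma even_word_xy: "even (word_x w + word_y w)"
proof (induction w)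
  case (Cons i w)
  have "even (sgx i + sgy i)" by (simp add: sgx_def sgy_def)
  then have "even (3 ^ length w * (sgx i + sgy i))" by simp
  with Cons have "even ((word_x w + word_y w) + 3 ^ length w * (sgx i + sgy i))" by (rule dvd_add)
  then show ?case by (simp add: algebra_simps)
qed simp

text \<open>The extreme case has all digits equal: 1 + 3 + ... + 3^(n-1) = (3^n - 1) / 2.\<close>

lemma word_x_bound: "2 * \<bar>word_x w\<bar> \<le> 3 ^ length w - 1"
  and word_y_bound: "2 * \<bar>word_y w\<bar> \<le> 3 ^ length w - 1"
proof -
  have s: "\<bar>sgx i\<bar> \<le> 1" "\<bar>sgy i\<bar> \<le> 1" for i by (auto simp: sgx_def sgy_def)
  have m: "\<bar>3 ^ k * (s::int)\<bar> \<le> 3 ^ k" if "\<bar>s\<bar> \<le> 1" for k s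
    using that mult_left_mono[of "\<bar>s\<bar>" 1 "3 ^ k"] by (simp add: abs_mult)
  have step: "2 * \<bar>u + v\<bar> \<le> 3 * c - 1" if "2 * \<bar>u\<bar> \<le> c - 1" "\<bar>v\<bar> \<le> c" for u v c :: int
  proof -
    have "2 * \<bar>u + v\<bar> \<le> 2 * \<bar>u\<bar> + 2 * \<bar>v\<bar>" using abs_triangle_ineq[of u v] by simp
    also have "\<dots> \<le> (c - 1) + 2 * c" using that by (intro add_mono) auto
    finally show ?thesis by simp
  qed
  show "2 * \<bar>word_x w\<bar> \<le> 3 ^ length w - 1"
  proof (induction w)
    case (Cons i w)
    then show ?case using step[OF Cons m[OF s(1), of "length w" i]] by simp
  qed simp
  show "2 * \<bar>word_y w\<bar> \<le> 3 ^ length w - 1"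
  proof (induction w)
    case (Cons i w)
    then show ?case using step[OF Cons m[OF s(2), of "length w" i]] by simp
  qed simp
qed

lemma sgxy_decode:
  assumes "i \<in> {1..5}"
  shows "i = (if sgx i = 0 then 5 else if sgx i = 1 then (if sgy i = 1 then 2 else 3) else (if sgy i = 1 then 1 else 4))"
  using assms unfolding indices_5 by (elim disjE) (simp_all add: sgx_def sgy_def)

text \<open>Uniqueness of balanced ternary expansions: the remainders are below 3^n / 2 in absolute
  value, so the leading digit is determined, and the digit pair determines the letter.\<close>

lemma word_xy_inj:
  "w \<in> words n \<Longrightarrow> w' \<in> words n \<Longrightarrow> word_x w = word_x w' \<Longrightarrow> word_y w = word_y w' \<Longrightarrow> w = w'"
proof (induction n arbitrary: w w')
  case (Suc n)
  obtain i v where w: "w = i # v" "i \<in> {1..5}" "v \<in> words n" using Suc.prems(1) by (rule words_SucE)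
  obtain j v' where w': "w' = j # v'" "j \<in> {1..5}" "v' \<in> words n" using Suc.prems(2) by (rule words_SucE)
  have l: "length v = n" "length v' = n" using w w' by (auto simp: words_length)
  have digit: "s = t" if "u + 3 ^ n * s = u' + 3 ^ n * t" "2 * \<bar>u\<bar> \<le> 3 ^ n - 1" "2 * \<bar>u'\<bar> \<le> 3 ^ n - 1" for s t u u' :: int
  proof (rule ccontr)
    assume "s \<noteq> t"
    then have "1 \<le> \<bar>s - t\<bar>" by simp
    then have "3 ^ n * 1 \<le> 3 ^ n * \<bar>s - t\<bar>" by (intro mult_left_mono) auto
    also have "\<dots> = \<bar>3 ^ n * s - 3 ^ n * t\<bar>" by (simp add: abs_mult flip: right_diff_distrib)
    finally show False using that by linarith
  qed
  have ex: "word_x v + 3 ^ n * sgx i = word_x v' + 3 ^ n * sgx j"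
    and ey: "word_y v + 3 ^ n * sgy i = word_y v' + 3 ^ n * sgy j"
    using Suc.prems(3,4) unfolding w(1) w'(1) word_x.simps word_y.simps l .
  have x: "sgx i = sgx j"
    using digit[OF ex] word_x_bound[of v] word_x_bound[of v'] unfolding l .
  have y: "sgy i = sgy j"
    using digit[OF ey] word_y_bound[of v] word_y_bound[of v'] unfolding l .
  have "i = j"
    using sgxy_decode[OF w(2)] unfolding x y sgxy_decode[OF w'(2), symmetric] .
  moreover have "v = v'"
    by (rule Suc.IH[OF w(3) w'(3)]) (use ex ey x y in simp_all)
  ultimately show ?case by (simp add: w(1) w'(1))
qed simp

text \<open>The level-n cells sit in the black squares of a chessboard; black squares whose points come
  close to each other coincide or meet in a corner.\<close>
lemma close_cells_share_vertex:
  assumes w: "w \<in> words n" "w' \<in> words n" and xy: "x \<in> vicsek_square" "y \<in> vicsek_square"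
    and close: "dist (word_map w x) (word_map w' y) < 2 * half_side / 3 ^ n"
  shows "\<exists>i\<in>{1..5}. \<exists>j\<in>{1..5}. word_map w (vicsek_pt i) = word_map w' (vicsek_pt j)"
proof -
  have l: "length w = n" "length w' = n" using w by (auto simp: words_length)
  \<comment> \<open>Offsets inside the squares account for at most 2 \<open>half_side\<close> and
    the assumed closeness for strictly less than another 2 \<open>half_side\<close>, so the lattice
    difference is strictly below 2.\<close>
  have small: "\<bar>d\<bar> \<le> 1" if "\<bar>(s + 2 * half_side * of_int u) / 3 ^ n - (t + 2 * half_side * of_int v) / 3 ^ n\<bar> < 2 * half_side / 3 ^ n"
    "\<bar>s\<bar> \<le> half_side" "\<bar>t\<bar> \<le> half_side" "d = v - u" for s t and d u v :: int
  proof -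
    have "\<bar>(s + 2 * half_side * of_int u) / 3 ^ n - (t + 2 * half_side * of_int v) / 3 ^ n\<bar>
      = \<bar>(s + 2 * half_side * of_int u) - (t + 2 * half_side * of_int v)\<bar> / 3 ^ n"
      by (simp flip: diff_divide_distrib)
    then have "\<bar>(s + 2 * half_side * of_int u) - (t + 2 * half_side * of_int v)\<bar> < 2 * half_side"
      using that(1) by (simp add: divide_less_cancel)
    moreover have "2 * half_side * of_int d = 2 * half_side * of_int v - 2 * half_side * of_int u"
      by (simp add: that(4) right_diff_distrib)
    ultimately have "\<bar>2 * half_side * real_of_int d\<bar> < 2 * half_side * 2" using that(2,3) by linarith
    then have "\<bar>real_of_int d\<bar> < 2" using half_side_pos by (simp add: abs_mult)
    then show ?thesis by linarith
  qed
  define dx where "dx = word_x w' - word_x w"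
  define dy where "dy = word_y w' - word_y w"
  have b: "\<bar>fst x\<bar> \<le> half_side" "\<bar>snd x\<bar> \<le> half_side" "\<bar>fst y\<bar> \<le> half_side" "\<bar>snd y\<bar> \<le> half_side"
    using xy by (auto simp: vicsek_square_def)
  have "\<bar>fst (word_map w x) - fst (word_map w' y)\<bar> < 2 * half_side / 3 ^ n"
    using dist_fst_le[of "word_map w x" "word_map w' y"] close by (simp add: dist_real_def)
  then have dx: "\<bar>dx\<bar> \<le> 1" unfolding fst_word_map l by (rule small) (use b in \<open>auto simp: dx_def\<close>)
  have "\<bar>snd (word_map w x) - snd (word_map w' y)\<bar> < 2 * half_side / 3 ^ n"
    using dist_snd_le[of "word_map w x" "word_map w' y"] close by (simp add: dist_real_def)
  then have dy: "\<bar>dy\<bar> \<le> 1" unfolding snd_word_map l by (rule small) (use b in \<open>auto simp: dy_def\<close>)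
  have "even (dx + dy)" using even_word_xy[of w] even_word_xy[of w'] by (simp add: dx_def dy_def)
  \<comment> \<open>Parity rules out neighbours that share a side. The same cell and the diagonal
    neighbours remain, and in each case (dx, dy) is the sign pair of some index i, whose corner is
    the shared one.\<close>
  then have "dx = 0 \<and> dy = 0 \<or> dx = -1 \<and> dy = 1 \<or> dx = 1 \<and> dy = 1 \<or> dx = 1 \<and> dy = -1 \<or> dx = -1 \<and> dy = -1"
  proof -
    have "dx = 0 \<or> dx = 1 \<or> dx = -1" "dy = 0 \<or> dy = 1 \<or> dy = -1" using dx dy by linarith+
    with \<open>even (dx + dy)\<close> show ?thesis by auto
  qed
  then have "\<exists>i\<in>{1..5}. sgx i = dx \<and> sgy i = dy"
  proof (elim disjE)
    assume "dx = 0 \<and> dy = 0" then show ?thesis by (intro bexI[of _ 5]) (auto simp: sgx_def sgy_def)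
  next
    assume "dx = -1 \<and> dy = 1" then show ?thesis by (intro bexI[of _ 1]) (auto simp: sgx_def sgy_def)
  next
    assume "dx = 1 \<and> dy = 1" then show ?thesis by (intro bexI[of _ 2]) (auto simp: sgx_def sgy_def)
  next
    assume "dx = 1 \<and> dy = -1" then show ?thesis by (intro bexI[of _ 3]) (auto simp: sgx_def sgy_def)
  next
    assume "dx = -1 \<and> dy = -1" then show ?thesis by (intro bexI[of _ 4]) (auto simp: sgx_def sgy_def)
  qed
  then obtain i where i: "i \<in> {1..5}" "sgx i = dx" "sgy i = dy" by blast
  have o: "sgx (opp i) = - dx" "sgy (opp i) = - dy"
    using i unfolding indices_5 by (auto simp: sgx_def sgy_def opp_def)
  have "word_map w (vicsek_pt i) = word_map w' (vicsek_pt (opp i))"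
    by (simp add: prod_eq_iff fst_word_map snd_word_map l vicsek_pt_eq i o dx_def dy_def algebra_simps)
  then show ?thesis using i(1) opp_in_5 by blast
qed

lemma card_lattice_interval:
  assumes "0 \<le> L"
  shows "real (card {\<lceil>c - L\<rceil>..\<lfloor>c + L\<rfloor>}) \<le> 2 * L + 1"
proof (cases "\<lceil>c - L\<rceil> \<le> \<lfloor>c + L\<rfloor> + 1")
  case True
  then have "real (card {\<lceil>c - L\<rceil>..\<lfloor>c + L\<rfloor>}) = of_int (\<lfloor>c + L\<rfloor> + 1 - \<lceil>c - L\<rceil>)" by simp
  then show ?thesis by linarith
qed (use assms in simp)

text \<open>A cell within \<rho> / 3^n of z has each lattice coordinate within L of that of z. Since
  these coordinates determine the word, it suffices to count lattice points in a square of side 2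
  L.\<close>

lemma card_cells_near:
  assumes "0 \<le> \<rho>"
  shows "real (card {w \<in> words n. \<exists>x\<in>vicsek_square. dist z (word_map w x) \<le> \<rho> / 3 ^ n}) \<le> ((\<rho> + half_side) / half_side + 1)\<^sup>2"
proof -
  define L where "L = (\<rho> + half_side) / (2 * half_side)"
  have L: "0 \<le> L" using assms half_side_pos by (simp add: L_def)
  define cx where "cx = 3 ^ n * fst z / (2 * half_side)"
  define cy where "cy = 3 ^ n * snd z / (2 * half_side)"
  define N where "N = {w \<in> words n. \<exists>x\<in>vicsek_square. dist z (word_map w x) \<le> \<rho> / 3 ^ n}"
  have near: "\<bar>of_int u - 3 ^ n * t / (2 * half_side)\<bar> \<le> L"
    if "\<bar>t - (s + 2 * half_side * of_int u) / 3 ^ n\<bar> \<le> \<rho> / 3 ^ n" "\<bar>s\<bar> \<le> half_side" for s t and u :: int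
  proof -
    have "\<bar>t - (s + 2 * half_side * of_int u) / 3 ^ n\<bar> = \<bar>3 ^ n * t - (s + 2 * half_side * of_int u)\<bar> / 3 ^ n"
    proof -
      have "t - (s + 2 * half_side * of_int u) / 3 ^ n = (3 ^ n * t - (s + 2 * half_side * of_int u)) / 3 ^ n"
        by (simp add: field_simps)
      then show ?thesis by (simp add: abs_divide)
    qed
    then have "\<bar>3 ^ n * t - (s + 2 * half_side * of_int u)\<bar> \<le> \<rho>"
      using that(1) by (simp add: divide_le_cancel)
    then have "\<bar>2 * half_side * of_int u - 3 ^ n * t\<bar> \<le> \<rho> + half_side" using that(2) by linarith
    then have "\<bar>2 * half_side * of_int u - 3 ^ n * t\<bar> / (2 * half_side) \<le> L"
      unfolding L_def using half_side_pos by (intro divide_right_mono) auto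
    moreover have "of_int u - 3 ^ n * t / (2 * half_side) = (2 * half_side * of_int u - 3 ^ n * t) / (2 * half_side)"
      using half_side_pos by (simp add: field_simps)
    ultimately show ?thesis using half_side_pos by (simp add: abs_divide)
  qed
  define I where "I = {\<lceil>cx - L\<rceil>..\<lfloor>cx + L\<rfloor>}"
  define J where "J = {\<lceil>cy - L\<rceil>..\<lfloor>cy + L\<rfloor>}"
  have "(\<lambda>w. (word_x w, word_y w)) ` N \<subseteq> I \<times> J"
  proof (rule image_subsetI)
    fix w assume "w \<in> N"
    then obtain x where x: "w \<in> words n" "x \<in> vicsek_square" "dist z (word_map w x) \<le> \<rho> / 3 ^ n" by (auto simp: N_def)
    have l: "length w = n" using x by (simp add: words_length)
    have "\<bar>fst z - fst (word_map w x)\<bar> \<le> \<rho> / 3 ^ n" "\<bar>snd z - snd (word_map w x)\<bar> \<le> \<rho> / 3 ^ n"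
      using dist_fst_le[of z "word_map w x"] dist_snd_le[of z "word_map w x"] x(3) by (auto simp: dist_real_def)
    then have "\<bar>of_int (word_x w) - cx\<bar> \<le> L" "\<bar>of_int (word_y w) - cy\<bar> \<le> L"
      unfolding fst_word_map snd_word_map l cx_def cy_def using x(2) near by (auto simp: vicsek_square_def)
    then show "(word_x w, word_y w) \<in> I \<times> J" unfolding I_def J_def by (auto simp: ceiling_le_iff le_floor_iff)
  qed
  moreover have "inj_on (\<lambda>w. (word_x w, word_y w)) N"
    by (rule inj_onI) (auto simp: N_def intro: word_xy_inj)
  ultimately have "card N \<le> card (I \<times> J)" by (intro card_inj_on_le[of _ N]) (auto simp: I_def J_def)
  then have "real (card N) \<le> real (card I) * real (card J)" by (simp add: card_cartesian_product flip: of_nat_mult)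
  also have "\<dots> \<le> (2 * L + 1) * (2 * L + 1)"
    unfolding I_def J_def using L by (intro mult_mono card_lattice_interval) auto
  also have "\<dots> = ((\<rho> + half_side) / half_side + 1)\<^sup>2" 
  proof -
    have "2 * L = (\<rho> + half_side) / half_side" using half_side_pos by (simp add: L_def field_simps)
    then show ?thesis by (simp only: power2_eq_square)
  qed
  finally show ?thesis unfolding N_def .
qed

section \<open>Comparison with the Euclidean distance and extension to K\<close>

lemma skeleton_dist_shared_vertex:
  assumes "w \<in> words n" "w' \<in> words n" "i \<in> {1..5}" "j \<in> {1..5}" "word_map w (vicsek_pt i) = word_map w' (vicsek_pt j)"
    "x \<in> word_map w ` skeleton" "y \<in> word_map w' ` skeleton"
  shows "skeleton_dist x y \<le> 4 / 3 ^ n"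
proof -
  obtain s t where st: "s \<in> skeleton" "t \<in> skeleton" "x = word_map w s" "y = word_map w' t" using assms by blast
  define c where "c = word_map w (vicsek_pt i)"
  have q: "vicsek_pt i \<in> skeleton" "vicsek_pt j \<in> skeleton" using assms vicsek_pt_skeleton by auto
  have "skeleton_dist x y \<le> skeleton_dist x c + skeleton_dist c y"
    unfolding st c_def using st q assms by (intro skeleton_dist_triangle word_map_skeleton[of _ n]) auto
  also have "skeleton_dist x c = (1/3) ^ n * skeleton_dist s (vicsek_pt i)"
    unfolding st c_def using skeleton_dist_word_map[OF st(1) q(1) assms(1)] .
  also have "skeleton_dist c y = (1/3) ^ n * skeleton_dist (vicsek_pt j) t"
    unfolding st c_def assms(5) using skeleton_dist_word_map[OF q(2) st(2) assms(2)] .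
  \<comment> \<open>Diameter 2 of the skeleton, scaled into each of the two cells.\<close>
  also have "(1/3) ^ n * skeleton_dist s (vicsek_pt i) + (1/3) ^ n * skeleton_dist (vicsek_pt j) t \<le> (1/3) ^ n * 2 + (1/3) ^ n * 2"
    using st q by (intro add_mono mult_left_mono skeleton_dist_le_2) auto
  finally show ?thesis by (simp add: power_one_over)
qed

text \<open>Points that are close in the plane lie in cells with a common corner and are therefore
  close along the cables as well. Without this the distance would not extend continuously to
  K.\<close>

lemma skeleton_dist_small:
  assumes "x \<in> skeleton" "y \<in> skeleton" "dist x y < 2 * half_side / 3 ^ n"
  shows "skeleton_dist x y \<le> 4 / 3 ^ n"
proof -
  obtain w s where w: "w \<in> words n" "s \<in> skeleton" "x = word_map w s" using assms(1) skeleton_words[of n] by blast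
  obtain w' t where w': "w' \<in> words n" "t \<in> skeleton" "y = word_map w' t" using assms(2) skeleton_words[of n] by blast
  obtain i j where ij: "i \<in> {1..5}" "j \<in> {1..5}" "word_map w (vicsek_pt i) = word_map w' (vicsek_pt j)"
    using close_cells_share_vertex[OF w(1) w'(1), of s t] skeleton_square w w' assms(3) by blast
  then show ?thesis using w w' by (intro skeleton_dist_shared_vertex[OF w(1) w'(1) ij]) auto
qed

lemma small_power_third:
  assumes "0 < e" obtains n where "c / 3 ^ n < (e::real)"
proof -
  obtain n where "(1/3) ^ n < e / (\<bar>c\<bar> + 1)"
    using real_arch_pow_inv[of "e / (\<bar>c\<bar> + 1)" "1/3"] assms by auto
  then have "\<bar>c\<bar> * (1/3) ^ n < e" using assms
    by (smt (verit) divide_pos_pos mult.commute mult_less_cancel_right pos_less_divide_eq zero_less_power)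
  moreover have "c / 3 ^ n \<le> \<bar>c\<bar> * (1/3) ^ n" by (simp add: power_one_over divide_right_mono)
  ultimately show ?thesis using that[of n] by linarith
qed

lemma skeleton_dist_uniformly_continuous:
  "uniformly_continuous_on (skeleton \<times> skeleton) (\<lambda>(a, b). skeleton_dist a b)"
  unfolding uniformly_continuous_on_def
proof (intro allI impI)
  fix e :: real assume "0 < e"
  \<comment> \<open>Moving each of the two arguments costs at most 4 / 3^n.\<close>
  then obtain n where n: "8 / 3 ^ n < e" by (rule small_power_third)
  define d where "d = 2 * half_side / 3 ^ n"
  have "dist (skeleton_dist a' b') (skeleton_dist a b) < e"
    if "a \<in> skeleton" "b \<in> skeleton" "a' \<in> skeleton" "b' \<in> skeleton" "dist (a', b') (a, b) < d" for a b a' b'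
  proof -
    have "dist a' a < d" "dist b' b < d"
      using that(5) dist_fst_le[of "(a', b')" "(a, b)"] dist_snd_le[of "(a', b')" "(a, b)"] by auto
    then have s: "skeleton_dist a' a \<le> 4 / 3 ^ n" "skeleton_dist b' b \<le> 4 / 3 ^ n"
      using that unfolding d_def by (auto intro!: skeleton_dist_small)
    have "\<bar>skeleton_dist a' b' - skeleton_dist a b\<bar> \<le> skeleton_dist a' a + skeleton_dist b' b"
      using skeleton_dist_triangle[of a' a b'] skeleton_dist_triangle[of a b b'] skeleton_dist_commute[of b b']
        skeleton_dist_triangle[of a a' b] skeleton_dist_triangle[of a' b' b] skeleton_dist_commute[of a a'] that by linarith
    then show ?thesis using s n by (simp add: dist_real_def)
  qed
  moreover have "0 < d" using half_side_pos by (simp add: d_def)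
  ultimately show "\<exists>d>0. \<forall>x\<in>skeleton \<times> skeleton. \<forall>x'\<in>skeleton \<times> skeleton. dist x' x < d \<longrightarrow>
      dist (case x' of (a, b) \<Rightarrow> skeleton_dist a b) (case x of (a, b) \<Rightarrow> skeleton_dist a b) < e"
    by (intro exI[of _ d]) auto
qed

lemma connected_skeleton: "connected skeleton"
proof -
  have "path_connected skeleton" unfolding skeleton_def
    using path_connected_cable vicsek_pt_cable[of 5] by (intro path_connected_UNION[where z = "vicsek_pt 5"]) auto
  then show ?thesis by (rule path_connected_imp_connected)
qed

text \<open>\<open>Lim\<close> is meaningful only along a nontrivial filter. The closure of the
  product is connected with more than one point, so none of its points is isolated.\<close>

lemma skeleton_square_limpt:
  assumes "x \<in> vicsek_set" "y \<in> vicsek_set"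
  shows "(x, y) islimpt (skeleton \<times> skeleton)"
proof -
  have "connected (closure (skeleton \<times> skeleton))"
    by (intro connected_imp_connected_closure connected_Times connected_skeleton)
  moreover have xy: "(x, y) \<in> closure (skeleton \<times> skeleton)"
    using assms by (simp add: closure_Times vicsek_set_eq)
  moreover have "\<nexists>a. closure (skeleton \<times> skeleton) = {a}"
  proof
    assume "\<exists>a. closure (skeleton \<times> skeleton) = {a}"
    then obtain a where "closure (skeleton \<times> skeleton) = {a}" by blast
    then have sub: "skeleton \<times> skeleton \<subseteq> {a}" using closure_subset[of "skeleton \<times> skeleton"] by simp
    have "(vicsek_pt 1, 0) \<in> skeleton \<times> skeleton" "(0, 0) \<in> skeleton \<times> skeleton"
      using vicsek_pt_skeleton[of 1] zero_skeleton by simp_all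
    then have a: "(vicsek_pt 1, 0) = a" "(0, 0) = a" using subsetD[OF sub] by simp_all
    have "(vicsek_pt 1, 0::pt) = (0, 0)" by (rule trans[OF a(1) a(2)[symmetric]])
    then show False using vicsek_pt_nonzero[of 1] by simp
  qed
  ultimately have "(x, y) islimpt closure (skeleton \<times> skeleton)" by (metis connected_imp_perfect)
  then show ?thesis by (simp add: limpt_of_closure)
qed

text \<open>Uniform continuity gives a continuous extension g to the closure. Since g is continuous
  at (x, y), the limit over the punctured neighbourhood that defines \<open>vicsek_dist\<close>
  equals g (x, y).\<close>

lemma vicsek_dist_extension:
  "(\<forall>x\<in>skeleton. \<forall>y\<in>skeleton. vicsek_dist x y = skeleton_dist x y) \<and>
   continuous_on (vicsek_set \<times> vicsek_set) (\<lambda>z. vicsek_dist (fst z) (snd z))"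
proof -
  obtain g where g: "uniformly_continuous_on (closure (skeleton \<times> skeleton)) g"
    "\<And>x. x \<in> skeleton \<times> skeleton \<Longrightarrow> (\<lambda>(a, b). skeleton_dist a b) x = g x"
    by (rule uniformly_continuous_on_extension_on_closure[OF skeleton_dist_uniformly_continuous]) blast
  have cl: "closure (skeleton \<times> skeleton) = vicsek_set \<times> vicsek_set" by (simp add: closure_Times vicsek_set_eq)
  have cont: "continuous_on (vicsek_set \<times> vicsek_set) g"
    using g(1) unfolding cl by (rule uniformly_continuous_imp_continuous)
  have eq: "vicsek_dist x y = g (x, y)" if "x \<in> vicsek_set" "y \<in> vicsek_set" for x y
    unfolding vicsek_dist_def
  proof (rule tendsto_Lim)
    show "at (x, y) within skeleton \<times> skeleton \<noteq> bot"
      using skeleton_square_limpt[OF that] by (simp add: trivial_limit_within)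
    have "(g \<longlongrightarrow> g (x, y)) (at (x, y) within vicsek_set \<times> vicsek_set)"
      using cont that unfolding continuous_on_def by blast
    then have "(g \<longlongrightarrow> g (x, y)) (at (x, y) within skeleton \<times> skeleton)"
      by (rule tendsto_within_subset) (use skeleton_vicsek_set in blast)
    then show "((\<lambda>(a, b). skeleton_dist a b) \<longlongrightarrow> g (x, y)) (at (x, y) within skeleton \<times> skeleton)"
      by (rule Lim_transform_within[OF _ zero_less_one]) (use g(2) in auto)
  qed
  have "continuous_on (vicsek_set \<times> vicsek_set) (\<lambda>z. vicsek_dist (fst z) (snd z))"
    using cont by (rule continuous_on_eq) (auto simp: eq)
  moreover have "vicsek_dist x y = skeleton_dist x y" if "x \<in> skeleton" "y \<in> skeleton" for x y
    using eq[of x y] g(2)[of "(x, y)"] that skeleton_vicsek_set by auto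
  ultimately show ?thesis by blast
qed

lemma vicsek_dist_skeleton: "x \<in> skeleton \<Longrightarrow> y \<in> skeleton \<Longrightarrow> vicsek_dist x y = skeleton_dist x y"
  and continuous_on_vicsek_dist: "continuous_on (vicsek_set \<times> vicsek_set) (\<lambda>z. vicsek_dist (fst z) (snd z))"
  using vicsek_dist_extension by blast+

text \<open>The bound holds for points of the skeleton in the two cells, and continuity carries it
  to the closures. With w = w' it bounds the diameter of a cell.\<close>

lemma vicsek_dist_shared_vertex:
  assumes "w \<in> words n" "w' \<in> words n" "i \<in> {1..5}" "j \<in> {1..5}" "word_map w (vicsek_pt i) = word_map w' (vicsek_pt j)"
    "x \<in> word_map w ` vicsek_set" "y \<in> word_map w' ` vicsek_set"
  shows "vicsek_dist x y \<le> 4 / 3 ^ n"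
proof -
  define S where "S = (word_map w ` skeleton) \<times> (word_map w' ` skeleton)"
  have xy: "(x, y) \<in> closure S" using assms by (simp add: S_def closure_Times closure_word_map_skeleton)
  have sub: "closure S \<subseteq> vicsek_set \<times> vicsek_set"
    using assms by (auto simp: S_def closure_Times closure_word_map_skeleton intro: word_map_vicsek_set)
  have "(\<lambda>z. vicsek_dist (fst z) (snd z)) (x, y) \<le> 4 / 3 ^ n"
  proof (rule continuous_le_on_closure[OF continuous_on_subset[OF continuous_on_vicsek_dist sub] xy])
    fix z assume "z \<in> S"
    then obtain a b where z: "z = (a, b)" "a \<in> word_map w ` skeleton" "b \<in> word_map w' ` skeleton"
      unfolding S_def by (elim SigmaE) blast
    have "a \<in> skeleton" "b \<in> skeleton" using z word_map_skeleton assms by blast+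
    then show "vicsek_dist (fst z) (snd z) \<le> 4 / 3 ^ n"
      using skeleton_dist_shared_vertex[OF assms(1-5) z(2,3)] by (simp add: z vicsek_dist_skeleton)
  qed
  then show ?thesis by simp
qed

lemma dist_le_vicsek_dist:
  assumes "x \<in> vicsek_set" "y \<in> vicsek_set"
  shows "dist x y \<le> vicsek_dist x y"
proof -
  have cl: "closure (skeleton \<times> skeleton) = vicsek_set \<times> vicsek_set" by (simp add: closure_Times vicsek_set_eq)
  have "(\<lambda>z. dist (fst z) (snd z) - vicsek_dist (fst z) (snd z)) (x, y) \<le> 0"
  proof (rule continuous_le_on_closure[where S = "skeleton \<times> skeleton"])
    show "continuous_on (closure (skeleton \<times> skeleton)) (\<lambda>z. dist (fst z) (snd z) - vicsek_dist (fst z) (snd z))"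
      unfolding cl by (intro continuous_intros continuous_on_vicsek_dist)
    show "(x, y) \<in> closure (skeleton \<times> skeleton)" using assms cl by simp
  qed (auto simp: vicsek_dist_skeleton dist_le_skeleton_dist)
  then show ?thesis by simp
qed

lemma closed_vicsek_ball:
  assumes "x \<in> vicsek_set" shows "closed (vicsek_ball x r)"
proof -
  have "continuous_on vicsek_set (\<lambda>y. vicsek_dist x y)"
  proof -
    have "continuous_on vicsek_set ((\<lambda>z. vicsek_dist (fst z) (snd z)) \<circ> (\<lambda>y. (x, y)))"
      using assms by (intro continuous_on_compose continuous_intros continuous_on_subset[OF continuous_on_vicsek_dist]) auto
    then show ?thesis by (simp add: comp_def)
  qed
  then show ?thesis unfolding vicsek_ball_def
    by (intro continuous_on_closed_Collect_le continuous_intros compact_imp_closed compact_vicsek_set)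
qed

lemma vicsek_ball_cball: "x \<in> vicsek_set \<Longrightarrow> vicsek_ball x r \<subseteq> cball x r \<inter> vicsek_set"
  using dist_le_vicsek_dist by (fastforce simp: vicsek_ball_def)

lemma cell_subset_vicsek_ball:
  assumes "w \<in> words n" "x \<in> word_map w ` vicsek_set"
  shows "word_map w ` vicsek_set \<subseteq> vicsek_ball x (4 / 3 ^ n)"
  \<comment> \<open>A cell trivially shares a vertex with itself; its centre, index 5, is
    taken.\<close>
  using vicsek_dist_shared_vertex[OF assms(1,1), of 5 5 x] assms word_map_vicsek_set
  by (auto simp: vicsek_ball_def)

section \<open>The self-similar probability measure\<close>

text \<open>Position k is the (k+1)-st digit after the point; digits are raised by 1 because the
  maps are numbered from 1.\<close>

definition base5_digit :: "real \<Rightarrow> nat \<Rightarrow> nat" where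
  "base5_digit t k = nat (\<lfloor>5 ^ Suc k * t\<rfloor> mod 5) + 1"

text \<open>The point whose sequence of cells is read off from the base 5 expansion of t.\<close>
definition coding :: "real \<Rightarrow> pt" where
  "coding t = (\<Sum>k. (2/3 * (1/3) ^ k) *\<^sub>R vicsek_pt (base5_digit t k))"

lemma norm_vicsek_pt_le: "norm (vicsek_pt i) \<le> 1"
proof (cases "i \<in> {1..4}")
  case False
  then have "vicsek_pt i = 0" by (auto simp: vicsek_pt_def zero_prod_def)
  then show ?thesis by simp
qed (simp add: norm_vicsek_pt)

lemma coding_term_bound: "norm ((2/3 * (1/3) ^ k) *\<^sub>R vicsek_pt i) \<le> 2/3 * (1/3) ^ k"
  using mult_left_mono[OF norm_vicsek_pt_le[of i], of "2/3 * (1/3) ^ k"] by simp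

lemma coding_bound_sums: "(\<lambda>k. 2/3 * (1/3) ^ k) sums (1::real)"
  using sums_mult[OF geometric_sums[of "1/3::real"], of "2/3"] by simp

lemma summable_coding: "summable (\<lambda>k. (2/3 * (1/3) ^ k) *\<^sub>R vicsek_pt (base5_digit t k))"
  by (rule summable_comparison_test'[OF sums_summable[OF coding_bound_sums]]) (rule coding_term_bound)

lemma norm_coding_le: "norm (coding t) \<le> 1"
  unfolding coding_def
  using norm_suminf_le[OF coding_term_bound sums_summable[OF coding_bound_sums]] sums_unique[OF coding_bound_sums]
  by simp

lemma coding_measurable [measurable]: "coding \<in> borel_measurable borel"
proof -
  have "(\<lambda>t. vicsek_pt (base5_digit t k)) \<in> borel_measurable borel" for k
  proof -
    have "(\<lambda>t::real. \<lfloor>5 ^ Suc k * t\<rfloor>) \<in> measurable borel (count_space UNIV)" by measurable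
    from measurable_compose[OF this, of "\<lambda>m. vicsek_pt (nat (m mod 5) + 1)" borel]
    show ?thesis unfolding base5_digit_def by simp
  qed
  then show ?thesis unfolding coding_def by (intro borel_measurable_suminf borel_measurable_scaleR) auto
qed

text \<open>Prepending the digit j to the expansion of s shifts the series by one place, which
  amounts to applying the map j + 1. The coding thus carries the self-similarity of [0,1) over to
  K.\<close>

lemma coding_shift:
  assumes s: "0 \<le> s" "s < 1" and j: "j < 5"
  shows "coding (real j / 5 + 1/5 * s) = vicsek_map (Suc j) (coding s)"
proof -
  define t where "t = real j / 5 + 1/5 * s"
  have t: "5 * t = real j + s" by (simp add: t_def)
  have d0: "base5_digit t 0 = Suc j"
  proof -
    have "\<lfloor>5 ^ Suc 0 * t\<rfloor> = int j" using s t by (simp add: floor_eq_iff)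
    then show ?thesis using j by (simp add: base5_digit_def)
  qed
  have dS: "base5_digit t (Suc k) = base5_digit s k" for k
  proof -
    have "5 ^ Suc (Suc k) * t = 5 ^ Suc k * (5 * t)" by simp
    also have "\<dots> = 5 ^ Suc k * s + of_int (5 ^ Suc k * int j)" unfolding t by (simp add: algebra_simps)
    \<comment> \<open>The added integer is a multiple of 5 and disappears modulo 5, so the later
      digits of t are those of s.\<close>
    finally have "\<lfloor>5 ^ Suc (Suc k) * t\<rfloor> = \<lfloor>5 ^ Suc k * s\<rfloor> + 5 ^ Suc k * int j"
      by (simp only: floor_add_int)
    then have "\<lfloor>5 ^ Suc (Suc k) * t\<rfloor> mod 5 = \<lfloor>5 ^ Suc k * s\<rfloor> mod 5" by (simp add: mod_add_eq[symmetric] mult.assoc)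
    then show ?thesis by (simp only: base5_digit_def)
  qed
  have "coding t = (2/3 * (1/3) ^ 0) *\<^sub>R vicsek_pt (base5_digit t 0) + (\<Sum>k. (2/3 * (1/3) ^ Suc k) *\<^sub>R vicsek_pt (base5_digit t (Suc k)))"
    unfolding coding_def using suminf_split_head[OF summable_coding[of t]] by simp
  also have "(\<Sum>k. (2/3 * (1/3) ^ Suc k) *\<^sub>R vicsek_pt (base5_digit t (Suc k)))
     = (\<Sum>k. (1/3) *\<^sub>R ((2/3 * (1/3) ^ k) *\<^sub>R vicsek_pt (base5_digit s k)))"
    unfolding dS by simp
  also have "\<dots> = (1/3) *\<^sub>R coding s"
    unfolding coding_def by (rule suminf_scaleR_right[OF summable_coding, symmetric])
  finally show ?thesis unfolding d0 t_def[symmetric] by (simp add: vicsek_map_eq add.commute)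
qed

text \<open>Writing t = (j + s) / 5 shows that the range of the coding is covered by its own five
  images, so the contraction argument puts it inside K.\<close>

lemma coding_vicsek_set:
  assumes "t \<in> {0..<1}" shows "coding t \<in> vicsek_set"
proof -
  have "coding ` {0..<1} \<subseteq> vicsek_set"
  proof (rule selfsim_contraction[where I = "{1..5}"])
    show "bounded (coding ` {0..<1})" unfolding bounded_iff using norm_coding_le by blast
    show "closed vicsek_set" using compact_vicsek_set by (rule compact_imp_closed)
    show "vicsek_set \<noteq> {}" using vicsek_pt_vicsek_set[of 5] by auto
    show "(\<Union>i\<in>{1..5}. vicsek_map i ` vicsek_set) \<subseteq> vicsek_set" using vicsek_map_vicsek_set by blast
    show "coding ` {0..<1} \<subseteq> (\<Union>i\<in>{1..5}. vicsek_map i ` coding ` {0..<1})"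
    proof (rule image_subsetI)
      fix t :: real assume t: "t \<in> {0..<1}"
      define j where "j = nat \<lfloor>5 * t\<rfloor>"
      define s where "s = 5 * t - real j"
      have "0 \<le> \<lfloor>5 * t\<rfloor>" using t by simp
      then have rj: "real j = of_int \<lfloor>5 * t\<rfloor>" by (simp add: j_def)
      have s: "0 \<le> s" "s < 1" unfolding s_def rj by linarith+
      have "\<lfloor>5 * t\<rfloor> < 5" using t by (simp add: floor_less_iff)
      then have j: "j < 5" unfolding j_def by linarith
      have "t = real j / 5 + 1/5 * s" by (simp add: s_def field_simps)
      then have "coding t = vicsek_map (Suc j) (coding s)" using coding_shift[OF s j] by simp
      then show "coding t \<in> (\<Union>i\<in>{1..5}. vicsek_map i ` coding ` {0..<1})"
        using s j by (intro UN_I[of "Suc j"]) auto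
    qed
  qed
  then show ?thesis using assms by blast
qed

text \<open>Image of Lebesgue measure under the coding: the witness for the definite description of
  \<open>vicsek_measure\<close>.\<close>

definition coding_measure :: "pt measure" where
  "coding_measure = distr (restrict_space lborel {0..<1}) (restrict_space borel vicsek_set) coding"

lemma sets_coding_measure [measurable_cong]: "sets coding_measure = sets (restrict_space borel vicsek_set)"
  and space_coding_measure: "space coding_measure = vicsek_set"
  by (simp_all add: coding_measure_def space_restrict_space)

lemma coding_measurable' [measurable]:
  "coding \<in> measurable (restrict_space lborel {0..<1}) (restrict_space borel vicsek_set)"
  by (intro measurable_restrict_space2 measurable_restrict_space1)
     (auto simp: space_restrict_space coding_vicsek_set)

lemma prob_space_coding_measure: "prob_space coding_measure"
proof -
  have "prob_space (restrict_space lborel {0..<1::real})"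
    by (intro prob_spaceI) (simp add: emeasure_restrict_space space_restrict_space)
  then show ?thesis unfolding coding_measure_def by (rule prob_space.prob_space_distr) measurable
qed

lemma vicsek_set_borel [measurable]: "vicsek_set \<in> sets borel"
  using compact_vicsek_set by (rule borel_compact)

lemma vicsek_map_measurable_set [measurable]:
  "i \<in> {1..5} \<Longrightarrow> vicsek_map i \<in> measurable (restrict_space borel vicsek_set) (restrict_space borel vicsek_set)"
  by (intro measurable_restrict_space2 measurable_restrict_space1 borel_measurable_continuous_onI continuous_intros)
     (auto simp: space_restrict_space vicsek_map_vicsek_set)

text \<open>[0,1) splits into the intervals [j/5, (j+1)/5). On each of them t = (j + s) / 5 has
  Jacobian 1/5, and \<open>coding_shift\<close> turns the integrand into h composed with the map j +
  1.\<close>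

lemma nn_integral_coding_selfsim:
  fixes h :: "pt \<Rightarrow> ennreal"
  assumes h [measurable]: "h \<in> borel_measurable (restrict_space borel vicsek_set)"
  shows "(\<integral>\<^sup>+x. h x \<partial>coding_measure) = (\<Sum>i\<in>{1..5}. ennreal (1/5) * (\<integral>\<^sup>+x. h (vicsek_map i x) \<partial>coding_measure))"
proof -
  have pull: "(\<integral>\<^sup>+x. k x \<partial>coding_measure) = (\<integral>\<^sup>+t. k (coding t) * indicator {0..<1} t \<partial>lborel)"
    if [measurable]: "k \<in> borel_measurable (restrict_space borel vicsek_set)" for k :: "pt \<Rightarrow> ennreal"
    unfolding coding_measure_def by (simp add: nn_integral_distr nn_integral_restrict_space)
  define F where "F t = h (coding t) * indicator {0..<1} t" for t
  have "(\<lambda>t. h (coding t)) \<in> borel_measurable (restrict_space lborel {0..<1})" by measurable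
  then have F [measurable]: "F \<in> borel_measurable borel"
    unfolding F_def by (subst (asm) borel_measurable_restrict_space_iff_ennreal) auto
  have split: "F t = (\<Sum>j<5. F t * indicator {real j / 5..<real j / 5 + 1/5} t)" for t
  proof (cases "t \<in> {0..<1}")
    case True
    define m where "m = nat \<lfloor>5 * t\<rfloor>"
    have m: "m < 5" "real m / 5 \<le> t" "t < real m / 5 + 1/5" using True by (auto simp: m_def) linarith+
    have "(\<Sum>j<5. F t * indicator {real j / 5..<real j / 5 + 1/5} t) = (\<Sum>j<5. if j = m then F t else 0)"
    proof (rule sum.cong)
      fix j assume "j \<in> {..<5::nat}"
      have "t \<in> {real j / 5..<real j / 5 + 1/5} \<longleftrightarrow> j = m"
      proof
        assume t: "t \<in> {real j / 5..<real j / 5 + 1/5}"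
        then have "real j < real m + 1" "real m < real j + 1" using m by auto
        then show "j = m" by linarith
      qed (use m in auto)
      then show "F t * indicator {real j / 5..<real j / 5 + 1/5} t = (if j = m then F t else 0)"
        by (simp only: indicator_def) simp
    qed simp
    then show ?thesis using m by simp
  qed (simp add: F_def)
  have "(\<integral>\<^sup>+x. h x \<partial>coding_measure) = (\<integral>\<^sup>+t. F t \<partial>lborel)" using pull[OF h] by (simp add: F_def)
  also have "\<dots> = (\<Sum>j<5. \<integral>\<^sup>+t. F t * indicator {real j / 5..<real j / 5 + 1/5} t \<partial>lborel)"
  proof -
    have "(\<integral>\<^sup>+t. F t \<partial>lborel) = (\<integral>\<^sup>+t. (\<Sum>j<5. F t * indicator {real j / 5..<real j / 5 + 1/5} t) \<partial>lborel)"
      by (intro nn_integral_cong split)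
    also have "\<dots> = (\<Sum>j<5. \<integral>\<^sup>+t. F t * indicator {real j / 5..<real j / 5 + 1/5} t \<partial>lborel)"
      by (rule nn_integral_sum) measurable
    finally show ?thesis .
  qed
  also have "\<dots> = (\<Sum>j<5. ennreal (1/5) * (\<integral>\<^sup>+x. h (vicsek_map (Suc j) x) \<partial>coding_measure))"
  proof (rule sum.cong)
    fix j assume j: "j \<in> {..<5::nat}"
    have m: "(\<lambda>x. h (vicsek_map (Suc j) x)) \<in> borel_measurable (restrict_space borel vicsek_set)"
      using j by (intro measurable_compose[OF vicsek_map_measurable_set h]) auto
    have "(\<integral>\<^sup>+t. F t * indicator {real j / 5..<real j / 5 + 1/5} t \<partial>lborel) =
      ennreal \<bar>1/5\<bar> * (\<integral>\<^sup>+s. F (real j / 5 + 1/5 * s) * indicator {real j / 5..<real j / 5 + 1/5} (real j / 5 + 1/5 * s) \<partial>lborel)"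
      by (rule nn_integral_real_affine) auto
    also have "(\<integral>\<^sup>+s. F (real j / 5 + 1/5 * s) * indicator {real j / 5..<real j / 5 + 1/5} (real j / 5 + 1/5 * s) \<partial>lborel)
      = (\<integral>\<^sup>+s. h (vicsek_map (Suc j) (coding s)) * indicator {0..<1} s \<partial>lborel)"
    proof (rule nn_integral_cong)
      fix s :: real
      show "F (real j / 5 + 1/5 * s) * indicator {real j / 5..<real j / 5 + 1/5} (real j / 5 + 1/5 * s)
        = h (vicsek_map (Suc j) (coding s)) * indicator {0..<1} s"
      proof (cases "s \<in> {0..<1}")
        case True
        have "j \<le> 4" using j by simp
        then have "real j \<le> 4" by simp
        then have "real j / 5 + 1/5 * s \<in> {0..<1}" using True by auto
        then show ?thesis using True j coding_shift[of s j] by (simp add: F_def)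
      qed (auto simp: indicator_def)
    qed
    also have "\<dots> = (\<integral>\<^sup>+x. h (vicsek_map (Suc j) x) \<partial>coding_measure)" by (rule pull[OF m, symmetric])
    finally show "(\<integral>\<^sup>+t. F t * indicator {real j / 5..<real j / 5 + 1/5} t \<partial>lborel)
      = ennreal (1/5) * (\<integral>\<^sup>+x. h (vicsek_map (Suc j) x) \<partial>coding_measure)" by simp
  qed simp
  also have "\<dots> = (\<Sum>i\<in>{1..5}. ennreal (1/5) * (\<integral>\<^sup>+x. h (vicsek_map i x) \<partial>coding_measure))"
    by (rule sum.reindex_bij_witness[of _ "\<lambda>i. i - 1" Suc]) auto
  finally show ?thesis .
qed

text \<open>Positive and negative parts are treated separately by the nonnegative version;
  integrability keeps all five pieces finite, so that they can be subtracted.\<close>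

lemma integral_coding_selfsim:
  fixes h :: "pt \<Rightarrow> real"
  assumes int: "integrable coding_measure h"
  shows "i \<in> {1..5} \<Longrightarrow> integrable coding_measure (\<lambda>x. h (vicsek_map i x))"
    "(LINT x|coding_measure. h x) = (\<Sum>i\<in>{1..5}. 1/5 * (LINT x|coding_measure. h (vicsek_map i x)))"
proof -
  have h [measurable]: "h \<in> borel_measurable (restrict_space borel vicsek_set)"
    using borel_measurable_integrable[OF int] by (simp add: measurable_cong_sets[OF sets_coding_measure refl])
  have finite_part: "(\<integral>\<^sup>+x. ennreal (k (vicsek_map i x)) \<partial>coding_measure) < \<infinity>"
    if "k \<in> borel_measurable (restrict_space borel vicsek_set)" "(\<integral>\<^sup>+x. ennreal (k x) \<partial>coding_measure) < \<infinity>" "i \<in> {1..5}" for k i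
  proof -
    have "ennreal (1/5) * (\<integral>\<^sup>+x. ennreal (k (vicsek_map i x)) \<partial>coding_measure)
      \<le> (\<Sum>i\<in>{1..5}. ennreal (1/5) * (\<integral>\<^sup>+x. ennreal (k (vicsek_map i x)) \<partial>coding_measure))"
      using that(3) by (intro member_le_sum) auto
    also have "\<dots> < \<infinity>" using nn_integral_coding_selfsim[of "\<lambda>x. ennreal (k x)"] that by simp
    finally show ?thesis by (auto simp: ennreal_mult_less_top)
  qed
  have meas: "(\<lambda>x. k (vicsek_map i x)) \<in> borel_measurable coding_measure"
    if "i \<in> {1..5}" "k \<in> borel_measurable (restrict_space borel vicsek_set)" for i and k :: "pt \<Rightarrow> real"
    using measurable_compose[OF vicsek_map_measurable_set[OF that(1)] that(2)]
    by (simp add: measurable_cong_sets[OF sets_coding_measure refl])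
  show int': "integrable coding_measure (\<lambda>x. h (vicsek_map i x))" if i: "i \<in> {1..5}" for i
  proof (rule integrableI_bounded)
    show "(\<integral>\<^sup>+x. ennreal (norm (h (vicsek_map i x))) \<partial>coding_measure) < \<infinity>"
      using int i by (intro finite_part[of "\<lambda>x. norm (h x)"]) (auto simp: integrable_iff_bounded)
  qed (rule meas[OF i h])
  have part: "enn2real (\<integral>\<^sup>+x. ennreal (k x) \<partial>coding_measure) = (\<Sum>i\<in>{1..5}. 1/5 * enn2real (\<integral>\<^sup>+x. ennreal (k (vicsek_map i x)) \<partial>coding_measure))"
    if k: "k \<in> borel_measurable (restrict_space borel vicsek_set)" "(\<integral>\<^sup>+x. ennreal (k x) \<partial>coding_measure) < \<infinity>" for k
  proof -
    have "enn2real (\<integral>\<^sup>+x. ennreal (k x) \<partial>coding_measure)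
       = enn2real (\<Sum>i\<in>{1..5}. ennreal (1/5) * (\<integral>\<^sup>+x. ennreal (k (vicsek_map i x)) \<partial>coding_measure))"
      using nn_integral_coding_selfsim[of "\<lambda>x. ennreal (k x)"] k by simp
    also have "\<dots> = (\<Sum>i\<in>{1..5}. enn2real (ennreal (1/5) * (\<integral>\<^sup>+x. ennreal (k (vicsek_map i x)) \<partial>coding_measure)))"
      using finite_part[OF k] by (subst enn2real_sum) (auto simp: ennreal_mult_less_top)
    finally show ?thesis by (simp add: enn2real_mult)
  qed
  have fin: "(\<integral>\<^sup>+x. ennreal (h x) \<partial>coding_measure) < \<infinity>" "(\<integral>\<^sup>+x. ennreal (- h x) \<partial>coding_measure) < \<infinity>"
    using int unfolding real_integrable_def by (auto simp: less_top)
  have "(LINT x|coding_measure. h x) = (\<Sum>i\<in>{1..5}. 1/5 * enn2real (\<integral>\<^sup>+x. ennreal (h (vicsek_map i x)) \<partial>coding_measure))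
     - (\<Sum>i\<in>{1..5}. 1/5 * enn2real (\<integral>\<^sup>+x. ennreal (- h (vicsek_map i x)) \<partial>coding_measure))"
    unfolding real_lebesgue_integral_def[OF int] part[OF h fin(1)] using part[OF _ fin(2)] h by simp
  also have "\<dots> = (\<Sum>i\<in>{1..5}. 1/5 * (LINT x|coding_measure. h (vicsek_map i x)))"
    unfolding sum_subtractf[symmetric] by (rule sum.cong) (simp_all add: real_lebesgue_integral_def[OF int'] right_diff_distrib)
  finally show "(LINT x|coding_measure. h x) = (\<Sum>i\<in>{1..5}. 1/5 * (LINT x|coding_measure. h (vicsek_map i x)))" .
qed

lemma integral_coding_words:
  fixes h :: "pt \<Rightarrow> real"
  assumes "integrable coding_measure h"
  shows "(\<forall>w\<in>words n. integrable coding_measure (\<lambda>x. h (word_map w x))) \<and>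
    (LINT x|coding_measure. h x) = (1/5) ^ n * (\<Sum>w\<in>words n. LINT x|coding_measure. h (word_map w x))"
  using assms
proof (induction n arbitrary: h)
  case (Suc n)
  have IH: "\<forall>w\<in>words n. integrable coding_measure (\<lambda>x. h (vicsek_map i (word_map w x)))"
    "(LINT x|coding_measure. h (vicsek_map i x)) = (1/5) ^ n * (\<Sum>w\<in>words n. LINT x|coding_measure. h (vicsek_map i (word_map w x)))"
    if "i \<in> {1..5}" for i
    using Suc.IH[OF integral_coding_selfsim(1)[OF Suc.prems that]] by auto
  have "\<forall>w\<in>words (Suc n). integrable coding_measure (\<lambda>x. h (word_map w x))"
  proof
    fix w assume "w \<in> words (Suc n)"
    then obtain i v where w: "w = i # v" "i \<in> {1..5}" "v \<in> words n" by (rule words_SucE)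
    then show "integrable coding_measure (\<lambda>x. h (word_map w x))" using IH(1)[OF w(2)] by simp
  qed
  moreover have "(LINT x|coding_measure. h x) = (1/5) ^ Suc n * (\<Sum>w\<in>words (Suc n). LINT x|coding_measure. h (word_map w x))"
    unfolding integral_coding_selfsim(2)[OF Suc.prems] sum_words_Suc sum_distrib_left
    by (rule sum.cong) (simp_all add: IH(2) sum_distrib_left)
  ultimately show ?case by blast
qed simp

interpretation coding: prob_space coding_measure by (rule prob_space_coding_measure)

lemma sets_restrict_vicsek_iff: "A \<in> sets (restrict_space borel vicsek_set) \<longleftrightarrow> A \<in> sets borel \<and> A \<subseteq> vicsek_set"
  by (subst sets_restrict_space_iff) auto

lemma word_map_measurable_set [measurable]:
  "w \<in> words n \<Longrightarrow> word_map w \<in> measurable (restrict_space borel vicsek_set) (restrict_space borel vicsek_set)"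
  by (intro measurable_restrict_space2 measurable_restrict_space1 borel_measurable_continuous_onI continuous_intros)
     (auto simp: space_restrict_space word_map_vicsek_set)

section \<open>Measure of cells and balls\<close>

lemma measure_coding_words:
  assumes "A \<in> sets coding_measure"
  shows "measure coding_measure A = (1/5) ^ n * (\<Sum>w\<in>words n. measure coding_measure (word_map w -` A \<inter> vicsek_set))"
proof -
  have "measure coding_measure A = (LINT x|coding_measure. indicator A x)"
    using assms sets.sets_into_space[OF assms] by (simp add: Int_absorb2)
  also have "\<dots> = (1/5) ^ n * (\<Sum>w\<in>words n. LINT x|coding_measure. indicator A (word_map w x))"
    using assms integral_coding_words[of "indicator A" n] by (simp add: coding.emeasure_finite less_top[symmetric])
  also have "(\<Sum>w\<in>words n. LINT x|coding_measure. indicator A (word_map w x) :: real) = (\<Sum>w\<in>words n. measure coding_measure (word_map w -` A \<inter> vicsek_set))"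
  proof (rule sum.cong)
    fix w assume w: "w \<in> words n"
    have "word_map w -` A \<inter> space (restrict_space borel vicsek_set) \<in> sets (restrict_space borel vicsek_set)"
      using measurable_sets[OF word_map_measurable_set[OF w]] assms by (simp add: sets_coding_measure)
    then have B: "word_map w -` A \<inter> vicsek_set \<in> sets coding_measure"
      by (simp add: sets_coding_measure space_restrict_space)
    have "(LINT x|coding_measure. indicator A (word_map w x)) = (LINT x|coding_measure. indicator (word_map w -` A \<inter> vicsek_set) x)"
      by (intro Bochner_Integration.integral_cong) (auto simp: indicator_def space_coding_measure)
    also have "\<dots> = measure coding_measure (word_map w -` A \<inter> vicsek_set)"
      using B by (simp add: space_coding_measure Int_assoc)
    finally show "(LINT x|coding_measure. indicator A (word_map w x)) = measure coding_measure (word_map w -` A \<inter> vicsek_set)" .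
  qed simp
  finally show ?thesis .
qed

text \<open>Only cells that meet the ball contribute, each at most 5^(-n), and
  \<open>card_cells_near\<close> bounds their number independently of n.\<close>

lemma measure_coding_le_ball:
  assumes A: "A \<in> sets coding_measure" "A \<subseteq> cball z (\<rho> / 3 ^ n)" and "0 \<le> \<rho>"
  shows "measure coding_measure A \<le> ((\<rho> + half_side) / half_side + 1)\<^sup>2 * (1/5) ^ n"
proof -
  define N where "N = {w \<in> words n. \<exists>x\<in>vicsek_square. dist z (word_map w x) \<le> \<rho> / 3 ^ n}"
  have "(\<Sum>w\<in>words n. measure coding_measure (word_map w -` A \<inter> vicsek_set)) \<le> (\<Sum>w\<in>words n. if w \<in> N then 1 else 0)"
  proof (rule sum_mono)
    fix w assume w: "w \<in> words n"
    have "word_map w -` A \<inter> vicsek_set = {}" if "w \<notin> N"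
    proof (rule ccontr)
      assume "word_map w -` A \<inter> vicsek_set \<noteq> {}"
      then obtain x where "x \<in> vicsek_set" "word_map w x \<in> A" by blast
      then have "x \<in> vicsek_square" "word_map w x \<in> cball z (\<rho> / 3 ^ n)" using A(2) vicsek_set_square by blast+
      then have "w \<in> N" using w unfolding N_def mem_cball by blast
      then show False using that by contradiction
    qed
    then show "measure coding_measure (word_map w -` A \<inter> vicsek_set) \<le> (if w \<in> N then 1 else 0)"
      using coding.prob_le_1 by auto
  qed
  also have "\<dots> = real (card N)" by (simp add: N_def sum.If_cases Int_def)
  also have "\<dots> \<le> ((\<rho> + half_side) / half_side + 1)\<^sup>2"
    unfolding N_def by (rule card_cells_near[OF assms(3)])
  finally have "(1/5) ^ n * (\<Sum>w\<in>words n. measure coding_measure (word_map w -` A \<inter> vicsek_set)) \<le> (1/5) ^ n * ((\<rho> + half_side) / half_side + 1)\<^sup>2"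
    by (rule mult_left_mono) simp
  then show ?thesis unfolding measure_coding_words[OF A(1), of n] by (simp add: mult.commute)
qed

text \<open>Radius 0 is allowed in \<open>measure_coding_le_ball\<close> at every level, and the
  bound tends to 0.\<close>

lemma measure_coding_singleton:
  assumes "A \<subseteq> {x}" shows "measure coding_measure A = 0"
proof (cases "A \<in> sets coding_measure")
  case True
  have "measure coding_measure A \<le> ((0 + half_side) / half_side + 1)\<^sup>2 * (1/5) ^ n" for n
    using True assms by (intro measure_coding_le_ball[of A x 0 n]) auto
  moreover have "(\<lambda>n. ((0 + half_side) / half_side + 1)\<^sup>2 * (1/5) ^ n) \<longlonglongrightarrow> ((0 + half_side) / half_side + 1)\<^sup>2 * 0"
    by (intro tendsto_intros LIMSEQ_realpow_zero) auto
  ultimately have "measure coding_measure A \<le> ((0 + half_side) / half_side + 1)\<^sup>2 * 0"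
    using LIMSEQ_le_const by blast
  then show ?thesis by (simp add: measure_le_0_iff)
qed (simp add: measure_notin_sets)

text \<open>Common leading letters are stripped by injectivity; at the first differing letter the
  cells lie in distinct first-level squares, which meet in at most one point.\<close>

lemma cells_inter:
  "w \<in> words n \<Longrightarrow> w' \<in> words n \<Longrightarrow> w \<noteq> w' \<Longrightarrow> \<exists>c. word_map w ` vicsek_square \<inter> word_map w' ` vicsek_square \<subseteq> {c}"
proof (induction n arbitrary: w w')
  case (Suc n)
  obtain i v where w: "w = i # v" "i \<in> {1..5}" "v \<in> words n" using Suc.prems(1) by (rule words_SucE)
  obtain j v' where w': "w' = j # v'" "j \<in> {1..5}" "v' \<in> words n" using Suc.prems(2) by (rule words_SucE)
  have im: "word_map (k # u) ` A = vicsek_map k ` word_map u ` A" for k u A by (simp add: image_image)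
  show ?case
  proof (cases "i = j")
    case True
    then have "v \<noteq> v'" using Suc.prems(3) w(1) w'(1) by simp
    then obtain c where "word_map v ` vicsek_square \<inter> word_map v' ` vicsek_square \<subseteq> {c}"
      using Suc.IH[OF w(3) w'(3)] by blast
    then have "vicsek_map i ` (word_map v ` vicsek_square \<inter> word_map v' ` vicsek_square) \<subseteq> {vicsek_map i c}" by blast
    then show ?thesis unfolding w(1) w'(1) True im
      by (subst image_Int[OF vicsek_map_inj, symmetric]) blast
  next
    case False
    have sq: "word_map u ` vicsek_square \<subseteq> vicsek_square" for u using word_map_square by blast
    have "\<exists>c. vicsek_map i ` vicsek_square \<inter> vicsek_map j ` vicsek_square \<subseteq> {c}"
    proof (cases "vicsek_map i ` vicsek_square \<inter> vicsek_map j ` vicsek_square = {}")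
      case False
      then obtain x y where xy: "x \<in> vicsek_square" "y \<in> vicsek_square" "vicsek_map i x = vicsek_map j y" by blast
      have "z = vicsek_map i x" if z: "z \<in> vicsek_map i ` vicsek_square" "z \<in> vicsek_map j ` vicsek_square" for z
      proof -
        obtain x' y' where x': "x' \<in> vicsek_square" "y' \<in> vicsek_square" "z = vicsek_map i x'" "z = vicsek_map j y'"
          using z by blast
        then have "x' = x" using square_inter_same[OF w(2) w'(2) \<open>i \<noteq> j\<close> xy, of x' y'] by simp
        then show ?thesis using x' by simp
      qed
      then show ?thesis by blast
    qed auto
    then obtain c where c: "vicsek_map i ` vicsek_square \<inter> vicsek_map j ` vicsek_square \<subseteq> {c}" ..
    have "vicsek_map i ` word_map v ` vicsek_square \<inter> vicsek_map j ` word_map v' ` vicsek_square \<subseteq> {c}"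
      by (rule order_trans[OF Int_mono[OF image_mono[OF sq] image_mono[OF sq]] c])
    then show ?thesis unfolding w(1) w'(1) im by (rule exI)
  qed
qed simp

lemma cell_sets: "w \<in> words n \<Longrightarrow> word_map w ` vicsek_set \<in> sets (restrict_space borel vicsek_set)"
proof -
  assume w: "w \<in> words n"
  have "compact (word_map w ` vicsek_set)"
    using compact_vicsek_set by (intro compact_continuous_image continuous_intros)
  then show ?thesis using word_map_vicsek_set[OF w] by (auto simp: sets_restrict_vicsek_iff borel_compact)
qed

text \<open>In the decomposition over words of length n, the word w contributes the full mass and
  every other word at most a single point, hence nothing.\<close>

lemma measure_coding_cell:
  assumes w: "w \<in> words n"
  shows "measure coding_measure (word_map w ` vicsek_set) = (1/5) ^ n"
proof -
  have "(\<Sum>v\<in>words n. measure coding_measure (word_map v -` word_map w ` vicsek_set \<inter> vicsek_set)) = (\<Sum>v\<in>words n. if v = w then 1 else 0)"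
  proof (rule sum.cong)
    fix v assume v: "v \<in> words n"
    show "measure coding_measure (word_map v -` word_map w ` vicsek_set \<inter> vicsek_set) = (if v = w then 1 else 0)"
    proof (cases "v = w")
      case True
      have "word_map w -` word_map w ` vicsek_set \<inter> vicsek_set = vicsek_set"
        using inj_vimage_image_eq[OF inj_word_map] by simp
      then show ?thesis using True coding.prob_space by (simp add: space_coding_measure)
    next
      case False
      obtain c where c: "word_map v ` vicsek_square \<inter> word_map w ` vicsek_square \<subseteq> {c}" using cells_inter[OF v w False] by blast
      have "\<exists>x. word_map v -` word_map w ` vicsek_set \<inter> vicsek_set \<subseteq> {x}"
      proof (cases "word_map v -` word_map w ` vicsek_set \<inter> vicsek_set = {}")
        case False
        then obtain x where x: "x \<in> word_map v -` word_map w ` vicsek_set \<inter> vicsek_set" by blast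
        have c': "word_map v y = c" if "y \<in> word_map v -` word_map w ` vicsek_set \<inter> vicsek_set" for y
          using that c vicsek_set_square by blast
        have "y = x" if "y \<in> word_map v -` word_map w ` vicsek_set \<inter> vicsek_set" for y
          using c'[OF that] c'[OF x] inj_word_map[of v] by (metis injD)
        then show ?thesis by blast
      qed auto
      then show ?thesis using False measure_coding_singleton by auto
    qed
  qed simp
  also have "\<dots> = 1" using w by simp
  finally show ?thesis
    using measure_coding_words[of "word_map w ` vicsek_set" n] cell_sets[OF w] by (simp add: sets_coding_measure)
qed

text \<open>For an arbitrary candidate M, null overlaps are not known beforehand. Subadditivity
  bounds the cells in W and the remaining cells from above, and the total mass 1 forces equality in
  both bounds.\<close>

lemma measure_cells_union:
  assumes M: "prob_space M" "sets M = sets (restrict_space borel vicsek_set)"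
    "\<And>w. w \<in> words n \<Longrightarrow> measure M (word_map w ` vicsek_set) = (1/5) ^ n" and W: "W \<subseteq> words n"
  shows "measure M (\<Union>w\<in>W. word_map w ` vicsek_set) = real (card W) * (1/5) ^ n"
proof -
  interpret prob_space M by fact
  have sp: "space M = vicsek_set" using sets_eq_imp_space_eq[OF M(2)] by (simp add: space_restrict_space)
  have fin: "finite V" if "V \<subseteq> words n" for V using that finite_words finite_subset by blast
  have S: "word_map w ` vicsek_set \<in> sets M" if "w \<in> words n" for w using cell_sets[OF that] M(2) by simp
  have le: "measure M (\<Union>w\<in>V. word_map w ` vicsek_set) \<le> real (card V) * (1/5) ^ n" if V: "V \<subseteq> words n" for V
  proof -
    have "measure M (\<Union>w\<in>V. word_map w ` vicsek_set) \<le> (\<Sum>w\<in>V. measure M (word_map w ` vicsek_set))"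
      using fin[OF V] S V by (intro finite_measure_subadditive_finite) auto
    also have "\<dots> = (\<Sum>w\<in>V. (1/5) ^ n)" using V by (intro sum.cong refl M(3)) auto
    finally show ?thesis by simp
  qed
  have "1 = measure M (space M)" using prob_space by simp
  also have "space M = (\<Union>w\<in>W. word_map w ` vicsek_set) \<union> (\<Union>w\<in>words n - W. word_map w ` vicsek_set)"
  proof -
    have "(\<Union>w\<in>W. word_map w ` vicsek_set) \<union> (\<Union>w\<in>words n - W. word_map w ` vicsek_set) = (\<Union>w\<in>words n. word_map w ` vicsek_set)"
      using W by blast
    then show ?thesis unfolding sp using vicsek_set_words[of n] by (rule trans[OF _ sym, rotated])
  qed
  also have "measure M \<dots> \<le> measure M (\<Union>w\<in>W. word_map w ` vicsek_set) + measure M (\<Union>w\<in>words n - W. word_map w ` vicsek_set)"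
    using S W fin by (intro measure_Un_le sets.finite_UN) auto
  also have "\<dots> \<le> measure M (\<Union>w\<in>W. word_map w ` vicsek_set) + real (card (words n - W)) * (1/5) ^ n"
    using le[of "words n - W"] by simp
  also have "real (card (words n - W)) = 5 ^ n - real (card W)"
    using W card_mono[OF finite_words W] fin[OF W] by (subst card_Diff_subset) (auto simp: card_words of_nat_diff)
  finally have "1 \<le> measure M (\<Union>w\<in>W. word_map w ` vicsek_set) + (5 ^ n - real (card W)) * (1/5) ^ n" .
  moreover have "(5 ^ n - real (card W)) * (1/5) ^ n = 1 - real (card W) * (1/5) ^ n"
    by (simp add: left_diff_distrib flip: power_mult_distrib)
  ultimately show ?thesis using le[OF W] by linarith
qed

lemma vicsek_set_snoc: "w \<in> words n \<Longrightarrow> word_map w ` vicsek_set = (\<Union>i\<in>{1..5}. word_map (w @ [i]) ` vicsek_set)"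
proof -
  have v: "vicsek_set = (\<Union>i\<in>{1..5}. vicsek_map i ` vicsek_set)"
    using vicsek_set_words[of 1] unfolding One_nat_def UN_words_Suc by simp
  have "word_map w ` (\<Union>i\<in>{1..5}. vicsek_map i ` vicsek_set) = (\<Union>i\<in>{1..5}. word_map (w @ [i]) ` vicsek_set)"
    by (simp add: image_UN image_image)
  then show ?thesis using v by simp
qed

lemma word_map_diameter:
  assumes "w \<in> words n" "x \<in> word_map w ` vicsek_set" "y \<in> word_map w ` vicsek_set"
  shows "dist x y \<le> 4 / 3 ^ n"
  using dist_le_vicsek_dist[of x y] vicsek_dist_shared_vertex[OF assms(1,1), of 5 5 x y] assms word_map_vicsek_set[OF assms(1)]
  by force

text \<open>A relatively open set is the increasing union over n of the cells of level n inside it,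
  so its measure is determined by counting cells. Such sets form an intersection-stable
  generator.\<close>

lemma vicsek_measure_unique:
  assumes M: "prob_space M" "sets M = sets (restrict_space borel vicsek_set)"
    "\<And>w. set w \<subseteq> {1..5} \<Longrightarrow> measure M (word_map w ` vicsek_set) = (1/5) ^ length w"
  shows "M = coding_measure"
proof -
  interpret prob_space M by fact
  define E where "E = (\<inter>) vicsek_set ` {U::pt set. open U}"
  have sp: "space M = vicsek_set" using sets_eq_imp_space_eq[OF M(2)] by (simp add: space_restrict_space)
  have cM: "measure M (word_map w ` vicsek_set) = (1/5) ^ n" if "w \<in> words n" for w n
    using M(3)[of w] that by (auto simp: words_def)
  have sets_E: "sets (restrict_space borel vicsek_set) = sigma_sets vicsek_set E"
    unfolding E_def sets_restrict_space borel_def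
    using vicsek_set_borel by (subst sigma_sets_Int[symmetric]) (simp_all add: borel_def)
  have open_eq: "measure M (vicsek_set \<inter> U) = measure coding_measure (vicsek_set \<inter> U)" if U: "open U" for U
  proof -
    define W where "W n = {w \<in> words n. word_map w ` vicsek_set \<subseteq> U}" for n
    define V where "V n = (\<Union>w\<in>W n. word_map w ` vicsek_set)" for n
    have "incseq V"
    proof (rule incseq_SucI)
      fix n
      show "V n \<subseteq> V (Suc n)"
      proof
        fix x assume "x \<in> V n"
        then obtain w where w: "w \<in> words n" "word_map w ` vicsek_set \<subseteq> U" "x \<in> word_map w ` vicsek_set" by (auto simp: V_def W_def)
        then obtain i where i: "i \<in> {1..5}" "x \<in> word_map (w @ [i]) ` vicsek_set" using vicsek_set_snoc[OF w(1)] by blast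
        have "word_map (w @ [i]) ` vicsek_set \<subseteq> U" using vicsek_set_snoc[OF w(1)] w(2) i(1) by blast
        then have "w @ [i] \<in> W (Suc n)" using words_snoc[OF w(1) i(1)] by (simp add: W_def)
        then show "x \<in> V (Suc n)" using i unfolding V_def by blast
      qed
    qed
    moreover have Vs: "V n \<in> sets M" for n
      using cell_sets M(2) unfolding V_def W_def by (intro sets.finite_UN) auto
    moreover have un: "(\<Union>n. V n) = vicsek_set \<inter> U"
    proof (intro equalityI subsetI)
      fix x assume "x \<in> (\<Union>n. V n)"
      then obtain n w where w: "w \<in> words n" "word_map w ` vicsek_set \<subseteq> U" "x \<in> word_map w ` vicsek_set" by (auto simp: V_def W_def)
      then show "x \<in> vicsek_set \<inter> U" using word_map_vicsek_set[OF w(1)] by blast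
    next
      fix x assume x: "x \<in> vicsek_set \<inter> U"
      then obtain e where e: "0 < e" "ball x e \<subseteq> U" using U open_contains_ball by blast
      obtain n where n: "4 / 3 ^ n < e" using small_power_third[OF e(1)] .
      obtain w where w: "w \<in> words n" "x \<in> word_map w ` vicsek_set" using x vicsek_set_words[of n] by blast
      have "word_map w ` vicsek_set \<subseteq> ball x e"
        using word_map_diameter[OF w] n by (intro subsetI) (force simp: mem_ball)
      then have "w \<in> W n" using w e by (auto simp: W_def)
      then show "x \<in> (\<Union>n. V n)" using w unfolding V_def by blast
    qed
    ultimately have "(\<lambda>n. measure M (V n)) \<longlonglongrightarrow> measure M (vicsek_set \<inter> U)"
      using finite_Lim_measure_incseq[of V] by auto
    moreover have "(\<lambda>n. measure coding_measure (V n)) \<longlonglongrightarrow> measure coding_measure (vicsek_set \<inter> U)"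
      using coding.finite_Lim_measure_incseq[of V] un \<open>incseq V\<close> Vs M(2) by (auto simp: sets_coding_measure)
    moreover have "measure M (V n) = measure coding_measure (V n)" for n
    proof -
      have "W n \<subseteq> words n" by (auto simp: W_def)
      then show ?thesis unfolding V_def
        using measure_cells_union[OF M(1,2) cM] measure_cells_union[OF prob_space_coding_measure sets_coding_measure measure_coding_cell] by simp
    qed
    ultimately show ?thesis by (simp add: LIMSEQ_unique)
  qed
  show ?thesis
  proof (rule measure_eqI_generator_eq[where E = E and \<Omega> = vicsek_set and A = "\<lambda>_. vicsek_set"])
    show "Int_stable E"
    proof (rule Int_stableI)
      fix a b assume "a \<in> E" "b \<in> E"
      then obtain U V where "open U" "open V" "a = vicsek_set \<inter> U" "b = vicsek_set \<inter> V" unfolding E_def by blast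
      then have "a \<inter> b = vicsek_set \<inter> (U \<inter> V)" "open (U \<inter> V)" by auto
      then show "a \<inter> b \<in> E" unfolding E_def by blast
    qed
    show "emeasure M X = emeasure coding_measure X" if "X \<in> E" for X
      using that open_eq by (auto simp: E_def emeasure_eq_measure coding.emeasure_eq_measure)
    show "range (\<lambda>_::nat. vicsek_set) \<subseteq> E" unfolding E_def by (auto intro!: image_eqI[of _ _ UNIV])
    show "sets M = sigma_sets vicsek_set E" using M(2) sets_E by simp
    show "sets coding_measure = sigma_sets vicsek_set E" using sets_coding_measure sets_E by simp
  qed (auto simp: E_def)
qed

lemma vicsek_measure_eq: "vicsek_measure = coding_measure"
  unfolding vicsek_measure_def
proof (rule the_equality)
  show "prob_space coding_measure \<and> sets coding_measure = sets (restrict_space borel vicsek_set) \<and>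
     (\<forall>w. set w \<subseteq> {1..5} \<longrightarrow> measure coding_measure (word_map w ` vicsek_set) = (1/5) ^ length w)"
    using prob_space_coding_measure sets_coding_measure measure_coding_cell by (auto simp: words_def)
qed (use vicsek_measure_unique in blast)

lemma sets_vicsek_measure [measurable_cong]: "sets vicsek_measure = sets (restrict_space borel vicsek_set)"
  and space_vicsek_measure: "space vicsek_measure = vicsek_set"
  and prob_space_vicsek_measure: "prob_space vicsek_measure"
  unfolding vicsek_measure_eq by (rule sets_coding_measure space_coding_measure prob_space_coding_measure)+

lemma measure_vicsek_cell: "w \<in> words n \<Longrightarrow> measure vicsek_measure (word_map w ` vicsek_set) = (1/5) ^ n"
  unfolding vicsek_measure_eq by (rule measure_coding_cell)

lemma integral_vicsek_words:
  fixes h :: "pt \<Rightarrow> real"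
  assumes "integrable vicsek_measure h"
  shows "w \<in> words n \<Longrightarrow> integrable vicsek_measure (\<lambda>x. h (word_map w x))"
    "(LINT x|vicsek_measure. h x) = (1/5) ^ n * (\<Sum>w\<in>words n. LINT x|vicsek_measure. h (word_map w x))"
  using integral_coding_words[of h n] assms unfolding vicsek_measure_eq by auto

definition ball_constant :: "real \<Rightarrow> real" where
  "ball_constant \<rho> = ((\<rho> + half_side) / half_side + 1)\<^sup>2"

lemma ball_constant_pos: "0 \<le> \<rho> \<Longrightarrow> 0 < ball_constant \<rho>"
  using half_side_pos unfolding ball_constant_def by (intro zero_less_power add_nonneg_pos divide_nonneg_pos) auto

lemma vicsek_ball_sets: "x \<in> vicsek_set \<Longrightarrow> vicsek_ball x r \<in> sets vicsek_measure"
  using closed_vicsek_ball[of x r] by (auto simp: sets_vicsek_measure sets_restrict_vicsek_iff borel_closed vicsek_ball_def)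

lemma measure_vicsek_ball_le:
  assumes "x \<in> vicsek_set" "0 \<le> \<rho>"
  shows "measure vicsek_measure (vicsek_ball x (\<rho> / 3 ^ n)) \<le> ball_constant \<rho> * (1/5) ^ n"
  using measure_coding_le_ball[of "vicsek_ball x (\<rho> / 3 ^ n)" x \<rho> n] vicsek_ball_sets[OF assms(1)] vicsek_ball_cball[OF assms(1)] assms
  unfolding vicsek_measure_eq ball_constant_def by blast

lemma measure_vicsek_ball_ge:
  assumes "x \<in> vicsek_set"
  shows "(1/5) ^ n \<le> measure vicsek_measure (vicsek_ball x (4 / 3 ^ n))"
proof -
  interpret prob_space vicsek_measure by (rule prob_space_vicsek_measure)
  obtain w where w: "w \<in> words n" "x \<in> word_map w ` vicsek_set" using assms vicsek_set_words[of n] by blast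
  show ?thesis unfolding measure_vicsek_cell[OF w(1), symmetric]
    using cell_subset_vicsek_ball[OF w] vicsek_ball_sets[OF assms] by (intro finite_measure_mono) auto
qed

section \<open>Convexity of the p-th power and convergence in mean\<close>

text \<open>The function t^p - p t has derivative p (t^(p-1) - 1), which changes sign at 1, so its
  minimum at t = 1 is strict.\<close>

lemma bernoulli_powr_strict:
  fixes x p :: real
  assumes "1 < p" "0 < x" "x \<noteq> 1"
  shows "1 + p * (x - 1) < x powr p"
proof -
  define f where "f t = t powr p - p * t" for t :: real
  have der: "(f has_real_derivative p * (t powr (p - 1) - 1)) (at t)" if "0 < t" for t
    unfolding f_def using that by (auto intro!: derivative_eq_intros simp: algebra_simps)
  have "f 1 < f x"
  proof (cases "1 < x")
    case True
    obtain z where z: "1 < z" "z < x" "f x - f 1 = (x - 1) * (p * (z powr (p - 1) - 1))"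
      using MVT2[OF True, of f "\<lambda>t. p * (t powr (p - 1) - 1)"] der by force
    have "1 < z powr (p - 1)" using z assms by (intro gr_one_powr) auto
    then have "0 < (x - 1) * (p * (z powr (p - 1) - 1))" using True assms by simp
    then show ?thesis using z by simp
  next
    case False
    then have x: "x < 1" using assms by simp
    obtain z where z: "x < z" "z < 1" "f 1 - f x = (1 - x) * (p * (z powr (p - 1) - 1))"
      using MVT2[OF x, of f "\<lambda>t. p * (t powr (p - 1) - 1)"] der assms by force
    have "z powr (p - 1) < z powr 0" using z assms by (intro powr_less_mono') auto
    then have "z powr (p - 1) - 1 < 0" using z assms by simp
    then have "(1 - x) * (p * (z powr (p - 1) - 1)) < 0" using x assms by (intro mult_pos_neg) auto
    then show ?thesis using z by simp
  qed
  then show ?thesis by (simp add: f_def algebra_simps)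
qed

text \<open>The derivative of |a|^p.\<close>

definition powr_slope :: "real \<Rightarrow> real \<Rightarrow> real" where
  "powr_slope p a = p * sgn a * \<bar>a\<bar> powr (p - 1)"

lemma powr_slope_0 [simp]: "powr_slope p 0 = 0"
  by (simp add: powr_slope_def)

text \<open>For a, b > 0 homogeneity reduces the claim to Bernoulli's inequality at b / a. For a > 0
  and b \<le> 0 the tangent is already negative. Negative a is handled by reflection.\<close>

lemma powr_tangent_strict:
  fixes a b p :: real
  assumes p: "1 < p" and ab: "a \<noteq> b"
  shows "\<bar>a\<bar> powr p + powr_slope p a * (b - a) < \<bar>b\<bar> powr p"
proof -
  have pos: "a powr p + p * a powr (p - 1) * (b - a) < \<bar>b\<bar> powr p" if a: "0 < a" and "a \<noteq> b" for a b :: real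
  proof (cases "0 < b")
    case True
    have "1 + p * (b / a - 1) < (b / a) powr p" using that True p by (intro bernoulli_powr_strict) auto
    then have "a powr p * (1 + p * (b / a - 1)) < a powr p * (b / a) powr p" using a by simp
    also have "a powr p * (b / a) powr p = b powr p" using a True by (simp add: powr_divide)
    also have "a powr p * (1 + p * (b / a - 1)) = a powr p + p * a powr (p - 1) * (b - a)"
      using a by (simp add: powr_diff field_simps)
    finally show ?thesis using True by simp
  next
    case False
    have "a powr p = a powr (p - 1) * a" using a by (simp add: powr_diff)
    then have "a powr p + p * a powr (p - 1) * (b - a) = a powr (p - 1) * ((1 - p) * a + p * b)"
      by (simp add: algebra_simps)
    also have "\<dots> < 0"
    proof (rule mult_pos_neg)
      have "(1 - p) * a < 0" using a p by (simp add: mult_neg_pos)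
      moreover have "p * b \<le> 0" using False p by (simp add: mult_nonneg_nonpos)
      ultimately show "(1 - p) * a + p * b < 0" by linarith
    qed (use a in simp)
    also have "0 \<le> \<bar>b\<bar> powr p" by simp
    finally show ?thesis .
  qed
  consider "a = 0" | "0 < a" | "a < 0" by linarith
  then show ?thesis
  proof cases
    case 1
    then show ?thesis using ab by simp
  next
    case 2
    then show ?thesis using pos[OF 2 ab] by (simp add: powr_slope_def)
  next
    case 3
    then show ?thesis using pos[of "-a" "-b"] ab by (simp add: powr_slope_def algebra_simps)
  qed
qed

lemma powr_tangent:
  fixes a b p :: real
  assumes "1 < p"
  shows "\<bar>a\<bar> powr p + powr_slope p a * (b - a) \<le> \<bar>b\<bar> powr p"
  using powr_tangent_strict[OF assms, of a b] by (cases "a = b") auto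

text \<open>Add the tangent inequalities at the midpoint towards a and towards b; the linear terms
  cancel.\<close>

lemma powr_midpoint_strict:
  fixes a b p :: real
  assumes "1 < p" "a \<noteq> b"
  shows "\<bar>(a + b) / 2\<bar> powr p < (\<bar>a\<bar> powr p + \<bar>b\<bar> powr p) / 2"
proof -
  define m where "m = (a + b) / 2"
  have ne: "m \<noteq> a" "m \<noteq> b" using assms by (auto simp: m_def field_simps)
  have "powr_slope p m * (a - m) + powr_slope p m * (b - m) = 0"
    by (simp add: m_def field_simps flip: distrib_left)
  moreover have "x < (u + v) / 2" if "s + t = 0" "x + s < u" "x + t < v" for x s t u v :: real
    using add_strict_mono[OF that(2,3)] that(1) by (simp add: field_simps add_eq_0_iff)
  ultimately show ?thesis
    using powr_tangent_strict[OF assms(1) ne(1)] powr_tangent_strict[OF assms(1) ne(2)]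
    unfolding m_def[symmetric] by blast
qed

lemma powr_midpoint:
  fixes a b p :: real
  assumes "1 < p"
  shows "\<bar>(a + b) / 2\<bar> powr p \<le> (\<bar>a\<bar> powr p + \<bar>b\<bar> powr p) / 2"
  using powr_midpoint_strict[OF assms, of a b] by (cases "a = b") auto

lemma powr_add_le:
  fixes a b p :: real
  assumes "1 < p"
  shows "\<bar>a + b\<bar> powr p \<le> 2 powr (p - 1) * (\<bar>a\<bar> powr p + \<bar>b\<bar> powr p)"
proof -
  have "\<bar>(a + b) / 2\<bar> powr p = \<bar>a + b\<bar> powr p / 2 powr p" by (simp add: powr_divide)
  then have "\<bar>a + b\<bar> powr p / 2 powr p \<le> (\<bar>a\<bar> powr p + \<bar>b\<bar> powr p) / 2" using powr_midpoint[OF assms, of a b] by simp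
  then show ?thesis by (simp add: powr_diff field_simps)
qed

lemma continuous_on_abs_powr:
  fixes p :: real
  assumes "0 < p" "continuous_on A f" shows "continuous_on A (\<lambda>x. \<bar>f x\<bar> powr p)"
  using assms by (intro continuous_on_powr' continuous_intros) auto

text \<open>By homogeneity it suffices to consider the compact set of pairs with norm one that are at least
  a fixed distance apart.\<close>
lemma powr_uniformly_convex:
  fixes p \<epsilon> :: real
  assumes p: "1 < p" and \<epsilon>: "0 < \<epsilon>"
  obtains C where "0 < C" "\<And>a b. \<bar>a - b\<bar> powr p \<le> \<epsilon> * (\<bar>a\<bar> powr p + \<bar>b\<bar> powr p) + C * ((\<bar>a\<bar> powr p + \<bar>b\<bar> powr p) / 2 - \<bar>(a + b) / 2\<bar> powr p)"
proof -
  define D where "D z = (\<bar>fst z\<bar> powr p + \<bar>snd z\<bar> powr p) / 2 - \<bar>(fst z + snd z) / 2\<bar> powr p" for z :: "real \<times> real"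
  define K where "K = {z :: real \<times> real. \<bar>fst z\<bar> powr p + \<bar>snd z\<bar> powr p = 1 \<and> \<epsilon> \<le> \<bar>fst z - snd z\<bar> powr p}"
  have contD: "continuous_on A D" for A
    unfolding D_def using p by (intro continuous_intros continuous_on_abs_powr) auto
  have "compact K"
  proof -
    have "K = {z. \<bar>fst z\<bar> powr p + \<bar>snd z\<bar> powr p = 1} \<inter> {z. \<epsilon> \<le> \<bar>fst z - snd z\<bar> powr p}" unfolding K_def by auto
    moreover have "closed {z :: real \<times> real. \<bar>fst z\<bar> powr p + \<bar>snd z\<bar> powr p = 1}"
      using p by (intro closed_Collect_eq continuous_intros continuous_on_abs_powr) auto
    moreover have "closed {z :: real \<times> real. \<epsilon> \<le> \<bar>fst z - snd z\<bar> powr p}"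
      using p by (intro closed_Collect_le continuous_intros continuous_on_abs_powr) auto
    ultimately have "closed K" by auto
    moreover have "K \<subseteq> cbox (-1, -1) (1, 1)"
    proof
      fix z assume z: "z \<in> K"
      have 1: "\<bar>t\<bar> \<le> 1" if "\<bar>t\<bar> powr p \<le> 1" for t :: real
      proof (rule ccontr)
        assume "\<not> \<bar>t\<bar> \<le> 1"
        then have "1 powr p < \<bar>t\<bar> powr p" using p by (intro powr_less_mono2) auto
        then show False using that by simp
      qed
      have "\<bar>fst z\<bar> powr p \<le> 1" "\<bar>snd z\<bar> powr p \<le> 1"
        using z powr_ge_zero[of "\<bar>fst z\<bar>" p] powr_ge_zero[of "\<bar>snd z\<bar>" p] unfolding K_def by (auto simp del: powr_ge_zero)
      then have "\<bar>fst z\<bar> \<le> 1" "\<bar>snd z\<bar> \<le> 1" using 1 by auto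
      then show "z \<in> cbox (-1, -1) (1, 1)" by (cases z) (auto simp: cbox_Pair_iff abs_le_iff)
    qed
    ultimately show ?thesis using bounded_cbox bounded_subset compact_eq_bounded_closed by blast
  qed
  have "\<exists>\<delta>>0. \<forall>z\<in>K. \<delta> \<le> D z"
  proof (cases "K = {}")
    case False
    then obtain z where z: "z \<in> K" "\<forall>y\<in>K. D z \<le> D y"
      using continuous_attains_inf[OF \<open>compact K\<close> False contD] by blast
    have "fst z \<noteq> snd z" using z(1) \<epsilon> p by (auto simp: K_def)
    then have "0 < D z" using powr_midpoint_strict[OF p] unfolding D_def by simp
    then show ?thesis using z by blast
  qed (auto intro: exI[of _ 1])
  then obtain \<delta> where \<delta>: "0 < \<delta>" "\<And>z. z \<in> K \<Longrightarrow> \<delta> \<le> D z" by blast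
  \<comment> \<open>On K the left side is at most 2^(p-1) = C \<delta>, and \<delta> is a lower
    bound for the convexity defect D there.\<close>
  define C where "C = 2 powr (p - 1) / \<delta>"
  have C: "0 < C" using \<delta> by (simp add: C_def)
  have Dpos: "0 \<le> D z" for z using powr_midpoint[OF p, of "fst z" "snd z"] by (simp add: D_def)
  have unit: "\<bar>fst z - snd z\<bar> powr p \<le> \<epsilon> + C * D z" if z: "\<bar>fst z\<bar> powr p + \<bar>snd z\<bar> powr p = 1" for z
  proof (cases "z \<in> K")
    case True
    have "\<bar>fst z - snd z\<bar> powr p \<le> 2 powr (p - 1) * (\<bar>fst z\<bar> powr p + \<bar>snd z\<bar> powr p)"
      using powr_add_le[OF p, of "fst z" "- snd z"] by simp
    also have "\<dots> = C * \<delta>" using z \<delta> by (simp add: C_def)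
    also have "\<dots> \<le> C * D z" using \<delta>(2)[OF True] C by simp
    finally show ?thesis using \<epsilon> by linarith
  next
    case False
    then have "\<bar>fst z - snd z\<bar> powr p < \<epsilon>" using z by (simp add: K_def not_le)
    moreover have "0 \<le> C * D z" using C Dpos by simp
    ultimately show ?thesis by linarith
  qed
  have "\<bar>a - b\<bar> powr p \<le> \<epsilon> * (\<bar>a\<bar> powr p + \<bar>b\<bar> powr p) + C * ((\<bar>a\<bar> powr p + \<bar>b\<bar> powr p) / 2 - \<bar>(a + b) / 2\<bar> powr p)" for a b
  proof (cases "a = 0 \<and> b = 0")
    case False
    define S where "S = \<bar>a\<bar> powr p + \<bar>b\<bar> powr p"
    have S: "0 < S"
    proof (cases "a = 0")
      case True
      then show ?thesis using False unfolding S_def by (intro add_nonneg_pos) auto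
    next
      case False
      then show ?thesis unfolding S_def by (intro add_pos_nonneg) auto
    qed
    \<comment> \<open>Dividing a and b by s scales every p-th power by 1 / S and makes the power sum
      equal to 1, where \<open>unit\<close> applies.\<close>
    define s where "s = S powr (1/p)"
    have s: "0 < s" "s powr p = S" using S p by (auto simp: s_def powr_powr)
    have sc: "\<bar>t / s\<bar> powr p = \<bar>t\<bar> powr p / S" for t using s by (simp add: powr_divide abs_divide)
    have u: "\<bar>a / s - b / s\<bar> powr p = \<bar>a - b\<bar> powr p / S" using sc[of "a - b"] by (simp add: diff_divide_distrib)
    have m: "\<bar>(a / s + b / s) / 2\<bar> powr p = \<bar>(a + b) / 2\<bar> powr p / S"
    proof -
      have "(a / s + b / s) / 2 = (a + b) / 2 / s" by (simp add: add_divide_distrib)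
      then show ?thesis by (simp only: sc)
    qed
    have one: "\<bar>a\<bar> powr p / S + \<bar>b\<bar> powr p / S = 1" using S by (simp add: S_def flip: add_divide_distrib)
    have "\<bar>a - b\<bar> powr p / S \<le> \<epsilon> + C * (1 / 2 - \<bar>(a + b) / 2\<bar> powr p / S)"
      using unit[of "(a / s, b / s)"] one unfolding D_def fst_conv snd_conv u m sc by simp
    then have "\<bar>a - b\<bar> powr p \<le> (\<epsilon> + C * (1 / 2 - \<bar>(a + b) / 2\<bar> powr p / S)) * S"
      using S by (simp add: pos_divide_le_eq)
    also have "\<dots> = \<epsilon> * S + C * (S / 2 - \<bar>(a + b) / 2\<bar> powr p)" using S by (simp add: field_simps)
    finally show ?thesis by (simp add: S_def)
  qed simp
  then show ?thesis using that[OF C] by blast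
qed

section \<open>Functions with integrable p-th power\<close>

lemma integrable_powr_add:
  fixes f g :: "'a \<Rightarrow> real"
  assumes p: "1 < p" and "f \<in> borel_measurable M" "g \<in> borel_measurable M"
    "integrable M (\<lambda>x. \<bar>f x\<bar> powr p)" "integrable M (\<lambda>x. \<bar>g x\<bar> powr p)"
  shows "integrable M (\<lambda>x. \<bar>f x + g x\<bar> powr p)"
proof (rule Bochner_Integration.integrable_bound)
  show "integrable M (\<lambda>x. 2 powr (p - 1) * (\<bar>f x\<bar> powr p + \<bar>g x\<bar> powr p))" using assms by auto
  show "AE x in M. norm (\<bar>f x + g x\<bar> powr p) \<le> norm (2 powr (p - 1) * (\<bar>f x\<bar> powr p + \<bar>g x\<bar> powr p))"
    using powr_add_le[OF p] by auto
qed (use assms in measurable)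

lemma integrable_powr_diff:
  fixes f g :: "'a \<Rightarrow> real"
  assumes p: "1 < p" and "f \<in> borel_measurable M" "g \<in> borel_measurable M"
    "integrable M (\<lambda>x. \<bar>f x\<bar> powr p)" "integrable M (\<lambda>x. \<bar>g x\<bar> powr p)"
  shows "integrable M (\<lambda>x. \<bar>f x - g x\<bar> powr p)"
  using integrable_powr_add[of p f M "\<lambda>x. - g x"] assms by simp

lemma integrable_powr_half:
  fixes f g :: "'a \<Rightarrow> real"
  assumes p: "1 < p" and "f \<in> borel_measurable M" "g \<in> borel_measurable M"
    "integrable M (\<lambda>x. \<bar>f x\<bar> powr p)" "integrable M (\<lambda>x. \<bar>g x\<bar> powr p)"
  shows "integrable M (\<lambda>x. \<bar>(f x + g x) / 2\<bar> powr p)"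
proof -
  have "(\<lambda>x. \<bar>(f x + g x) / 2\<bar> powr p) = (\<lambda>x. \<bar>f x + g x\<bar> powr p * (1 / 2 powr p))"
    by (simp add: powr_divide)
  then show ?thesis using integrable_powr_add[OF assms] by simp
qed

text \<open>Jensen's inequality in Hoelder form: the tangent at the mean m bounds |f|^p from below,
  and its linear term integrates to zero.\<close>

lemma powr_integral_mean:
  fixes f :: "'a \<Rightarrow> real"
  assumes p: "1 < p" and "finite_measure M" "f \<in> borel_measurable M" "integrable M (\<lambda>x. \<bar>f x\<bar> powr p)"
  shows "integrable M f" "\<bar>LINT x|M. f x\<bar> powr p \<le> measure M (space M) powr (p - 1) * (LINT x|M. \<bar>f x\<bar> powr p)"
proof -
  interpret finite_measure M by fact
  show int: "integrable M f"
  proof (rule Bochner_Integration.integrable_bound)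
    show "integrable M (\<lambda>x. 1 + \<bar>f x\<bar> powr p)" using assms by auto
    have "\<bar>t\<bar> \<le> 1 + \<bar>t\<bar> powr p" for t :: real
    proof (cases "\<bar>t\<bar> \<le> 1")
      case False
      then have "\<bar>t\<bar> powr 1 \<le> \<bar>t\<bar> powr p" using p by (intro powr_mono) auto
      then show ?thesis using False by simp
    qed (use powr_ge_zero[of "\<bar>t\<bar>" p] in linarith)
    then show "AE x in M. norm (f x) \<le> norm (1 + \<bar>f x\<bar> powr p)" by auto
  qed (use assms in auto)
  define V where "V = measure M (space M)"
  show "\<bar>LINT x|M. f x\<bar> powr p \<le> measure M (space M) powr (p - 1) * (LINT x|M. \<bar>f x\<bar> powr p)"
  proof (cases "V = 0")
    case True
    then have "emeasure M (space M) = 0" by (simp add: emeasure_eq_measure V_def)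
    then have "AE x in M. False" by (intro AE_I[of _ _ "space M"]) auto
    then have "(LINT x|M. f x) = (LINT x|M. 0)" using assms by (intro integral_cong_AE) auto
    then show ?thesis using p by simp
  next
    case False
    then have V: "0 < V" using measure_nonneg[of M "space M"] unfolding V_def by linarith
    define m where "m = (LINT x|M. f x) / V"
    have "(LINT x|M. \<bar>m\<bar> powr p + powr_slope p m * (f x - m)) \<le> (LINT x|M. \<bar>f x\<bar> powr p)"
      using int assms powr_tangent[OF p] by (intro integral_mono) auto
    moreover have "(LINT x|M. \<bar>m\<bar> powr p + powr_slope p m * (f x - m)) = \<bar>m\<bar> powr p * V + powr_slope p m * ((LINT x|M. f x) - m * V)"
      using int by (simp add: V_def)
    moreover have "(LINT x|M. f x) - m * V = 0" using V by (simp add: m_def)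
    ultimately have "\<bar>m\<bar> powr p * V \<le> (LINT x|M. \<bar>f x\<bar> powr p)" by simp
    then have "V powr (p - 1) * (\<bar>m\<bar> powr p * V) \<le> V powr (p - 1) * (LINT x|M. \<bar>f x\<bar> powr p)"
      by (rule mult_left_mono) simp
    moreover have "V powr (p - 1) * (\<bar>m\<bar> powr p * V) = \<bar>LINT x|M. f x\<bar> powr p"
      using V by (simp add: m_def powr_divide abs_divide powr_diff)
    ultimately show ?thesis by (simp add: V_def)
  qed
qed

lemma set_powr_integral_mean:
  fixes f :: "'a \<Rightarrow> real"
  assumes p: "1 < p" and "E \<in> sets M" "emeasure M E < \<infinity>" "f \<in> borel_measurable M" "integrable M (\<lambda>x. \<bar>f x\<bar> powr p)"
  shows "set_integrable M E f"
    "\<bar>LINT x:E|M. f x\<bar> powr p \<le> measure M E powr (p - 1) * (LINT x:E|M. \<bar>f x\<bar> powr p)"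
proof -
  define R where "R = restrict_space M E"
  have E: "E \<inter> space M \<in> sets M" "E \<subseteq> space M" using assms(2) sets.sets_into_space by auto
  have "finite_measure R" unfolding R_def
    using assms E by (intro finite_measureI) (auto simp: emeasure_restrict_space space_restrict_space Int_absorb2 less_top[symmetric])
  moreover have "f \<in> borel_measurable R" unfolding R_def using assms(4) by (rule measurable_restrict_space1)
  moreover have "integrable R (\<lambda>x. \<bar>f x\<bar> powr p)" unfolding R_def
    using integrable_mult_indicator[OF assms(2,5)] E by (simp add: integrable_restrict_space)
  ultimately have *: "integrable R f" "\<bar>LINT x|R. f x\<bar> powr p \<le> measure R (space R) powr (p - 1) * (LINT x|R. \<bar>f x\<bar> powr p)"
    using powr_integral_mean[OF p] by blast+
  show "set_integrable M E f" using *(1) E by (simp add: R_def integrable_restrict_space set_integrable_def)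
  show "\<bar>LINT x:E|M. f x\<bar> powr p \<le> measure M E powr (p - 1) * (LINT x:E|M. \<bar>f x\<bar> powr p)"
    using *(2) E assms(2) by (simp add: R_def integral_restrict_space set_lebesgue_integral_def measure_restrict_space space_restrict_space Int_absorb2)
qed

text \<open>Let E n be the p-energy of g n. By \<open>mono\<close> the midpoint of g n and g m has
  energy at least E n, and by convexity at most (E n + E m) / 2. Hence E increases to a limit, and
  the convexity defect is at most (E m - E n) / 2; uniform convexity turns a small defect into a
  small difference.\<close>

lemma Lp_uniformly_convex_Cauchy:
  fixes g :: "nat \<Rightarrow> 'a \<Rightarrow> real"
  assumes p: "1 < p" and meas: "\<And>n. g n \<in> borel_measurable M"
    and int: "\<And>n. integrable M (\<lambda>x. \<bar>g n x\<bar> powr p)"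
    and bound: "\<And>n. (LINT x|M. \<bar>g n x\<bar> powr p) \<le> B"
    and mono: "\<And>n m. n \<le> m \<Longrightarrow> (LINT x|M. \<bar>g n x\<bar> powr p) \<le> (LINT x|M. \<bar>(g n x + g m x) / 2\<bar> powr p)"
    and \<eta>: "0 < \<eta>"
  shows "\<exists>N. \<forall>n\<ge>N. \<forall>m\<ge>n. (LINT x|M. \<bar>g m x - g n x\<bar> powr p) < \<eta>"
proof -
  define E where "E n = (LINT x|M. \<bar>g n x\<bar> powr p)" for n
  have E0: "0 \<le> E n" for n unfolding E_def by simp
  have half: "integrable M (\<lambda>x. \<bar>(g n x + g m x) / 2\<bar> powr p)" for n m
    using integrable_powr_half[OF p meas meas int int] .
  have diff: "integrable M (\<lambda>x. \<bar>g m x - g n x\<bar> powr p)" for n m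
    using integrable_powr_diff[OF p meas meas int int] .
  have E_half: "(LINT x|M. \<bar>(g n x + g m x) / 2\<bar> powr p) \<le> (E n + E m) / 2" for n m
  proof -
    have "(LINT x|M. \<bar>(g n x + g m x) / 2\<bar> powr p) \<le> (LINT x|M. (\<bar>g n x\<bar> powr p + \<bar>g m x\<bar> powr p) / 2)"
      using half int powr_midpoint[OF p] by (intro integral_mono) auto
    then show ?thesis using int by (simp add: E_def)
  qed
  have "incseq E"
  proof (rule incseq_SucI)
    fix n show "E n \<le> E (Suc n)" using mono[of n "Suc n"] E_half[of n "Suc n"] unfolding E_def by simp
  qed
  then obtain L where "E \<longlonglongrightarrow> L"
    by (rule incseq_convergent[of E B]) (use bound in \<open>auto simp: E_def\<close>)
  then have "Cauchy E" by (rule LIMSEQ_imp_Cauchy)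
  have B0: "0 \<le> B" by (rule order_trans[OF E0[of 0]]) (use bound[of 0] in \<open>simp add: E_def\<close>)
  \<comment> \<open>Chosen so that the first term of the convexity bound is at most \<eta> / 2, as E
    n + E m \<le> 2 B.\<close>
  define \<epsilon> where "\<epsilon> = \<eta> / (4 * (B + 1))"
  have \<epsilon>: "0 < \<epsilon>" "\<epsilon> * (2 * B) \<le> \<eta> / 2"
    using \<eta> B0 by (auto simp: \<epsilon>_def field_simps)
  obtain C where C: "0 < C" "\<And>a b. \<bar>a - b\<bar> powr p \<le> \<epsilon> * (\<bar>a\<bar> powr p + \<bar>b\<bar> powr p) + C * ((\<bar>a\<bar> powr p + \<bar>b\<bar> powr p) / 2 - \<bar>(a + b) / 2\<bar> powr p)"
    using powr_uniformly_convex[OF p \<epsilon>(1)] by blast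
  obtain N where N: "\<And>m n. N \<le> m \<Longrightarrow> N \<le> n \<Longrightarrow> dist (E m) (E n) < \<eta> / (2 * C)"
    using \<open>Cauchy E\<close> \<eta> C(1) unfolding Cauchy_def by (metis divide_pos_pos mult_pos_pos zero_less_numeral)
  have "(LINT x|M. \<bar>g m x - g n x\<bar> powr p) < \<eta>" if nm: "N \<le> n" "n \<le> m" for n m
  proof -
    have "(LINT x|M. \<bar>g m x - g n x\<bar> powr p) = (LINT x|M. \<bar>g n x - g m x\<bar> powr p)" by (simp add: abs_minus_commute)
    also have "\<dots> \<le> (LINT x|M. \<epsilon> * (\<bar>g n x\<bar> powr p + \<bar>g m x\<bar> powr p) + C * ((\<bar>g n x\<bar> powr p + \<bar>g m x\<bar> powr p) / 2 - \<bar>(g n x + g m x) / 2\<bar> powr p))"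
      using int half diff C(2) by (intro integral_mono) auto
    also have "\<dots> = \<epsilon> * (E n + E m) + C * ((E n + E m) / 2 - (LINT x|M. \<bar>(g n x + g m x) / 2\<bar> powr p))"
      using int half by (simp add: E_def)
    also have "\<dots> \<le> \<epsilon> * (E n + E m) + C * ((E n + E m) / 2 - E n)"
      using mono[OF nm(2)] C(1) by (intro add_left_mono mult_left_mono diff_left_mono) (auto simp: E_def)
    also have "\<epsilon> * (E n + E m) \<le> \<epsilon> * (2 * B)"
      using bound[of n] bound[of m] \<epsilon>(1) by (intro mult_left_mono) (auto simp: E_def)
    also have "C * ((E n + E m) / 2 - E n) < \<eta> / 2"
    proof -
      have "E m - E n < \<eta> / (2 * C)" using N[of m n] nm by (simp add: dist_real_def abs_less_iff)
      then have "C * (E m - E n) < \<eta> / 2" using C(1) by (simp add: field_simps)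
      moreover have "(E n + E m) / 2 - E n \<le> E m - E n" using incseqD[OF \<open>incseq E\<close> nm(2)] by (simp add: field_simps)
      then have "C * ((E n + E m) / 2 - E n) \<le> C * (E m - E n)" using C(1) by (intro mult_left_mono) auto
      ultimately show ?thesis by linarith
    qed
    finally show ?thesis using \<epsilon>(2) by linarith
  qed
  then show ?thesis by blast
qed

text \<open>Completeness by a fast subsequence: it converges almost everywhere, and Fatou's lemma
  shows that its limit is also the limit in the mean.\<close>

lemma Lp_Cauchy_converges:
  fixes g :: "nat \<Rightarrow> 'a \<Rightarrow> real"
  assumes p: "1 < p" and meas [measurable]: "\<And>n. g n \<in> borel_measurable M"
    and int: "\<And>n. integrable M (\<lambda>x. \<bar>g n x\<bar> powr p)"
    and Cauchy: "\<And>\<eta>. 0 < \<eta> \<Longrightarrow> \<exists>N. \<forall>n\<ge>N. \<forall>m\<ge>n. (LINT x|M. \<bar>g m x - g n x\<bar> powr p) < \<eta>"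
  shows "\<exists>h\<in>borel_measurable M. integrable M (\<lambda>x. \<bar>h x\<bar> powr p) \<and> (\<lambda>n. LINT x|M. \<bar>h x - g n x\<bar> powr p) \<longlonglongrightarrow> 0"
proof -
  have diff: "integrable M (\<lambda>x. \<bar>g m x - g n x\<bar> powr p)" for n m
    using integrable_powr_diff[OF p meas meas int int] .
  have nn: "(\<integral>\<^sup>+x. ennreal (\<bar>g m x - g n x\<bar> powr p) \<partial>M) = ennreal (LINT x|M. \<bar>g m x - g n x\<bar> powr p)" for n m
    using diff by (intro nn_integral_eq_integral) auto
  \<comment> \<open>The weight c^k = (2^k)^p forces pointwise differences of order 2^(-k), while
    integrals below (2 c)^(-k) keep the weighted series integrable.\<close>
  define c where "c = (2::real) powr p"
  have c: "1 < c" "0 < c" using p by (auto simp: c_def gr_one_powr)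
  have "\<exists>N. \<forall>n\<ge>N. \<forall>m\<ge>n. (LINT x|M. \<bar>g m x - g n x\<bar> powr p) < (1 / (2 * c)) ^ k" for k
    using c by (intro Cauchy) simp
  then obtain N where N: "\<And>k n m. N k \<le> n \<Longrightarrow> n \<le> m \<Longrightarrow> (LINT x|M. \<bar>g m x - g n x\<bar> powr p) < (1 / (2 * c)) ^ k" by metis
  \<comment> \<open>The sum makes r nondecreasing and at least N k; the summand k makes it tend to
    infinity.\<close>
  define r where "r k = k + (\<Sum>i\<le>k. N i)" for k
  have r: "N k \<le> r k" "r k \<le> r (Suc k)" "k \<le> r k" for k
    unfolding r_def by (auto intro: trans_le_add2 member_le_sum)
  define \<Delta> where "\<Delta> k x = g (r (Suc k)) x - g (r k) x" for k x
  have [measurable]: "\<Delta> k \<in> borel_measurable M" for k unfolding \<Delta>_def by measurable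
  have "(\<integral>\<^sup>+x. (\<Sum>k. ennreal (c ^ k * \<bar>\<Delta> k x\<bar> powr p)) \<partial>M) = (\<Sum>k. \<integral>\<^sup>+x. ennreal (c ^ k * \<bar>\<Delta> k x\<bar> powr p) \<partial>M)"
    by (rule nn_integral_suminf) measurable
  also have "\<dots> \<le> (\<Sum>k. ennreal ((1/2) ^ k))"
  proof (intro suminf_le allI)
    fix k
    have "(\<integral>\<^sup>+x. ennreal (c ^ k * \<bar>\<Delta> k x\<bar> powr p) \<partial>M) = ennreal (c ^ k) * ennreal (LINT x|M. \<bar>\<Delta> k x\<bar> powr p)"
      unfolding \<Delta>_def nn[symmetric] using c by (subst nn_integral_cmult[symmetric]) (auto simp: ennreal_mult)
    also have "\<dots> = ennreal (c ^ k * (LINT x|M. \<bar>\<Delta> k x\<bar> powr p))" using c by (simp add: ennreal_mult)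
    also have "\<dots> \<le> ennreal (c ^ k * (1 / (2 * c)) ^ k)"
      using N[OF r(1) r(2), of k] c unfolding \<Delta>_def by (intro ennreal_leI mult_left_mono) auto
    also have "c ^ k * (1 / (2 * c)) ^ k = (1/2) ^ k" using c by (simp flip: power_mult_distrib)
    finally show "(\<integral>\<^sup>+x. ennreal (c ^ k * \<bar>\<Delta> k x\<bar> powr p) \<partial>M) \<le> ennreal ((1/2) ^ k)" .
  qed auto
  also have "\<dots> < \<infinity>" by (subst suminf_ennreal2) (auto simp: summable_geometric)
  finally have "AE x in M. (\<Sum>k. ennreal (c ^ k * \<bar>\<Delta> k x\<bar> powr p)) \<noteq> \<infinity>"
    by (intro nn_integral_noteq_infinite) auto
  then have conv: "AE x in M. convergent (\<lambda>k. g (r k) x)"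
  proof (rule AE_mp, intro AE_I2 impI)
    fix x assume "(\<Sum>k. ennreal (c ^ k * \<bar>\<Delta> k x\<bar> powr p)) \<noteq> \<infinity>"
    then obtain S where S: "0 \<le> S" "(\<Sum>k. ennreal (c ^ k * \<bar>\<Delta> k x\<bar> powr p)) = ennreal S"
      by (cases "\<Sum>k. ennreal (c ^ k * \<bar>\<Delta> k x\<bar> powr p)") auto
    have bnd: "\<bar>\<Delta> k x\<bar> \<le> S powr (1/p) * (1/2) ^ k" for k
    proof -
      have "ennreal (c ^ k * \<bar>\<Delta> k x\<bar> powr p) \<le> ennreal S"
        unfolding S(2)[symmetric] using sum_le_suminf[of "\<lambda>k. ennreal (c ^ k * \<bar>\<Delta> k x\<bar> powr p)" "{k}"] by simp
      then have "c ^ k * \<bar>\<Delta> k x\<bar> powr p \<le> S" using S(1) by simp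
      then have "(c ^ k * \<bar>\<Delta> k x\<bar> powr p) powr (1/p) \<le> S powr (1/p)"
        using c p by (intro powr_mono2) auto
      moreover have "(c ^ k * \<bar>\<Delta> k x\<bar> powr p) powr (1/p) = 2 ^ k * \<bar>\<Delta> k x\<bar>"
      proof -
        have "c ^ k = (2 ^ k) powr p" unfolding c_def by (simp add: powr_powr powr_realpow[symmetric] mult.commute)
        then have "c ^ k * \<bar>\<Delta> k x\<bar> powr p = (2 ^ k * \<bar>\<Delta> k x\<bar>) powr p" by (simp add: powr_mult)
        then show ?thesis using p by (simp add: powr_powr)
      qed
      ultimately show ?thesis by (simp add: power_one_over field_simps)
    qed
    have "summable (\<lambda>k. \<Delta> k x)"
      by (rule summable_comparison_test'[where g = "\<lambda>k. S powr (1/p) * (1/2) ^ k" and N = 0])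
         (use bnd in \<open>auto intro!: summable_mult summable_geometric\<close>)
    then have "(\<lambda>n. g (r 0) x + (\<Sum>k<n. \<Delta> k x)) \<longlonglongrightarrow> g (r 0) x + (\<Sum>k. \<Delta> k x)"
      by (intro tendsto_intros summable_LIMSEQ)
    moreover have "g (r 0) x + (\<Sum>k<n. \<Delta> k x) = g (r n) x" for n
      unfolding \<Delta>_def by (subst sum_lessThan_telescope) simp
    ultimately show "convergent (\<lambda>k. g (r k) x)" by (simp add: convergent_def) blast
  qed
  define h where "h x = lim (\<lambda>k. g (r k) x)" for x
  have h [measurable]: "h \<in> borel_measurable M" unfolding h_def by measurable
  have lim: "AE x in M. (\<lambda>k. g (r k) x) \<longlonglongrightarrow> h x"
    using conv unfolding h_def by (auto simp: convergent_LIMSEQ_iff)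
  \<comment> \<open>A bound on g m - g n for all later m passes to h - g n along the
    subsequence.\<close>
  have fatou: "(\<integral>\<^sup>+x. ennreal (\<bar>h x - g n x\<bar> powr p) \<partial>M) \<le> ennreal \<eta>"
    if \<eta>: "\<And>m. n \<le> m \<Longrightarrow> (LINT x|M. \<bar>g m x - g n x\<bar> powr p) < \<eta>" for n \<eta>
  proof -
    have "(\<integral>\<^sup>+x. ennreal (\<bar>h x - g n x\<bar> powr p) \<partial>M) = (\<integral>\<^sup>+x. liminf (\<lambda>k. ennreal (\<bar>g (r k) x - g n x\<bar> powr p)) \<partial>M)"
    proof (rule nn_integral_cong_AE, use lim in eventually_elim)
      fix x assume "(\<lambda>k. g (r k) x) \<longlonglongrightarrow> h x"
      then have "(\<lambda>k. \<bar>g (r k) x - g n x\<bar> powr p) \<longlonglongrightarrow> \<bar>h x - g n x\<bar> powr p"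
        using p by (intro tendsto_powr' tendsto_intros) auto
      then have "(\<lambda>k. ennreal (\<bar>g (r k) x - g n x\<bar> powr p)) \<longlonglongrightarrow> ennreal (\<bar>h x - g n x\<bar> powr p)"
        by (rule tendsto_ennrealI)
      then show "ennreal (\<bar>h x - g n x\<bar> powr p) = liminf (\<lambda>k. ennreal (\<bar>g (r k) x - g n x\<bar> powr p))"
        by (intro lim_imp_Liminf[symmetric]) auto
    qed
    also have "\<dots> \<le> liminf (\<lambda>k. \<integral>\<^sup>+x. ennreal (\<bar>g (r k) x - g n x\<bar> powr p) \<partial>M)"
      by (rule nn_integral_liminf) measurable
    also have "\<dots> \<le> ennreal \<eta>"
    proof -
      have "(\<integral>\<^sup>+x. ennreal (\<bar>g (r k) x - g n x\<bar> powr p) \<partial>M) \<le> ennreal \<eta>" if "n \<le> k" for k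
        unfolding nn using \<eta>[of "r k"] r(3)[of k] that by (intro ennreal_leI) auto
      then have "eventually (\<lambda>k. (\<integral>\<^sup>+x. ennreal (\<bar>g (r k) x - g n x\<bar> powr p) \<partial>M) \<le> ennreal \<eta>) sequentially"
        unfolding eventually_sequentially by blast
      then have ls: "limsup (\<lambda>k. \<integral>\<^sup>+x. ennreal (\<bar>g (r k) x - g n x\<bar> powr p) \<partial>M) \<le> ennreal \<eta>" by (rule Limsup_bounded)
      show ?thesis by (rule order_trans[OF Liminf_le_Limsup ls]) simp
    qed
    finally show ?thesis .
  qed
  have close: "integrable M (\<lambda>x. \<bar>h x - g n x\<bar> powr p) \<and> (LINT x|M. \<bar>h x - g n x\<bar> powr p) \<le> \<eta>"
    if \<eta>: "\<And>m. n \<le> m \<Longrightarrow> (LINT x|M. \<bar>g m x - g n x\<bar> powr p) < \<eta>" "0 < \<eta>" for n \<eta>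
  proof
    show i: "integrable M (\<lambda>x. \<bar>h x - g n x\<bar> powr p)"
    proof (rule integrableI_bounded)
      have "(\<integral>\<^sup>+x. ennreal (\<bar>h x - g n x\<bar> powr p) \<partial>M) < \<infinity>"
        by (rule le_less_trans[OF fatou[of n \<eta>]]) (use \<eta>(1) in auto)
      then show "(\<integral>\<^sup>+x. ennreal (norm (\<bar>h x - g n x\<bar> powr p)) \<partial>M) < \<infinity>" by simp
    qed measurable
    have "ennreal (LINT x|M. \<bar>h x - g n x\<bar> powr p) \<le> ennreal \<eta>"
      using fatou[OF \<eta>(1)] nn_integral_eq_integral[OF i] by simp
    then show "(LINT x|M. \<bar>h x - g n x\<bar> powr p) \<le> \<eta>" using \<eta>(2) by simp
  qed
  have "integrable M (\<lambda>x. \<bar>h x\<bar> powr p)"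
  proof -
    obtain n where n: "\<forall>m\<ge>n. (LINT x|M. \<bar>g m x - g n x\<bar> powr p) < 1" using Cauchy[of 1] by auto
    have "integrable M (\<lambda>x. \<bar>(h x - g n x) + g n x\<bar> powr p)"
      using close[of n 1] n int[of n] by (intro integrable_powr_add[OF p]) auto
    then show ?thesis by simp
  qed
  moreover have "(\<lambda>n. LINT x|M. \<bar>h x - g n x\<bar> powr p) \<longlonglongrightarrow> 0"
  proof (rule LIMSEQ_I)
    fix \<eta> :: real assume \<eta>: "0 < \<eta>"
    then obtain N where N: "\<forall>n\<ge>N. \<forall>m\<ge>n. (LINT x|M. \<bar>g m x - g n x\<bar> powr p) < \<eta> / 2" using Cauchy[of "\<eta> / 2"] by auto
    have "(LINT x|M. \<bar>h x - g n x\<bar> powr p) < \<eta>" if "N \<le> n" for n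
      using close[of n "\<eta> / 2"] N that \<eta> by auto
    then show "\<exists>no. \<forall>n\<ge>no. norm ((LINT x|M. \<bar>h x - g n x\<bar> powr p) - 0) < \<eta>" by auto
  qed
  ultimately show ?thesis using h by blast
qed

text \<open>On a set of finite measure Hoelder's inequality bounds the difference of the integrals
  by the L^p distance.\<close>

lemma Lp_convergence_set_integral:
  fixes g :: "nat \<Rightarrow> 'a \<Rightarrow> real"
  assumes p: "1 < p" and E: "E \<in> sets M" "emeasure M E < \<infinity>"
    and g: "\<And>n. g n \<in> borel_measurable M" "\<And>n. integrable M (\<lambda>x. \<bar>g n x\<bar> powr p)"
    and h: "h \<in> borel_measurable M" "integrable M (\<lambda>x. \<bar>h x\<bar> powr p)"
    and lim: "(\<lambda>n. LINT x|M. \<bar>h x - g n x\<bar> powr p) \<longlonglongrightarrow> 0"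
  shows "(\<lambda>n. LINT x:E|M. g n x) \<longlonglongrightarrow> (LINT x:E|M. h x)"
proof -
  define V where "V = measure M E powr (p - 1)"
  have si: "set_integrable M E h" "set_integrable M E (g n)" for n
    using set_powr_integral_mean(1)[OF p E] g h by auto
  have d: "integrable M (\<lambda>x. \<bar>h x - g n x\<bar> powr p)" for n
    using integrable_powr_diff[OF p h(1) g(1) h(2) g(2)] .
  have le: "\<bar>(LINT x:E|M. h x) - (LINT x:E|M. g n x)\<bar> powr p \<le> V * (LINT x|M. \<bar>h x - g n x\<bar> powr p)" for n
  proof -
    have "\<bar>(LINT x:E|M. h x) - (LINT x:E|M. g n x)\<bar> powr p = \<bar>LINT x:E|M. h x - g n x\<bar> powr p"
      using si by (simp add: set_integral_diff)
    also have "\<dots> \<le> V * (LINT x:E|M. \<bar>h x - g n x\<bar> powr p)"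
      unfolding V_def using d g h by (intro set_powr_integral_mean[OF p E]) auto
    also have "\<dots> \<le> V * (LINT x|M. \<bar>h x - g n x\<bar> powr p)"
      unfolding set_lebesgue_integral_def using d integrable_mult_indicator[OF E(1) d]
      by (intro mult_left_mono integral_mono) (auto simp: V_def indicator_def)
    finally show ?thesis .
  qed
  have "(\<lambda>n. \<bar>(LINT x:E|M. h x) - (LINT x:E|M. g n x)\<bar> powr p) \<longlonglongrightarrow> 0"
  proof (rule tendsto_sandwich[of "\<lambda>_. 0"])
    show "(\<lambda>n. V * (LINT x|M. \<bar>h x - g n x\<bar> powr p)) \<longlonglongrightarrow> 0" using tendsto_mult_right_zero[OF lim] .
  qed (use le in auto)
  then have "(\<lambda>n. (\<bar>(LINT x:E|M. h x) - (LINT x:E|M. g n x)\<bar> powr p) powr (1/p)) \<longlonglongrightarrow> 0 powr (1/p)"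
    using p by (intro tendsto_powr' tendsto_intros) auto
  then have "(\<lambda>n. \<bar>(LINT x:E|M. h x) - (LINT x:E|M. g n x)\<bar>) \<longlonglongrightarrow> 0" using p by (simp add: powr_powr)
  then have "(\<lambda>n. (LINT x:E|M. h x) - (LINT x:E|M. g n x)) \<longlonglongrightarrow> 0" by (rule tendsto_rabs_zero_cancel)
  from tendsto_diff[OF tendsto_const[of "LINT x:E|M. h x"] this] show ?thesis by simp
qed

section \<open>From the Besov condition to discrete energies\<close>

interpretation vicsek: prob_space vicsek_measure by (rule prob_space_vicsek_measure)

lemma measurable_vicsek_measure_borel: "G \<in> borel_measurable borel \<Longrightarrow> G \<in> borel_measurable vicsek_measure"
  for G :: "pt \<Rightarrow> 'b::topological_space"
  by (simp add: measurable_cong_sets[OF sets_vicsek_measure refl] measurable_restrict_space1)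

lemma integrable_vicsek_bounded:
  fixes G :: "pt \<Rightarrow> real"
  assumes "G \<in> borel_measurable vicsek_measure" "\<And>x. x \<in> vicsek_set \<Longrightarrow> \<bar>G x\<bar> \<le> B"
  shows "integrable vicsek_measure G"
  by (rule vicsek.integrable_const_bound[where B = B]) (use assms in \<open>auto simp: space_vicsek_measure intro!: AE_I2\<close>)

lemma vicsek_Fubini_measurable:
  fixes G :: "pt \<times> pt \<Rightarrow> real"
  assumes G: "G \<in> borel_measurable borel"
  shows "(\<lambda>x. LINT y|vicsek_measure. G (x, y)) \<in> borel_measurable vicsek_measure"
proof -
  have id: "(\<lambda>x. x) \<in> measurable vicsek_measure borel" by (rule measurable_vicsek_measure_borel) simp
  have "(\<lambda>z. (fst z, snd z)) \<in> measurable (vicsek_measure \<Otimes>\<^sub>M vicsek_measure) (borel \<Otimes>\<^sub>M borel)"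
    by (intro measurable_Pair measurable_compose[OF measurable_fst id] measurable_compose[OF measurable_snd id])
  then have "(\<lambda>z. z) \<in> measurable (vicsek_measure \<Otimes>\<^sub>M vicsek_measure) (borel :: (pt \<times> pt) measure)"
    by (simp add: borel_prod)
  from measurable_compose[OF this G] have "(\<lambda>(x, y). G (x, y)) \<in> borel_measurable (vicsek_measure \<Otimes>\<^sub>M vicsek_measure)"
    by simp
  then show ?thesis by (rule vicsek.borel_measurable_lebesgue_integral)
qed

lemma vicsek_Fubini_bounded:
  fixes G :: "pt \<times> pt \<Rightarrow> real"
  assumes G: "G \<in> borel_measurable borel" and B: "\<And>x y. x \<in> vicsek_set \<Longrightarrow> y \<in> vicsek_set \<Longrightarrow> \<bar>G (x, y)\<bar> \<le> B"
  shows "x \<in> vicsek_set \<Longrightarrow> integrable vicsek_measure (\<lambda>y. G (x, y))"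
    "integrable vicsek_measure (\<lambda>x. LINT y|vicsek_measure. G (x, y))"
proof -
  have "(\<lambda>y. G (x, y)) \<in> borel_measurable borel" for x
    by (rule measurable_compose[OF _ G]) (intro borel_measurable_continuous_onI continuous_intros)
  then show i: "integrable vicsek_measure (\<lambda>y. G (x, y))" if "x \<in> vicsek_set" for x
    using B[OF that] by (intro integrable_vicsek_bounded[where B = B] measurable_vicsek_measure_borel)
  have "\<bar>LINT y|vicsek_measure. G (x, y)\<bar> \<le> B" if "x \<in> vicsek_set" for x
  proof -
    have "\<bar>LINT y|vicsek_measure. G (x, y)\<bar> \<le> (LINT y|vicsek_measure. \<bar>G (x, y)\<bar>)" by (rule integral_abs_bound)
    also have "\<dots> \<le> (LINT y|vicsek_measure. B)"
      using i[OF that] B[OF that] by (intro integral_mono) (auto simp: space_vicsek_measure)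
    finally show ?thesis using vicsek.prob_space by simp
  qed
  then show "integrable vicsek_measure (\<lambda>x. LINT y|vicsek_measure. G (x, y))"
    using vicsek_Fubini_measurable[OF G] by (rule integrable_vicsek_bounded[rotated])
qed

definition mean_oscillation :: "real \<Rightarrow> (pt \<Rightarrow> real) \<Rightarrow> real" where
  "mean_oscillation p h = (LINT x|vicsek_measure. LINT y|vicsek_measure. \<bar>h y - h x\<bar> powr p)"

text \<open>A continuous extension to the whole plane (Tietze) makes integrands of two variables
  Borel everywhere, which settles the measurability of iterated integrals; compactness of K gives
  the bound.\<close>

lemma vicsek_continuous_extension:
  fixes f :: "pt \<Rightarrow> real"
  assumes "continuous_on vicsek_set f"
  obtains F B where "continuous_on UNIV F" "\<And>x. x \<in> vicsek_set \<Longrightarrow> F x = f x" "\<And>x. x \<in> vicsek_set \<Longrightarrow> \<bar>F x\<bar> \<le> B" "0 \<le> B"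
proof -
  obtain F where F: "continuous_on UNIV F" "\<And>x. x \<in> vicsek_set \<Longrightarrow> F x = f x"
    using Tietze_unbounded[OF assms, of UNIV] compact_vicsek_set by (metis closed_closedin compact_imp_closed subtopology_UNIV)
  have "compact (f ` vicsek_set)" using assms compact_vicsek_set by (rule compact_continuous_image)
  then have "bounded (f ` vicsek_set)" by (rule compact_imp_bounded)
  then obtain B where B: "\<And>x. x \<in> vicsek_set \<Longrightarrow> \<bar>f x\<bar> \<le> B"
    unfolding bounded_iff by (metis image_eqI real_norm_def)
  have "0 \<le> B" using B[OF vicsek_pt_vicsek_set[of 5]] by simp
  then show ?thesis using F B by (intro that[of F B]) auto
qed

section \<open>Oscillations of a continuous function on cells\<close>

context
  fixes p :: real and f :: "pt \<Rightarrow> real"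
  assumes p: "1 < p" and f: "continuous_on vicsek_set f"
begin

lemma continuous_on_word: "w \<in> words n \<Longrightarrow> continuous_on vicsek_set (\<lambda>x. f (word_map w x))"
  by (rule continuous_on_compose2[OF f]) (auto intro!: continuous_intros word_map_vicsek_set)

lemma word_osc_integrable:
  assumes "w \<in> words n"
  shows "x \<in> vicsek_set \<Longrightarrow> integrable vicsek_measure (\<lambda>y. \<bar>f (word_map w y) - f (word_map w x)\<bar> powr p)"
    "integrable vicsek_measure (\<lambda>x. LINT y|vicsek_measure. \<bar>f (word_map w y) - f (word_map w x)\<bar> powr p)"
proof -
  obtain F B where F: "continuous_on UNIV F" "\<And>x. x \<in> vicsek_set \<Longrightarrow> F x = f (word_map w x)" "\<And>x. x \<in> vicsek_set \<Longrightarrow> \<bar>F x\<bar> \<le> B" "0 \<le> B"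
    using vicsek_continuous_extension[OF continuous_on_word[OF assms]] by blast
  define G where "G z = \<bar>F (snd z) - F (fst z)\<bar> powr p" for z
  have cF: "continuous_on A (\<lambda>z. F (h z))" if "continuous_on A h" for A :: "(pt \<times> pt) set" and h
    by (rule continuous_on_compose2[OF F(1) that]) auto
  have G: "G \<in> borel_measurable borel"
    unfolding G_def using p by (intro borel_measurable_continuous_onI continuous_on_abs_powr continuous_intros cF) auto
  have bd: "\<bar>G (x, y)\<bar> \<le> (2 * B) powr p" if "x \<in> vicsek_set" "y \<in> vicsek_set" for x y
  proof -
    have "\<bar>F y - F x\<bar> \<le> 2 * B" using F(3)[OF that(1)] F(3)[OF that(2)] by linarith
    then show ?thesis unfolding G_def using p by (auto intro!: powr_mono2)
  qed
  have eq: "(LINT y|vicsek_measure. G (x, y)) = (LINT y|vicsek_measure. \<bar>f (word_map w y) - f (word_map w x)\<bar> powr p)" if "x \<in> vicsek_set" for x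
    using that F(2) by (intro Bochner_Integration.integral_cong) (auto simp: G_def space_vicsek_measure)
  show "integrable vicsek_measure (\<lambda>y. \<bar>f (word_map w y) - f (word_map w x)\<bar> powr p)" if x: "x \<in> vicsek_set" for x
  proof -
    have "integrable vicsek_measure (\<lambda>y. G (x, y))" by (rule vicsek_Fubini_bounded(1)[OF G bd x])
    moreover have "integrable vicsek_measure (\<lambda>y. G (x, y)) \<longleftrightarrow> integrable vicsek_measure (\<lambda>y. \<bar>f (word_map w y) - f (word_map w x)\<bar> powr p)"
      using x F(2) by (intro Bochner_Integration.integrable_cong) (auto simp: G_def space_vicsek_measure)
    ultimately show ?thesis by simp
  qed
  have "integrable vicsek_measure (\<lambda>x. LINT y|vicsek_measure. G (x, y))" by (rule vicsek_Fubini_bounded(2)[OF G bd])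
  moreover have "integrable vicsek_measure (\<lambda>x. LINT y|vicsek_measure. G (x, y)) \<longleftrightarrow>
    integrable vicsek_measure (\<lambda>x. LINT y|vicsek_measure. \<bar>f (word_map w y) - f (word_map w x)\<bar> powr p)"
    using eq by (intro Bochner_Integration.integrable_cong) (auto simp: space_vicsek_measure)
  ultimately show "integrable vicsek_measure (\<lambda>x. LINT y|vicsek_measure. \<bar>f (word_map w y) - f (word_map w x)\<bar> powr p)" by simp
qed

lemma word_integrable: "w \<in> words n \<Longrightarrow> integrable vicsek_measure (\<lambda>x. f (word_map w x))"
proof -
  assume w: "w \<in> words n"
  obtain F B where F: "continuous_on UNIV F" "\<And>x. x \<in> vicsek_set \<Longrightarrow> F x = f (word_map w x)" "\<And>x. x \<in> vicsek_set \<Longrightarrow> \<bar>F x\<bar> \<le> B" "0 \<le> B"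
    using vicsek_continuous_extension[OF continuous_on_word[OF w]] by blast
  have "integrable vicsek_measure F"
    using F by (intro integrable_vicsek_bounded measurable_vicsek_measure_borel borel_measurable_continuous_onI) auto
  moreover have "integrable vicsek_measure F \<longleftrightarrow> integrable vicsek_measure (\<lambda>x. f (word_map w x))"
    using F(2) by (intro Bochner_Integration.integrable_cong) (auto simp: space_vicsek_measure)
  ultimately show ?thesis by simp
qed

text \<open>The ball of radius 4 / 3^n around a point contains every level n cell through it, so the
  inner integral dominates the one over the cell. The ball has measure at most
  \<open>ball_constant 4\<close> * 5^(-n), and this factor 5^(-n) cancels the one from averaging
  over the cell.\<close>

lemma besov_lower_bound:
  "(1/5) ^ n * (\<Sum>w\<in>words n. mean_oscillation p (\<lambda>x. f (word_map w x))) \<le> ball_constant 4 *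
    (LINT x|vicsek_measure. (LINT y:vicsek_ball x (4 / 3 ^ n)|vicsek_measure.
        \<bar>f y - f x\<bar> powr p / measure vicsek_measure (vicsek_ball x (4 / 3 ^ n))))"
proof -
  define r where "r = (4::real) / 3 ^ n"
  define c where "c = ball_constant 4"
  have c: "0 < c" unfolding c_def by (rule ball_constant_pos) simp
  obtain F B where F: "continuous_on UNIV F" "\<And>x. x \<in> vicsek_set \<Longrightarrow> F x = f x" "\<And>x. x \<in> vicsek_set \<Longrightarrow> \<bar>F x\<bar> \<le> B" "0 \<le> B"
    using vicsek_continuous_extension[OF f] by blast
  \<comment> \<open>The distance is extended as well, so that membership in the ball becomes a Borel
    condition on pairs of points.\<close>
  obtain D :: "pt \<times> pt \<Rightarrow> real" where D: "continuous_on UNIV D" "\<And>z. z \<in> vicsek_set \<times> vicsek_set \<Longrightarrow> D z = vicsek_dist (fst z) (snd z)"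
    using Tietze_unbounded[OF continuous_on_vicsek_dist, of UNIV] closed_Times[OF compact_imp_closed[OF compact_vicsek_set] compact_imp_closed[OF compact_vicsek_set]]
    by (metis closed_closedin subtopology_UNIV)
  \<comment> \<open>Integrated over y, k gives the unnormalised inner integral \<open>num\<close>
    and j gives the measure \<open>m\<close> of the ball. In this form both are visibly measurable
    in x.\<close>
  define k where "k z = (if D z \<le> r then \<bar>F (snd z) - F (fst z)\<bar> powr p else 0)" for z
  define j where "j z = (if D z \<le> r then 1 else 0 :: real)" for z
  have cF: "continuous_on A (\<lambda>z. F (h z))" if "continuous_on A h" for A :: "(pt \<times> pt) set" and h
    by (rule continuous_on_compose2[OF F(1) that]) auto
  have [measurable]: "D \<in> borel_measurable borel" using D(1) by (rule borel_measurable_continuous_onI)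
  have [measurable]: "(\<lambda>z. \<bar>F (snd z) - F (fst z)\<bar> powr p) \<in> borel_measurable borel"
    using p by (intro borel_measurable_continuous_onI continuous_on_abs_powr continuous_intros cF) auto
  have k: "k \<in> borel_measurable borel" unfolding k_def by measurable
  have j: "j \<in> borel_measurable borel" unfolding j_def by measurable
  have kB: "0 \<le> k (x, y)" "k (x, y) \<le> (2 * B) powr p * j (x, y)" if "x \<in> vicsek_set" "y \<in> vicsek_set" for x y
  proof -
    have "\<bar>F y - F x\<bar> \<le> 2 * B" using F(3)[OF that(1)] F(3)[OF that(2)] by linarith
    then show "0 \<le> k (x, y)" "k (x, y) \<le> (2 * B) powr p * j (x, y)" unfolding k_def j_def using p by (auto intro!: powr_mono2)
  qed
  have kB': "\<bar>k (x, y)\<bar> \<le> (2 * B) powr p" if "x \<in> vicsek_set" "y \<in> vicsek_set" for x y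
    using kB[OF that] by (auto simp: j_def k_def split: if_splits)
  have jB: "\<bar>j (x, y)\<bar> \<le> 1" for x y by (simp add: j_def)
  define num where "num x = (LINT y|vicsek_measure. k (x, y))" for x
  define m where "m x = (LINT y|vicsek_measure. j (x, y))" for x
  have ball: "y \<in> vicsek_ball x r \<longleftrightarrow> D (x, y) \<le> r" if "x \<in> vicsek_set" "y \<in> vicsek_set" for x y
    using that D(2) by (simp add: vicsek_ball_def)
  have m_eq: "measure vicsek_measure (vicsek_ball x r) = m x" if x: "x \<in> vicsek_set" for x
  proof -
    have "m x = (LINT y|vicsek_measure. indicator (vicsek_ball x r) y)"
      unfolding m_def using ball[OF x] by (intro Bochner_Integration.integral_cong) (auto simp: j_def indicator_def space_vicsek_measure)
    also have "\<dots> = measure vicsek_measure (vicsek_ball x r)"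
      using sets.sets_into_space[OF vicsek_ball_sets[OF x]] by (simp add: Int_absorb2)
    finally show ?thesis by simp
  qed
  have m_le: "m x \<le> c * (1/5) ^ n" if "x \<in> vicsek_set" for x
    using measure_vicsek_ball_le[OF that, of 4 n] m_eq[OF that] by (simp add: r_def c_def)
  have m_pos: "0 < m x" if "x \<in> vicsek_set" for x
    using less_le_trans[OF _ measure_vicsek_ball_ge[OF that, of n]] m_eq[OF that] by (simp add: r_def)
  have inner: "(LINT y:vicsek_ball x r|vicsek_measure. \<bar>f y - f x\<bar> powr p / measure vicsek_measure (vicsek_ball x r)) = num x / m x"
    if x: "x \<in> vicsek_set" for x
  proof -
    have "(LINT y:vicsek_ball x r|vicsek_measure. \<bar>f y - f x\<bar> powr p / measure vicsek_measure (vicsek_ball x r))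
      = (LINT y|vicsek_measure. k (x, y) / m x)"
      unfolding set_lebesgue_integral_def m_eq[OF x] using ball[OF x] x F(2)
      by (intro Bochner_Integration.integral_cong) (auto simp: k_def indicator_def space_vicsek_measure)
    then show ?thesis by (simp add: num_def)
  qed
  have num_int: "integrable vicsek_measure (\<lambda>y. k (x, y))" if "x \<in> vicsek_set" for x
    by (rule vicsek_Fubini_bounded(1)[OF k kB' that])
  have num_le: "num x \<le> (2 * B) powr p * m x" if x: "x \<in> vicsek_set" for x
  proof -
    have "num x \<le> (LINT y|vicsek_measure. (2 * B) powr p * j (x, y))"
      unfolding num_def using num_int[OF x] vicsek_Fubini_bounded(1)[OF j jB x] kB[OF x]
      by (intro integral_mono) (auto simp: space_vicsek_measure)
    then show ?thesis by (simp add: m_def)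
  qed
  have num_nonneg: "0 \<le> num x" if x: "x \<in> vicsek_set" for x
    unfolding num_def using kB(1)[OF x] by (intro integral_nonneg_AE AE_I2) (simp add: space_vicsek_measure)
  have quot_int: "integrable vicsek_measure (\<lambda>x. num x / m x)"
  proof (rule integrable_vicsek_bounded[where B = "(2 * B) powr p"])
    show "(\<lambda>x. num x / m x) \<in> borel_measurable vicsek_measure"
      unfolding num_def m_def using vicsek_Fubini_measurable[OF k] vicsek_Fubini_measurable[OF j] by (rule borel_measurable_divide)
    fix x assume x: "x \<in> vicsek_set"
    show "\<bar>num x / m x\<bar> \<le> (2 * B) powr p" using num_le[OF x] num_nonneg[OF x] m_pos[OF x] by (simp add: pos_divide_le_eq)
  qed
  have low: "(LINT y|vicsek_measure. \<bar>f (word_map w y) - f (word_map w x)\<bar> powr p) \<le> c * (num (word_map w x) / m (word_map w x))"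
    if w: "w \<in> words n" and x: "x \<in> vicsek_set" for w x
  proof -
    have wx: "word_map w x \<in> vicsek_set" by (rule word_map_vicsek_set[OF w x])
    have kk: "k (word_map w x, word_map w y) = \<bar>f (word_map w y) - f (word_map w x)\<bar> powr p" if y: "y \<in> vicsek_set" for y
    proof -
      have wy: "word_map w y \<in> vicsek_set" by (rule word_map_vicsek_set[OF w y])
      have "word_map w y \<in> vicsek_ball (word_map w x) r"
        using cell_subset_vicsek_ball[OF w, of "word_map w x"] x y by (auto simp: r_def)
      then show ?thesis using ball[OF wx wy] F(2) wx wy by (simp add: k_def)
    qed
    have eq: "(LINT y|vicsek_measure. \<bar>f (word_map w y) - f (word_map w x)\<bar> powr p) = (LINT y|vicsek_measure. k (word_map w x, word_map w y))"
      using kk by (intro Bochner_Integration.integral_cong) (auto simp: space_vicsek_measure)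
    have nonneg: "0 \<le> (LINT y|vicsek_measure. k (word_map w x, word_map v y))" if "v \<in> words n" for v
      using kB(1)[OF wx] word_map_vicsek_set[OF that] by (intro integral_nonneg_AE AE_I2) (simp add: space_vicsek_measure)
    \<comment> \<open>Of the 5^n cells that make up \<open>num\<close>, only the one belonging to w
      is kept.\<close>
    have "(LINT y|vicsek_measure. k (word_map w x, word_map w y)) \<le> (\<Sum>v\<in>words n. LINT y|vicsek_measure. k (word_map w x, word_map v y))"
      using nonneg w by (intro member_le_sum) auto
    then have "(1/5) ^ n * (LINT y|vicsek_measure. k (word_map w x, word_map w y)) \<le> num (word_map w x)"
      unfolding num_def integral_vicsek_words(2)[OF num_int[OF wx], of n] by (intro mult_left_mono) auto
    then have 1: "(LINT y|vicsek_measure. k (word_map w x, word_map w y)) \<le> 5 ^ n * num (word_map w x)"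
      by (simp add: power_one_over field_simps)
    have "5 ^ n * m (word_map w x) \<le> c" using m_le[OF wx] by (simp add: power_one_over field_simps)
    then have "5 ^ n * num (word_map w x) * m (word_map w x) \<le> c * num (word_map w x)"
      using num_nonneg[OF wx] mult_right_mono by (fastforce simp: mult_ac)
    then have "5 ^ n * num (word_map w x) \<le> c * (num (word_map w x) / m (word_map w x))"
      using m_pos[OF wx] by (simp add: pos_le_divide_eq)
    then show ?thesis using 1 eq by linarith
  qed
  have "(\<Sum>w\<in>words n. mean_oscillation p (\<lambda>x. f (word_map w x))) \<le> (\<Sum>w\<in>words n. LINT x|vicsek_measure. c * (num (word_map w x) / m (word_map w x)))"
  proof (rule sum_mono)
    fix w assume w: "w \<in> words n"
    show "mean_oscillation p (\<lambda>x. f (word_map w x)) \<le> (LINT x|vicsek_measure. c * (num (word_map w x) / m (word_map w x)))"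
    proof -
      have q: "integrable vicsek_measure (\<lambda>x. c * (num (word_map w x) / m (word_map w x)))"
        by (rule integrable_mult_right[OF integral_vicsek_words(1)[OF quot_int w]])
      show ?thesis unfolding mean_oscillation_def
        by (rule integral_mono[OF word_osc_integrable(2)[OF w] q]) (use low[OF w] in \<open>simp add: space_vicsek_measure\<close>)
    qed
  qed
  then have "(1/5) ^ n * (\<Sum>w\<in>words n. mean_oscillation p (\<lambda>x. f (word_map w x)))
    \<le> (1/5) ^ n * (\<Sum>w\<in>words n. LINT x|vicsek_measure. c * (num (word_map w x) / m (word_map w x)))"
    by (rule mult_left_mono) simp
  also have "\<dots> = c * (LINT x|vicsek_measure. num x / m x)"
    unfolding integral_vicsek_words(2)[OF quot_int, of n] integral_mult_right_zero
    by (simp only: sum_distrib_left[symmetric] mult.left_commute)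
  also have "(LINT x|vicsek_measure. num x / m x) = (LINT x|vicsek_measure. (LINT y:vicsek_ball x r|vicsek_measure. \<bar>f y - f x\<bar> powr p / measure vicsek_measure (vicsek_ball x r)))"
    using inner by (intro Bochner_Integration.integral_cong) (auto simp: space_vicsek_measure)
  finally show ?thesis unfolding c_def r_def .
qed

section \<open>Means over cells and their limits at vertices\<close>

definition cell_mean :: "nat list \<Rightarrow> real" where
  "cell_mean w = (LINT x|vicsek_measure. f (word_map w x))"

text \<open>Jensen twice: first the mean over the parent is compared with a value in the child, then
  that value is averaged over the child. An integral over the child is at most 5 times the one over
  the parent, in normalised measure.\<close>

lemma cell_mean_step:
  assumes w: "w \<in> words n" and i: "i \<in> {1..5}"
  shows "\<bar>cell_mean (w @ [i]) - cell_mean w\<bar> powr p \<le> 5 * mean_oscillation p (\<lambda>x. f (word_map w x))"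
proof -
  have wi: "w @ [i] \<in> words (Suc n)" by (rule words_snoc[OF w i])
  have i1: "[i] \<in> words 1" using i by (simp add: words_def)
  define h where "h x = f (word_map w x)" for x
  have hi: "h (vicsek_map i x) = f (word_map (w @ [i]) x)" for x by (simp add: h_def)
  have int: "integrable vicsek_measure h" "integrable vicsek_measure (\<lambda>x. h (vicsek_map i x))"
    unfolding hi using word_integrable[OF w] word_integrable[OF wi] by (simp_all add: h_def[abs_def])
  define G where "G x = (LINT y|vicsek_measure. \<bar>h y - h x\<bar> powr p)" for x
  have Gint: "integrable vicsek_measure G" unfolding G_def h_def by (rule word_osc_integrable(2)[OF w])
  have Gi: "integrable vicsek_measure (\<lambda>x. G (vicsek_map i x))" using integral_vicsek_words(1)[OF Gint i1] by simp
  have G0: "0 \<le> G x" for x unfolding G_def by (intro integral_nonneg_AE AE_I2) simp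
  have jensen: "\<bar>u - cell_mean w\<bar> powr p \<le> (LINT y|vicsek_measure. \<bar>h y - u\<bar> powr p)"
    if "integrable vicsek_measure (\<lambda>y. \<bar>h y - u\<bar> powr p)" for u
  proof -
    have "\<bar>LINT y|vicsek_measure. h y - u\<bar> powr p \<le> measure vicsek_measure (space vicsek_measure) powr (p - 1) * (LINT y|vicsek_measure. \<bar>h y - u\<bar> powr p)"
      by (intro powr_integral_mean(2)[OF p vicsek.finite_measure_axioms _ that] borel_measurable_diff
          borel_measurable_integrable[OF int(1)] borel_measurable_const)
    moreover have "(LINT y|vicsek_measure. h y - u) = cell_mean w - u"
      using int vicsek.prob_space by (simp add: cell_mean_def h_def[symmetric])
    ultimately show ?thesis using vicsek.prob_space by (simp add: abs_minus_commute)
  qed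
  have pt: "\<bar>h (vicsek_map i x) - cell_mean w\<bar> powr p \<le> G (vicsek_map i x)" if "x \<in> vicsek_set" for x
    unfolding G_def using word_osc_integrable(1)[OF w vicsek_map_vicsek_set[OF i that]] by (intro jensen) (simp add: h_def)
  have pint: "integrable vicsek_measure (\<lambda>x. \<bar>h (vicsek_map i x) - cell_mean w\<bar> powr p)"
  proof (rule Bochner_Integration.integrable_bound[OF Gi])
    show "AE x in vicsek_measure. norm (\<bar>h (vicsek_map i x) - cell_mean w\<bar> powr p) \<le> norm (G (vicsek_map i x))"
      using pt G0 by (intro AE_I2) (simp add: space_vicsek_measure)
  qed (use int(2) in measurable)
  have "\<bar>LINT x|vicsek_measure. h (vicsek_map i x) - cell_mean w\<bar> powr p
     \<le> measure vicsek_measure (space vicsek_measure) powr (p - 1) * (LINT x|vicsek_measure. \<bar>h (vicsek_map i x) - cell_mean w\<bar> powr p)"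
    by (intro powr_integral_mean(2)[OF p vicsek.finite_measure_axioms _ pint] borel_measurable_diff
        borel_measurable_integrable[OF int(2)] borel_measurable_const)
  moreover have "(LINT x|vicsek_measure. h (vicsek_map i x) - cell_mean w) = cell_mean (w @ [i]) - cell_mean w"
    using int vicsek.prob_space by (simp add: cell_mean_def hi)
  ultimately have "\<bar>cell_mean (w @ [i]) - cell_mean w\<bar> powr p \<le> (LINT x|vicsek_measure. \<bar>h (vicsek_map i x) - cell_mean w\<bar> powr p)"
    using vicsek.prob_space by simp
  also have "\<dots> \<le> (LINT x|vicsek_measure. G (vicsek_map i x))"
    using pint Gi pt by (intro integral_mono) (auto simp: space_vicsek_measure)
  also have "\<dots> \<le> (\<Sum>v\<in>words 1. LINT x|vicsek_measure. G (word_map v x))"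
  proof -
    have "(LINT x|vicsek_measure. G (word_map [i] x)) \<le> (\<Sum>v\<in>words 1. LINT x|vicsek_measure. G (word_map v x))"
      using i1 G0 by (intro member_le_sum[of "[i]"]) (auto intro!: integral_nonneg_AE AE_I2)
    then show ?thesis by simp
  qed
  also have "\<dots> = 5 * (LINT x|vicsek_measure. G x)" using integral_vicsek_words(2)[OF Gint, of 1] by simp
  finally show ?thesis unfolding mean_oscillation_def G_def h_def .
qed

text \<open>The step from w to w i costs a factor 2^(p-1) by \<open>powr_add_le\<close>, but one
  level further down gains 3^(-(p-1)). The product \<theta> = (2/3)^(p-1) is below 1, so the
  constant does not depend on the length N of the chain.\<close>

lemma cell_mean_chain:
  assumes osc: "\<And>n. (\<Sum>w\<in>words n. mean_oscillation p (\<lambda>x. f (word_map w x))) \<le> C * ((1/3) powr (p - 1)) ^ n"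
    and i: "i \<in> {1..5}"
  shows "(\<Sum>w\<in>words n. \<bar>cell_mean (w @ replicate N i) - cell_mean w\<bar> powr p)
    \<le> 2 powr (p - 1) * 5 * C / (1 - (2/3) powr (p - 1)) * ((1/3) powr (p - 1)) ^ n"
proof (induction N arbitrary: n)
  define \<rho> where "\<rho> = (1/3::real) powr (p - 1)"
  define \<theta> where "\<theta> = (2/3::real) powr (p - 1)"
  define c where "c = 2 powr (p - 1) * 5 * C / (1 - \<theta>)"
  have \<theta>: "\<theta> < 1" unfolding \<theta>_def using powr_less_mono2[of "p - 1" "2/3" 1] p by simp
  have \<theta>\<rho>: "2 powr (p - 1) * \<rho> = \<theta>" unfolding \<theta>_def \<rho>_def by (simp flip: powr_mult)
  have C0: "0 \<le> C"
  proof -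
    have "0 \<le> (\<Sum>w\<in>words 0. mean_oscillation p (\<lambda>x. f (word_map w x)))"
      unfolding mean_oscillation_def by (intro sum_nonneg integral_nonneg_AE AE_I2) simp
    then show ?thesis using osc[of 0] by simp
  qed
  have c0: "0 \<le> c" unfolding c_def using C0 \<theta> by (intro divide_nonneg_pos) auto
  \<comment> \<open>The fixed point equation that determines c and lets the induction reproduce the
    same constant.\<close>
  have c_eq: "2 powr (p - 1) * (c * \<rho> + 5 * C) = c"
  proof -
    have "c * (1 - \<theta>) = 2 powr (p - 1) * 5 * C" using \<theta> by (simp add: c_def)
    moreover have "2 powr (p - 1) * (c * \<rho> + 5 * C) = c * \<theta> + 2 powr (p - 1) * 5 * C"
      unfolding \<theta>\<rho>[symmetric] by (simp add: algebra_simps)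
    ultimately show ?thesis by (simp add: algebra_simps)
  qed
  {
    case 0
    have "0 \<le> c * \<rho> ^ n" using c0 by (simp add: \<rho>_def)
    then show ?case unfolding c_def \<theta>_def \<rho>_def using p by simp
  next
    case (Suc N)
    have "(\<Sum>w\<in>words n. \<bar>cell_mean (w @ replicate (Suc N) i) - cell_mean w\<bar> powr p)
      \<le> (\<Sum>w\<in>words n. 2 powr (p - 1) * (\<bar>cell_mean ((w @ [i]) @ replicate N i) - cell_mean (w @ [i])\<bar> powr p + 5 * mean_oscillation p (\<lambda>x. f (word_map w x))))"
    proof (rule sum_mono)
      fix w assume w: "w \<in> words n"
      have "\<bar>cell_mean (w @ replicate (Suc N) i) - cell_mean w\<bar> powr p \<le>
        2 powr (p - 1) * (\<bar>cell_mean ((w @ [i]) @ replicate N i) - cell_mean (w @ [i])\<bar> powr p + \<bar>cell_mean (w @ [i]) - cell_mean w\<bar> powr p)"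
        using powr_add_le[OF p, of "cell_mean ((w @ [i]) @ replicate N i) - cell_mean (w @ [i])" "cell_mean (w @ [i]) - cell_mean w"] by simp
      also have "\<dots> \<le> 2 powr (p - 1) * (\<bar>cell_mean ((w @ [i]) @ replicate N i) - cell_mean (w @ [i])\<bar> powr p + 5 * mean_oscillation p (\<lambda>x. f (word_map w x)))"
        using cell_mean_step[OF w i] by (intro mult_left_mono add_left_mono) auto
      finally show "\<bar>cell_mean (w @ replicate (Suc N) i) - cell_mean w\<bar> powr p \<le>
        2 powr (p - 1) * (\<bar>cell_mean ((w @ [i]) @ replicate N i) - cell_mean (w @ [i])\<bar> powr p + 5 * mean_oscillation p (\<lambda>x. f (word_map w x)))" .
    qed
    also have "\<dots> = 2 powr (p - 1) * ((\<Sum>w\<in>words n. \<bar>cell_mean ((w @ [i]) @ replicate N i) - cell_mean (w @ [i])\<bar> powr p)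
       + 5 * (\<Sum>w\<in>words n. mean_oscillation p (\<lambda>x. f (word_map w x))))"
      by (simp only: sum_distrib_left[symmetric] sum.distrib)
    also have "\<dots> \<le> 2 powr (p - 1) * (c * \<rho> ^ Suc n + 5 * (C * \<rho> ^ n))"
    proof (intro mult_left_mono add_mono)
      have "(\<Sum>w\<in>words n. \<bar>cell_mean ((w @ [i]) @ replicate N i) - cell_mean (w @ [i])\<bar> powr p)
        = (\<Sum>v\<in>(\<lambda>w. w @ [i]) ` words n. \<bar>cell_mean (v @ replicate N i) - cell_mean v\<bar> powr p)"
        by (subst sum.reindex) (auto simp: inj_on_def)
      \<comment> \<open>Words ending in i are some of the words of length n + 1, so the induction
        hypothesis at that level applies.\<close>
      also have "\<dots> \<le> (\<Sum>v\<in>words (Suc n). \<bar>cell_mean (v @ replicate N i) - cell_mean v\<bar> powr p)"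
        using words_snoc i by (intro sum_mono2) auto
      also have "\<dots> \<le> c * \<rho> ^ Suc n" unfolding c_def \<theta>_def \<rho>_def by (rule Suc.IH)
      finally show "(\<Sum>w\<in>words n. \<bar>cell_mean ((w @ [i]) @ replicate N i) - cell_mean (w @ [i])\<bar> powr p) \<le> c * \<rho> ^ Suc n" .
      show "(\<Sum>w\<in>words n. mean_oscillation p (\<lambda>x. f (word_map w x))) \<le> C * \<rho> ^ n" unfolding \<rho>_def by (rule osc)
    qed auto
    also have "\<dots> = (2 powr (p - 1) * (c * \<rho> + 5 * C)) * \<rho> ^ n" by (simp add: algebra_simps)
    also have "\<dots> = c * \<rho> ^ n" unfolding c_eq ..
    finally show ?case unfolding c_def \<theta>_def \<rho>_def .
  }
qed

lemma word_map_replicate_fixed: "word_map (replicate N i) (vicsek_pt i) = vicsek_pt i"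
  by (induction N) simp_all

text \<open>The map i fixes q_i, so the cells w i i ... i shrink to the vertex in question, and
  continuity of f does the rest.\<close>

lemma cell_mean_tendsto:
  assumes w: "w \<in> words n" and i: "i \<in> {1..5}"
  shows "(\<lambda>N. cell_mean (w @ replicate N i)) \<longlonglongrightarrow> f (word_map w (vicsek_pt i))"
proof (rule LIMSEQ_I)
  fix e :: real assume e: "0 < e"
  define z where "z = word_map w (vicsek_pt i)"
  have z: "z \<in> vicsek_set" unfolding z_def by (rule word_map_vicsek_set[OF w vicsek_pt_vicsek_set[OF i]])
  obtain d where d: "0 < d" "\<And>x. x \<in> vicsek_set \<Longrightarrow> dist x z < d \<Longrightarrow> dist (f x) (f z) < e / 2"
    using f z e unfolding continuous_on_iff by (metis half_gt_zero)
  obtain k where k: "4 / 3 ^ k < d" using small_power_third[OF d(1)] .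
  have "norm (cell_mean (w @ replicate N i) - f z) < e" if N: "k \<le> N" for N
  proof -
    have v: "w @ replicate N i \<in> words (n + N)"
      using w i by (intro words_append) (auto simp: words_def)
    have near: "\<bar>f (word_map (w @ replicate N i) x) - f z\<bar> \<le> e / 2" if x: "x \<in> vicsek_set" for x
    proof -
      have zv: "z = word_map (w @ replicate N i) (vicsek_pt i)" by (simp add: z_def word_map_replicate_fixed del: foldr_replicate)
      have "dist (word_map (w @ replicate N i) x) z \<le> 4 / 3 ^ (n + N)"
        unfolding zv using x vicsek_pt_vicsek_set[OF i] by (intro word_map_diameter[OF v]) auto
      also have "\<dots> \<le> 4 / 3 ^ k" using N by (intro divide_left_mono power_increasing) auto
      finally have "dist (word_map (w @ replicate N i) x) z < d" using k by simp
      then show ?thesis using d(2)[OF word_map_vicsek_set[OF v x]] by (simp add: dist_real_def)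
    qed
    have int: "integrable vicsek_measure (\<lambda>x. f (word_map (w @ replicate N i) x))" by (rule word_integrable[OF v])
    have "cell_mean (w @ replicate N i) - f z = (LINT x|vicsek_measure. f (word_map (w @ replicate N i) x) - f z)"
      using int vicsek.prob_space by (simp add: cell_mean_def)
    also have "\<bar>\<dots>\<bar> \<le> (LINT x|vicsek_measure. \<bar>f (word_map (w @ replicate N i) x) - f z\<bar>)" by (rule integral_abs_bound)
    also have "\<dots> \<le> (LINT x|vicsek_measure. e / 2)"
      using int near by (intro integral_mono) (auto simp: space_vicsek_measure)
    finally show ?thesis using e vicsek.prob_space by simp
  qed
  then show "\<exists>no. \<forall>N\<ge>no. norm (cell_mean (w @ replicate N i) - f (word_map w (vicsek_pt i))) < e" unfolding z_def by blast
qed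

text \<open>Letting N grow in \<open>cell_mean_chain\<close> replaces the small-cell mean by a
  vertex value. The centre is the vertex with index 5, so each end of an arm is compared with the
  mean over the cell.\<close>

lemma discrete_energy_bound:
  assumes osc: "\<And>n. (\<Sum>w\<in>words n. mean_oscillation p (\<lambda>x. f (word_map w x))) \<le> C * ((1/3) powr (p - 1)) ^ n"
  shows "\<exists>C'. \<forall>n. (\<Sum>w\<in>words n. \<Sum>i\<in>{1..4}. \<bar>f (word_map w (vicsek_pt i)) - f (word_map w 0)\<bar> powr p) \<le> C' * ((1/3) powr (p - 1)) ^ n"
proof -
  define c where "c = 2 powr (p - 1) * 5 * C / (1 - (2/3) powr (p - 1))"
  define \<rho> where "\<rho> = (1/3::real) powr (p - 1)"
  have vert: "(\<Sum>w\<in>words n. \<bar>f (word_map w (vicsek_pt i)) - cell_mean w\<bar> powr p) \<le> c * \<rho> ^ n" if i: "i \<in> {1..5}" for n i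
  proof (rule LIMSEQ_le_const2)
    show "(\<lambda>N. \<Sum>w\<in>words n. \<bar>cell_mean (w @ replicate N i) - cell_mean w\<bar> powr p)
      \<longlonglongrightarrow> (\<Sum>w\<in>words n. \<bar>f (word_map w (vicsek_pt i)) - cell_mean w\<bar> powr p)"
      using p i by (intro tendsto_sum tendsto_powr' tendsto_intros cell_mean_tendsto) auto
    show "\<exists>N. \<forall>m\<ge>N. (\<Sum>w\<in>words n. \<bar>cell_mean (w @ replicate m i) - cell_mean w\<bar> powr p) \<le> c * \<rho> ^ n"
      using cell_mean_chain[OF osc i] unfolding c_def \<rho>_def by blast
  qed
  have "(\<Sum>w\<in>words n. \<bar>f (word_map w (vicsek_pt i)) - f (word_map w 0)\<bar> powr p) \<le> 2 powr (p - 1) * (2 * c) * \<rho> ^ n" if i: "i \<in> {1..4}" for n i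
  proof -
    have i5: "i \<in> {1..5}" using i by auto
    have "(\<Sum>w\<in>words n. \<bar>f (word_map w (vicsek_pt i)) - f (word_map w 0)\<bar> powr p) \<le>
      (\<Sum>w\<in>words n. 2 powr (p - 1) * (\<bar>f (word_map w (vicsek_pt i)) - cell_mean w\<bar> powr p + \<bar>f (word_map w (vicsek_pt 5)) - cell_mean w\<bar> powr p))"
    proof (rule sum_mono)
      fix w
      show "\<bar>f (word_map w (vicsek_pt i)) - f (word_map w 0)\<bar> powr p \<le> 2 powr (p - 1) * (\<bar>f (word_map w (vicsek_pt i)) - cell_mean w\<bar> powr p + \<bar>f (word_map w (vicsek_pt 5)) - cell_mean w\<bar> powr p)"
        using powr_add_le[OF p, of "f (word_map w (vicsek_pt i)) - cell_mean w" "cell_mean w - f (word_map w (vicsek_pt 5))"]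
        by (simp add: abs_minus_commute)
    qed
    also have "\<dots> = 2 powr (p - 1) * ((\<Sum>w\<in>words n. \<bar>f (word_map w (vicsek_pt i)) - cell_mean w\<bar> powr p) + (\<Sum>w\<in>words n. \<bar>f (word_map w (vicsek_pt 5)) - cell_mean w\<bar> powr p))"
      by (simp only: sum_distrib_left[symmetric] sum.distrib)
    also have "\<dots> \<le> 2 powr (p - 1) * (c * \<rho> ^ n + c * \<rho> ^ n)"
      using vert[OF i5] vert[of 5] by (intro mult_left_mono add_mono) auto
    finally show ?thesis by (simp add: algebra_simps)
  qed
  then have H: "(\<Sum>i\<in>{1..4}. \<Sum>w\<in>words n. \<bar>f (word_map w (vicsek_pt i)) - f (word_map w 0)\<bar> powr p) \<le> (\<Sum>i\<in>{1..4::nat}. 2 powr (p - 1) * (2 * c) * \<rho> ^ n)" for n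
    by (rule sum_mono)
  have "(\<Sum>w\<in>words n. \<Sum>i\<in>{1..4}. \<bar>f (word_map w (vicsek_pt i)) - f (word_map w 0)\<bar> powr p) \<le> (4 * (2 powr (p - 1) * (2 * c))) * \<rho> ^ n" for n
    by (subst sum.swap) (rule order_trans[OF H], simp)
  then show ?thesis unfolding \<rho>_def by blast
qed

end

lemma third_powr_hausdorff_dim: "((1/3) ^ n) powr hausdorff_dim = ((1/5) ^ n :: real)"
proof -
  have h: "(1/3) powr hausdorff_dim = (1/5::real)"
    by (simp add: powr_def hausdorff_dim_def ln_div exp_minus inverse_eq_divide)
  have "((1/3) ^ n) powr hausdorff_dim = ((1/3) powr hausdorff_dim) ^ n"
    by (simp add: powr_powr powr_realpow[symmetric] mult.commute)
  then show ?thesis unfolding h .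
qed

text \<open>The limsup condition is sampled at r = 4 / 3^n, where \<open>besov_lower_bound\<close>
  converts it into a bound on the oscillations over cells of level n.\<close>

lemma sobolev_energy_bound:
  assumes p: "1 < p" and f: "f \<in> sobolev_space p"
  shows "\<exists>C. \<forall>n. (\<Sum>w\<in>words n. \<Sum>i\<in>{1..4}. \<bar>f (word_map w (vicsek_pt i)) - f (word_map w 0)\<bar> powr p) \<le> C * ((1/3) powr (p - 1)) ^ n"
proof -
  have cont: "continuous_on vicsek_set f" and lim: "Limsup (at_right 0) (\<lambda>r. ereal (besov_quotient p f r)) < \<infinity>"
    using f by (auto simp: sobolev_space_def)
  obtain M where M: "Limsup (at_right 0) (\<lambda>r. ereal (besov_quotient p f r)) < ereal M"
    using lim less_PInf_Ex_of_nat[of "Limsup (at_right 0) (\<lambda>r. ereal (besov_quotient p f r))"] by auto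
  have "eventually (\<lambda>r. ereal (besov_quotient p f r) < ereal M) (at_right 0)" using M by (rule Limsup_lessD)
  then obtain r0 where r0: "0 < r0" "\<And>r. 0 < r \<Longrightarrow> r < r0 \<Longrightarrow> besov_quotient p f r < M"
    unfolding eventually_at_right_field by auto
  obtain n0 where n0: "4 / 3 ^ n0 < r0" using small_power_third[OF r0(1)] .
  define \<rho> where "\<rho> = (1/3::real) powr (p - 1)"
  define \<Omega> where "\<Omega> n = (\<Sum>w\<in>words n. mean_oscillation p (\<lambda>x. f (word_map w x)))" for n
  define c where "c = ball_constant 4"
  have c: "0 < c" unfolding c_def by (rule ball_constant_pos) simp
  define C0 where "C0 = c * (\<bar>M\<bar> powr p * 4 powr (sobolev_exponent p * p))"
  have \<rho>: "0 < \<rho>" by (simp add: \<rho>_def)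
  have large: "\<Omega> n \<le> C0 * \<rho> ^ n" if n: "n0 \<le> n" for n
  proof -
    define r where "r = (4::real) / 3 ^ n"
    define I where "I = (LINT x|vicsek_measure. (LINT y:vicsek_ball x r|vicsek_measure. \<bar>f y - f x\<bar> powr p / measure vicsek_measure (vicsek_ball x r)))"
    have "r \<le> 4 / 3 ^ n0" unfolding r_def using n by (intro divide_left_mono power_increasing) auto
    then have r: "0 < r" "r < r0" using n0 by (auto simp: r_def)
    have I0: "0 \<le> I" unfolding I_def set_lebesgue_integral_def by (intro integral_nonneg_AE AE_I2) auto
    have "1 / r powr sobolev_exponent p * I powr (1 / p) \<le> \<bar>M\<bar>"
      using r0(2)[OF r] unfolding besov_quotient_def I_def[symmetric] by linarith
    then have "I powr (1 / p) \<le> \<bar>M\<bar> * r powr sobolev_exponent p" using r by (simp add: pos_divide_le_eq)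
    then have "(I powr (1 / p)) powr p \<le> (\<bar>M\<bar> * r powr sobolev_exponent p) powr p" using p by (intro powr_mono2) auto
    then have I: "I \<le> \<bar>M\<bar> powr p * r powr (sobolev_exponent p * p)" using p I0 by (simp add: powr_powr powr_mult)
    have "r powr (sobolev_exponent p * p) = 4 powr (sobolev_exponent p * p) * (\<rho> ^ n * (1/5) ^ n)"
    proof -
      \<comment> \<open>The summand p - 1 yields \<rho>^n, and d_h yields 5^(-n), which cancels
        against the measure of the cells.\<close>
      have e: "sobolev_exponent p * p = (p - 1) + hausdorff_dim" using p by (simp add: sobolev_exponent_def field_simps)
      have "r = 4 * (1/3) ^ n" by (simp add: r_def power_one_over)
      then have "r powr (sobolev_exponent p * p) = 4 powr (sobolev_exponent p * p) * ((1/3) ^ n) powr (sobolev_exponent p * p)"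
        by (simp add: powr_mult)
      also have "((1/3::real) ^ n) powr (sobolev_exponent p * p) = ((1/3) ^ n) powr (p - 1) * (1/5) ^ n"
        unfolding e powr_add third_powr_hausdorff_dim ..
      also have "((1/3::real) ^ n) powr (p - 1) = \<rho> ^ n"
        by (simp add: \<rho>_def powr_powr powr_realpow[symmetric] mult.commute)
      finally show ?thesis .
    qed
    then have "I \<le> \<bar>M\<bar> powr p * 4 powr (sobolev_exponent p * p) * \<rho> ^ n * (1/5) ^ n" using I by (simp add: mult_ac)
    then have "c * I \<le> (C0 * \<rho> ^ n) * (1/5) ^ n" using c unfolding C0_def by (simp add: mult_ac mult_left_mono)
    moreover have "(1/5) ^ n * \<Omega> n \<le> c * I"
      unfolding \<Omega>_def c_def I_def r_def by (rule besov_lower_bound[OF p cont])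
    ultimately have "(1/5) ^ n * \<Omega> n \<le> (1/5) ^ n * (C0 * \<rho> ^ n)" by (simp only: mult.commute[of _ "(1/5) ^ n"])
    then show ?thesis by (rule mult_left_le_imp_le) simp
  qed
  \<comment> \<open>The limsup controls only n \<ge> n0; each of the finitely many earlier levels is
    covered by its own quotient.\<close>
  define C1 where "C1 = C0 + (\<Sum>n<n0. \<Omega> n / \<rho> ^ n)"
  have \<Omega>0: "0 \<le> \<Omega> n" for n
    unfolding \<Omega>_def mean_oscillation_def by (intro sum_nonneg integral_nonneg_AE AE_I2) simp
  have C0: "0 \<le> C0" unfolding C0_def using c by simp
  have "\<Omega> n \<le> C1 * \<rho> ^ n" for n
  proof (cases "n0 \<le> n")
    case True
    have "C0 \<le> C1" unfolding C1_def using \<Omega>0 \<rho> by (simp add: sum_nonneg)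
    then have "C0 * \<rho> ^ n \<le> C1 * \<rho> ^ n" using \<rho> by (intro mult_right_mono) auto
    then show ?thesis using large[OF True] by linarith
  next
    case False
    have "\<Omega> n / \<rho> ^ n \<le> (\<Sum>n<n0. \<Omega> n / \<rho> ^ n)" using False \<Omega>0 \<rho> by (intro member_le_sum) auto
    then have "\<Omega> n / \<rho> ^ n \<le> C1" using C0 by (simp add: C1_def)
    then show ?thesis using \<rho> by (simp add: pos_divide_le_eq)
  qed
  then show ?thesis unfolding \<Omega>_def \<rho>_def by (rule discrete_energy_bound[OF p cont])
qed

section \<open>Existence of the derivative\<close>

definition edge :: "nat list \<Rightarrow> nat \<Rightarrow> pt set" where
  "edge w i = word_map w ` arm i"

text \<open>The distance from q_5 gained along the edge, starting at the centre of its cell, divided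
  by the length of the edge. It is 1 if the edge leads away from q_5 and -1 otherwise.\<close>

definition orient :: "nat list \<Rightarrow> nat \<Rightarrow> real" where
  "orient w i = (skeleton_dist 0 (word_map w (vicsek_pt i)) - skeleton_dist 0 (word_map w 0)) * 3 ^ length w"

lemma orient_affine:
  assumes w: "w \<in> words n" and i: "i \<in> {1..4}"
  shows "orient w i = 1 \<or> orient w i = -1"
    "t \<in> {0..1} \<Longrightarrow> skeleton_dist 0 (word_map w (t *\<^sub>R vicsek_pt i)) = skeleton_dist 0 (word_map w 0) + orient w i * t / 3 ^ n"
proof -
  have "5 \<in> {1..5::nat}" by simp
  from skeleton_dist_affine[OF w this i] obtain \<alpha> \<sigma> where s: "\<sigma> = 1 \<or> \<sigma> = -1"
    "\<And>t. t \<in> {0..1} \<Longrightarrow> skeleton_dist (vicsek_pt 5) (word_map w (t *\<^sub>R vicsek_pt i)) = \<alpha> + \<sigma> * t * (1/3) ^ n"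
    by blast
  have "\<sigma> * (1/3) ^ n * 3 ^ n = \<sigma>" by (simp add: power_one_over)
  then have o: "orient w i = \<sigma>"
    unfolding orient_def using s(2)[of 0] s(2)[of 1] words_length[OF w] by simp
  show "orient w i = 1 \<or> orient w i = -1" using s(1) o by simp
  show "skeleton_dist 0 (word_map w (t *\<^sub>R vicsek_pt i)) = skeleton_dist 0 (word_map w 0) + orient w i * t / 3 ^ n" if "t \<in> {0..1}"
    using s(2)[OF that] s(2)[of 0] o by (simp add: power_one_over)
qed

lemma arm_points:
  assumes "i \<in> {1..4}"
  shows "vicsek_map 5 0 = 0" "vicsek_map 5 (vicsek_pt i) = (1/3) *\<^sub>R vicsek_pt i"
    "vicsek_map i 0 = (2/3) *\<^sub>R vicsek_pt i" "vicsek_map i (vicsek_pt (opp i)) = (1/3) *\<^sub>R vicsek_pt i"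
  using vicsek_map_opp[OF assms] by (simp_all add: vicsek_map_eq)

text \<open>The distance is affine along the edge, so all thirds inherit its direction; the middle
  third is parametrised backwards, which flips its sign.\<close>

lemma orient_children:
  assumes w: "w \<in> words n" and i: "i \<in> {1..4}"
  shows "orient (w @ [5]) i = orient w i" "orient (w @ [i]) i = orient w i" "orient (w @ [i]) (opp i) = - orient w i"
proof -
  note a = orient_affine(2)[OF w i]
  have l: "length w = n" by (rule words_length[OF w])
  have v: "skeleton_dist 0 (word_map w ((1/3) *\<^sub>R vicsek_pt i)) = skeleton_dist 0 (word_map w 0) + orient w i / 3 / 3 ^ n"
    "skeleton_dist 0 (word_map w ((2/3) *\<^sub>R vicsek_pt i)) = skeleton_dist 0 (word_map w 0) + orient w i * 2 / 3 / 3 ^ n"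
    "skeleton_dist 0 (word_map w (vicsek_pt i)) = skeleton_dist 0 (word_map w 0) + orient w i / 3 ^ n"
    using a[of "1/3"] a[of "2/3"] a[of 1] by simp_all
  show "orient (w @ [5]) i = orient w i"
    unfolding orient_def[of "w @ [5]"] using v by (simp add: arm_points[OF i] l)
  show "orient (w @ [i]) i = orient w i"
    unfolding orient_def[of "w @ [i]"] using v by (simp add: arm_points[OF i] l field_simps)
  show "orient (w @ [i]) (opp i) = - orient w i"
    unfolding orient_def[of "w @ [i]"] using v by (simp add: arm_points[OF i] l field_simps)
qed

lemma edge_children:
  assumes "i \<in> {1..4}"
  shows "edge w i = edge (w @ [5]) i \<union> edge (w @ [i]) (opp i) \<union> edge (w @ [i]) i"
proof -
  have "edge w i = word_map w ` (vicsek_map 5 ` arm i \<union> vicsek_map i ` arm (opp i) \<union> vicsek_map i ` arm i)"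
    unfolding edge_def by (rule arg_cong[OF arm_subdivision[OF assms]])
  then show ?thesis by (simp add: edge_def image_Un image_image)
qed

lemma edge_length_sets [measurable]: "w \<in> words n \<Longrightarrow> i \<in> {1..4} \<Longrightarrow> edge w i \<in> sets length_measure"
  unfolding edge_def by (rule edge_sets)

lemma emeasure_edge: "w \<in> words n \<Longrightarrow> i \<in> {1..4} \<Longrightarrow> emeasure length_measure (edge w i) = ennreal ((1/3) ^ n)"
  unfolding edge_def by (rule length_measure_edge)

lemma measure_edge: "w \<in> words n \<Longrightarrow> i \<in> {1..4} \<Longrightarrow> measure length_measure (edge w i) = (1/3) ^ n"
  by (simp add: measure_def emeasure_edge)

lemma edges_inter:
  assumes "w \<in> words n" "i \<in> {1..4}" "v \<in> words n" "j \<in> {1..4}" "(w, i) \<noteq> (v, j)"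
  shows "\<exists>c. edge w i \<inter> edge v j \<subseteq> {c}"
proof (cases "w = v")
  case False
  obtain c where c: "word_map w ` vicsek_square \<inter> word_map v ` vicsek_square \<subseteq> {c}"
    using cells_inter[OF assms(1,3) False] by blast
  have "edge w i \<inter> edge v j \<subseteq> {c}"
    unfolding edge_def by (rule order_trans[OF Int_mono[OF image_mono[OF arm_square] image_mono[OF arm_square]] c])
  then show ?thesis by (rule exI)
next
  case True
  then have ij: "i \<noteq> j" using assms(5) by simp
  have "arm i \<inter> arm j \<subseteq> {0}" by (rule arm_inter[OF assms(2,4) ij])
  then have "word_map v ` (arm i \<inter> arm j) \<subseteq> {word_map v 0}" by blast
  then show ?thesis unfolding edge_def True by (subst image_Int[OF inj_word_map, symmetric]) (rule exI)
qed

lemma AE_edges_disjoint: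
  assumes "w \<in> words n" "i \<in> {1..4}" "v \<in> words n" "j \<in> {1..4}" "(w, i) \<noteq> (v, j)"
  shows "AE z in length_measure. \<not> (z \<in> edge w i \<and> z \<in> edge v j)"
proof -
  obtain c where "edge w i \<inter> edge v j \<subseteq> {c}" using edges_inter[OF assms] by blast
  then have "edge w i \<inter> edge v j \<in> null_sets length_measure"
    using edge_length_sets assms length_measure_singleton by (intro null_setsI sets.Int) auto
  then have "AE z in length_measure. z \<notin> edge w i \<inter> edge v j" by (rule AE_not_in)
  then show ?thesis by simp
qed

section \<open>Edgewise slopes as a martingale and their limit\<close>

context
  fixes f :: "pt \<Rightarrow> real" and p :: real
  assumes p: "1 < p"
begin

text \<open>The sign makes this the increment of f in the direction away from q_5, whichever way the
  edge is parametrised. Only so is it additive under subdivision.\<close>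

definition increment :: "nat list \<Rightarrow> nat \<Rightarrow> real" where
  "increment w i = orient w i * (f (word_map w (vicsek_pt i)) - f (word_map w 0))"

lemma increment_children:
  assumes "w \<in> words n" "i \<in> {1..4}"
  shows "increment w i = increment (w @ [5]) i + increment (w @ [i]) (opp i) + increment (w @ [i]) i"
  unfolding increment_def orient_children[OF assms] by (simp add: arm_points[OF assms(2)] algebra_simps)

text \<open>On each edge of level n the slope of f, the edge having length 3^(-n). At common
  vertices several terms add up, which is harmless because vertices are null.\<close>

definition step_deriv :: "nat \<Rightarrow> pt \<Rightarrow> real" where
  "step_deriv n z = (\<Sum>(w, i)\<in>words n \<times> {1..4}. 3 ^ n * increment w i * indicator (edge w i) z)"

text \<open>Away from the common vertices at most one indicator is nonzero, so \<phi> moves inside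
  the sum; \<phi> 0 = 0 covers the points outside the cable of level n.\<close>

lemma step_deriv_compose:
  fixes \<phi> :: "real \<Rightarrow> real"
  assumes "\<phi> 0 = 0"
  shows "AE z in length_measure. \<phi> (step_deriv n z) = (\<Sum>(w, i)\<in>words n \<times> {1..4}. \<phi> (3 ^ n * increment w i) * indicator (edge w i) z)"
proof -
  define J where "J = words n \<times> {1..4::nat}"
  have fin: "finite J" by (simp add: J_def)
  have "AE z in length_measure. \<forall>x\<in>J. \<forall>y\<in>J - {x}. \<not> (z \<in> edge (fst x) (snd x) \<and> z \<in> edge (fst y) (snd y))"
  proof (rule AE_finite_allI[OF fin])
    fix x assume x: "x \<in> J"
    show "AE z in length_measure. \<forall>y\<in>J - {x}. \<not> (z \<in> edge (fst x) (snd x) \<and> z \<in> edge (fst y) (snd y))"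
    proof (rule AE_finite_allI)
      fix y assume "y \<in> J - {x}"
      then show "AE z in length_measure. \<not> (z \<in> edge (fst x) (snd x) \<and> z \<in> edge (fst y) (snd y))"
        using x by (intro AE_edges_disjoint[of _ n]) (auto simp: J_def prod_eq_iff)
    qed (use fin in simp)
  qed
  then show ?thesis
  proof eventually_elim
    fix z assume disj: "\<forall>x\<in>J. \<forall>y\<in>J - {x}. \<not> (z \<in> edge (fst x) (snd x) \<and> z \<in> edge (fst y) (snd y))"
    show "\<phi> (step_deriv n z) = (\<Sum>(w, i)\<in>words n \<times> {1..4}. \<phi> (3 ^ n * increment w i) * indicator (edge w i) z)"
    proof (cases "\<exists>x\<in>J. z \<in> edge (fst x) (snd x)")
      case True
      then obtain x where x: "x \<in> J" "z \<in> edge (fst x) (snd x)" by blast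
      have sum: "(\<Sum>(w, i)\<in>J. c w i * indicator (edge w i) z) = c (fst x) (snd x)" for c :: "nat list \<Rightarrow> nat \<Rightarrow> real"
      proof -
        have "(\<Sum>(w, i)\<in>J. c w i * indicator (edge w i) z) = (\<Sum>y\<in>J. if y = x then c (fst x) (snd x) else 0)"
        proof (rule sum.cong[OF refl])
          fix y assume "y \<in> J"
          then have "y \<noteq> x \<Longrightarrow> z \<notin> edge (fst y) (snd y)" using disj x by blast
          then show "(case y of (w, i) \<Rightarrow> c w i * indicator (edge w i) z) = (if y = x then c (fst x) (snd x) else 0)"
            using x by (cases "y = x") (simp_all add: case_prod_beta)
        qed
        then show ?thesis using x fin by simp
      qed
      show ?thesis unfolding step_deriv_def J_def[symmetric] sum ..
    next
      case False
      have sum: "(\<Sum>(w, i)\<in>J. c w i * indicator (edge w i) z) = 0" for c :: "nat list \<Rightarrow> nat \<Rightarrow> real"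
        using False by (intro sum.neutral ballI) (simp add: case_prod_beta indicator_def)
      show ?thesis unfolding step_deriv_def J_def[symmetric] sum by (rule assms)
    qed
  qed
qed

lemma edge_combination_integral:
  fixes c :: "nat list \<Rightarrow> nat \<Rightarrow> real"
  shows "integrable length_measure (\<lambda>z. \<Sum>(w, i)\<in>words n \<times> {1..4}. c w i * indicator (edge w i) z)"
    "(LINT z|length_measure. (\<Sum>(w, i)\<in>words n \<times> {1..4}. c w i * indicator (edge w i) z)) = (\<Sum>(w, i)\<in>words n \<times> {1..4}. c w i * (1/3) ^ n)"
proof -
  have int: "integrable length_measure (\<lambda>z. c w i * indicator (edge w i) z)" if "w \<in> words n" "i \<in> {1..4}" for w i
    using that emeasure_edge[OF that] edge_length_sets[OF that] by (intro integrable_mult_right integrable_real_indicator) auto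
  show "integrable length_measure (\<lambda>z. \<Sum>(w, i)\<in>words n \<times> {1..4}. c w i * indicator (edge w i) z)"
    unfolding case_prod_beta by (intro Bochner_Integration.integrable_sum int) auto
  have "(LINT z|length_measure. (\<Sum>(w, i)\<in>words n \<times> {1..4}. c w i * indicator (edge w i) z)) = (\<Sum>(w, i)\<in>words n \<times> {1..4}. LINT z|length_measure. c w i * indicator (edge w i) z)"
    unfolding case_prod_beta by (intro Bochner_Integration.integral_sum int) auto
  also have "\<dots> = (\<Sum>(w, i)\<in>words n \<times> {1..4}. c w i * (1/3) ^ n)"
  proof (rule sum.cong, rule refl, clarify)
    fix w i assume wi: "w \<in> words n" "i \<in> {1..4::nat}"
    have "edge w i \<inter> space length_measure = edge w i" using sets.sets_into_space[OF edge_length_sets[OF wi]] by blast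
    then show "(LINT z|length_measure. c w i * indicator (edge w i) z) = c w i * (1/3) ^ n"
      using measure_edge[OF wi] by simp
  qed
  finally show "(LINT z|length_measure. (\<Sum>(w, i)\<in>words n \<times> {1..4}. c w i * indicator (edge w i) z)) = (\<Sum>(w, i)\<in>words n \<times> {1..4}. c w i * (1/3) ^ n)" .
qed

lemma step_deriv_integrable: "integrable length_measure (step_deriv n)"
  unfolding step_deriv_def[abs_def] by (rule edge_combination_integral)

lemma step_deriv_measurable: "step_deriv n \<in> borel_measurable length_measure"
  using step_deriv_integrable by (rule borel_measurable_integrable)

lemma step_deriv_powr:
  "integrable length_measure (\<lambda>z. \<bar>step_deriv n z\<bar> powr p)"
  "(LINT z|length_measure. \<bar>step_deriv n z\<bar> powr p) = (\<Sum>(w, i)\<in>words n \<times> {1..4}. \<bar>3 ^ n * increment w i\<bar> powr p * (1/3) ^ n)"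
proof -
  have ae: "AE z in length_measure. \<bar>step_deriv n z\<bar> powr p = (\<Sum>(w, i)\<in>words n \<times> {1..4}. \<bar>3 ^ n * increment w i\<bar> powr p * indicator (edge w i) z)"
    using step_deriv_compose[of "\<lambda>t. \<bar>t\<bar> powr p" n] p by simp
  note c = edge_combination_integral[of "\<lambda>w i. \<bar>3 ^ n * increment w i\<bar> powr p" n]
  have m: "(\<lambda>z. \<bar>step_deriv n z\<bar> powr p) \<in> borel_measurable length_measure"
    using step_deriv_measurable[of n] by measurable
  show "integrable length_measure (\<lambda>z. \<bar>step_deriv n z\<bar> powr p)"
    using integrable_cong_AE[OF m borel_measurable_integrable[OF c(1)] ae] c(1) by simp
  show "(LINT z|length_measure. \<bar>step_deriv n z\<bar> powr p) = (\<Sum>(w, i)\<in>words n \<times> {1..4}. \<bar>3 ^ n * increment w i\<bar> powr p * (1/3) ^ n)"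
    using integral_cong_AE[OF m borel_measurable_integrable[OF c(1)] ae] c(2) by simp
qed

lemma set_integrable_edge:
  fixes h :: "pt \<Rightarrow> real"
  assumes "integrable length_measure h" "w \<in> words n" "i \<in> {1..4}"
  shows "set_integrable length_measure (edge w i) h"
  unfolding set_integrable_def using integrable_mult_indicator[OF edge_length_sets[OF assms(2,3)] assms(1)] .

lemma set_integral_edge_children:
  fixes h :: "pt \<Rightarrow> real"
  assumes h: "integrable length_measure h" and w: "w \<in> words n" and i: "i \<in> {1..4}"
  shows "(LINT z:edge w i|length_measure. h z) = (LINT z:edge (w @ [5]) i|length_measure. h z)
    + (LINT z:edge (w @ [i]) (opp i)|length_measure. h z) + (LINT z:edge (w @ [i]) i|length_measure. h z)"
proof -
  have w5: "w @ [5] \<in> words (Suc n)" and wi: "w @ [i] \<in> words (Suc n)" using i by (auto intro!: words_snoc[OF w])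
  have o: "opp i \<in> {1..4}" "opp i \<noteq> i" using i by (rule opp_in_4, rule opp_neq)
  have ne: "5 \<noteq> i" using i by auto
  have d1: "AE z in length_measure. \<not> (z \<in> edge (w @ [5]) i \<and> z \<in> edge (w @ [i]) (opp i))"
    using ne by (intro AE_edges_disjoint[OF w5 i wi o(1)]) auto
  have d2: "AE z in length_measure. \<not> (z \<in> edge (w @ [5]) i \<and> z \<in> edge (w @ [i]) i)"
    using ne by (intro AE_edges_disjoint[OF w5 i wi i]) auto
  have d3: "AE z in length_measure. \<not> (z \<in> edge (w @ [i]) (opp i) \<and> z \<in> edge (w @ [i]) i)"
    using o by (intro AE_edges_disjoint[OF wi o(1) wi i]) auto
  have d23: "AE z in length_measure. \<not> (z \<in> edge (w @ [5]) i \<union> edge (w @ [i]) (opp i) \<and> z \<in> edge (w @ [i]) i)"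
    using d2 d3 by eventually_elim auto
  note s = set_integrable_edge[OF h w5 i] set_integrable_edge[OF h wi o(1)] set_integrable_edge[OF h wi i]
  have "(LINT z:edge w i|length_measure. h z) = (LINT z:edge (w @ [5]) i \<union> edge (w @ [i]) (opp i)|length_measure. h z) + (LINT z:edge (w @ [i]) i|length_measure. h z)"
    unfolding edge_children[OF i, of w]
    using w5 wi i o by (intro set_integral_Un_AE[OF d23] set_integrable_Un s) (auto intro: edge_length_sets)
  also have "(LINT z:edge (w @ [5]) i \<union> edge (w @ [i]) (opp i)|length_measure. h z) = (LINT z:edge (w @ [5]) i|length_measure. h z) + (LINT z:edge (w @ [i]) (opp i)|length_measure. h z)"
    using w5 wi i o by (intro set_integral_Un_AE[OF d1] s) (auto intro: edge_length_sets)
  finally show ?thesis .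
qed

text \<open>The martingale property. The edge is split into its three children, for which the level
  difference is smaller by one, and \<open>increment\<close> is additive.\<close>

lemma step_deriv_edge_integral:
  "w \<in> words n \<Longrightarrow> i \<in> {1..4} \<Longrightarrow> (LINT z:edge w i|length_measure. step_deriv (n + k) z) = increment w i"
proof (induction k arbitrary: n w i)
  case 0
  have ae: "AE z in length_measure. indicator (edge w i) z *\<^sub>R step_deriv n z = 3 ^ n * increment w i * indicator (edge w i) z"
  proof -
    define J where "J = words n \<times> {1..4::nat}"
    have "AE z in length_measure. \<forall>y\<in>J - {(w, i)}. \<not> (z \<in> edge w i \<and> z \<in> edge (fst y) (snd y))"
    proof (rule AE_finite_allI)
      fix y assume "y \<in> J - {(w, i)}"
      then show "AE z in length_measure. \<not> (z \<in> edge w i \<and> z \<in> edge (fst y) (snd y))"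
        using 0 by (intro AE_edges_disjoint[of _ n]) (auto simp: J_def prod_eq_iff)
    qed (simp add: J_def)
    then show ?thesis
    proof eventually_elim
      fix z assume disj: "\<forall>y\<in>J - {(w, i)}. \<not> (z \<in> edge w i \<and> z \<in> edge (fst y) (snd y))"
      have "step_deriv n z = (\<Sum>y\<in>J. if y = (w, i) then 3 ^ n * increment w i else 0)" if "z \<in> edge w i"
        unfolding step_deriv_def J_def[symmetric]
      proof (rule sum.cong[OF refl])
        fix y assume "y \<in> J"
        then have "y \<noteq> (w, i) \<Longrightarrow> z \<notin> edge (fst y) (snd y)" using disj that by blast
        then show "(case y of (w, i) \<Rightarrow> 3 ^ n * increment w i * indicator (edge w i) z) = (if y = (w, i) then 3 ^ n * increment w i else 0)"
          using that by (cases "y = (w, i)") (simp_all add: case_prod_beta)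
      qed
      then show "indicator (edge w i) z *\<^sub>R step_deriv n z = 3 ^ n * increment w i * indicator (edge w i) z"
        using 0 by (auto simp: J_def indicator_def)
    qed
  qed
  have "(LINT z:edge w i|length_measure. step_deriv n z) = (LINT z|length_measure. 3 ^ n * increment w i * indicator (edge w i) z)"
    unfolding set_lebesgue_integral_def using ae step_deriv_measurable[of n] edge_length_sets[OF 0]
    by (intro integral_cong_AE) auto
  also have "\<dots> = 3 ^ n * increment w i * (1/3) ^ n"
  proof -
    have "edge w i \<inter> space length_measure = edge w i" using sets.sets_into_space[OF edge_length_sets[OF 0]] by blast
    then show ?thesis using measure_edge[OF 0] by simp
  qed
  finally show ?case by (simp add: power_one_over)
next
  case (Suc k)
  have w5: "w @ [5] \<in> words (Suc n)" and wi: "w @ [i] \<in> words (Suc n)" using Suc.prems by (auto intro!: words_snoc)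
  have o: "opp i \<in> {1..4}" using Suc.prems(2) by (rule opp_in_4)
  show ?case
    unfolding set_integral_edge_children[OF step_deriv_integrable Suc.prems] increment_children[OF Suc.prems]
    using Suc.IH[OF w5 Suc.prems(2)] Suc.IH[OF wi o] Suc.IH[OF wi Suc.prems(2)] by simp
qed

text \<open>Tangent inequality at the slope of level n. The coefficient of the linear term is
  constant on each edge of level n, and the deviation d integrates to zero there by the martingale
  property. This is the midpoint hypothesis of \<open>Lp_uniformly_convex_Cauchy\<close>.\<close>

lemma step_deriv_monotone:
  assumes "n \<le> m"
  shows "(LINT z|length_measure. \<bar>step_deriv n z\<bar> powr p) \<le> (LINT z|length_measure. \<bar>(step_deriv n z + step_deriv m z) / 2\<bar> powr p)"
proof -
  define d where "d z = (step_deriv m z - step_deriv n z) / 2" for z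
  have d: "integrable length_measure d" unfolding d_def using step_deriv_integrable by simp
  have d0: "(LINT z:edge w i|length_measure. d z) = 0" if wi: "w \<in> words n" "i \<in> {1..4}" for w i
  proof -
    have "(LINT z:edge w i|length_measure. step_deriv m z - step_deriv n z) = 0"
      using step_deriv_edge_integral[OF wi, of "m - n"] step_deriv_edge_integral[OF wi, of 0] assms
        set_integral_diff(2)[OF set_integrable_edge[OF step_deriv_integrable wi] set_integrable_edge[OF step_deriv_integrable wi], of m n] by simp
    then show ?thesis by (simp add: d_def)
  qed
  have ae: "AE z in length_measure. powr_slope p (step_deriv n z) * d z
      = (\<Sum>(w, i)\<in>words n \<times> {1..4}. powr_slope p (3 ^ n * increment w i) * (indicator (edge w i) z *\<^sub>R d z))"
    using step_deriv_compose[of "powr_slope p" n, OF powr_slope_0]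
    by eventually_elim (simp only: sum_distrib_right case_prod_beta' mult.assoc real_scaleR_def)
  have ms: "(\<lambda>z. powr_slope p (step_deriv n z) * d z) \<in> borel_measurable length_measure"
    unfolding powr_slope_def using step_deriv_measurable[of n] borel_measurable_integrable[OF d] by measurable
  have ei: "integrable length_measure (\<lambda>z. indicator (edge w i) z *\<^sub>R d z)" if "w \<in> words n" "i \<in> {1..4}" for w i
    using set_integrable_edge[OF d that] by (simp add: set_integrable_def)
  have si: "integrable length_measure (\<lambda>z. \<Sum>(w, i)\<in>words n \<times> {1..4}. powr_slope p (3 ^ n * increment w i) * (indicator (edge w i) z *\<^sub>R d z))"
    unfolding case_prod_beta by (intro Bochner_Integration.integrable_sum integrable_mult_right ei) auto
  have i1: "integrable length_measure (\<lambda>z. powr_slope p (step_deriv n z) * d z)"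
    using integrable_cong_AE[OF ms borel_measurable_integrable[OF si] ae] si by simp
  have "(LINT z|length_measure. powr_slope p (step_deriv n z) * d z)
    = (LINT z|length_measure. (\<Sum>(w, i)\<in>words n \<times> {1..4}. powr_slope p (3 ^ n * increment w i) * (indicator (edge w i) z *\<^sub>R d z)))"
    by (rule integral_cong_AE[OF ms borel_measurable_integrable[OF si] ae])
  also have "\<dots> = (\<Sum>x\<in>words n \<times> {1..4}. LINT z|length_measure. powr_slope p (3 ^ n * increment (fst x) (snd x)) * (indicator (edge (fst x) (snd x)) z *\<^sub>R d z))"
    unfolding case_prod_beta by (intro Bochner_Integration.integral_sum integrable_mult_right ei) auto
  also have "\<dots> = 0"
    using d0 unfolding set_lebesgue_integral_def by (intro sum.neutral) auto
  finally have zero: "(LINT z|length_measure. powr_slope p (step_deriv n z) * d z) = 0" .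
  have half: "integrable length_measure (\<lambda>z. \<bar>(step_deriv n z + step_deriv m z) / 2\<bar> powr p)"
    by (rule integrable_powr_half[OF p step_deriv_measurable step_deriv_measurable step_deriv_powr(1) step_deriv_powr(1)])
  have "(LINT z|length_measure. \<bar>step_deriv n z\<bar> powr p + powr_slope p (step_deriv n z) * d z) \<le> (LINT z|length_measure. \<bar>(step_deriv n z + step_deriv m z) / 2\<bar> powr p)"
  proof (rule integral_mono[OF Bochner_Integration.integrable_add[OF step_deriv_powr(1) i1] half])
    fix z
    have "(step_deriv n z + step_deriv m z) / 2 - step_deriv n z = d z" by (simp add: d_def field_simps)
    then show "\<bar>step_deriv n z\<bar> powr p + powr_slope p (step_deriv n z) * d z \<le> \<bar>(step_deriv n z + step_deriv m z) / 2\<bar> powr p"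
      using powr_tangent[OF p, of "step_deriv n z" "(step_deriv n z + step_deriv m z) / 2"] by simp
  qed
  then show ?thesis using zero step_deriv_powr(1) i1 by simp
qed

text \<open>The energy of the slopes of level n is 3^(n(p-1)) times the discrete energy, exactly
  balancing the assumed decay, so the martingale is bounded in L^p and has a limit with the right
  integrals.\<close>

lemma derivative_exists:
  assumes energy: "\<And>n. (\<Sum>w\<in>words n. \<Sum>i\<in>{1..4}. \<bar>f (word_map w (vicsek_pt i)) - f (word_map w 0)\<bar> powr p) \<le> C * ((1/3) powr (p - 1)) ^ n"
  shows "\<exists>h\<in>Lp_functions p length_measure. \<forall>n. \<forall>w\<in>words n. \<forall>i\<in>{1..4}. (LINT z:edge w i|length_measure. h z) = increment w i"
proof -
  have bound: "(LINT z|length_measure. \<bar>step_deriv n z\<bar> powr p) \<le> C" for n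
  proof -
    have inc: "\<bar>increment w i\<bar> = \<bar>f (word_map w (vicsek_pt i)) - f (word_map w 0)\<bar>" if "w \<in> words n" "i \<in> {1..4}" for w i
      using orient_affine(1)[OF that] by (auto simp: increment_def)
    have "(LINT z|length_measure. \<bar>step_deriv n z\<bar> powr p) = (\<Sum>(w, i)\<in>words n \<times> {1..4}. (3 powr (p - 1)) ^ n * \<bar>f (word_map w (vicsek_pt i)) - f (word_map w 0)\<bar> powr p)"
      unfolding step_deriv_powr(2)
    proof (rule sum.cong, rule refl, clarify)
      fix w i assume wi: "w \<in> words n" "i \<in> {1..4::nat}"
      have "(3 ^ n) powr p * (1/3) ^ n = (3 powr (p - 1)) ^ n"
      proof -
        have "(3 ^ n) powr p = (3 powr p) ^ n" by (simp add: powr_powr powr_realpow[symmetric] mult.commute)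
        then show ?thesis by (simp add: powr_diff power_divide power_one_over)
      qed
      then show "\<bar>3 ^ n * increment w i\<bar> powr p * (1/3) ^ n = (3 powr (p - 1)) ^ n * \<bar>f (word_map w (vicsek_pt i)) - f (word_map w 0)\<bar> powr p"
        using inc[OF wi] by (simp add: abs_mult powr_mult mult_ac)
    qed
    also have "\<dots> = (3 powr (p - 1)) ^ n * (\<Sum>w\<in>words n. \<Sum>i\<in>{1..4}. \<bar>f (word_map w (vicsek_pt i)) - f (word_map w 0)\<bar> powr p)"
      by (simp add: sum.cartesian_product[symmetric] sum_distrib_left)
    also have "\<dots> \<le> (3 powr (p - 1)) ^ n * (C * ((1/3) powr (p - 1)) ^ n)"
      using energy by (intro mult_left_mono) auto
    also have "\<dots> = C * (3 powr (p - 1) * (1/3) powr (p - 1)) ^ n" by (simp add: power_mult_distrib)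
    also have "3 powr (p - 1) * (1/3) powr (p - 1) = (1::real)" by (simp flip: powr_mult)
    finally show ?thesis by simp
  qed
  have cauchy: "\<exists>N. \<forall>n\<ge>N. \<forall>m\<ge>n. (LINT z|length_measure. \<bar>step_deriv m z - step_deriv n z\<bar> powr p) < \<eta>" if "0 < \<eta>" for \<eta>
    by (rule Lp_uniformly_convex_Cauchy[OF p step_deriv_measurable step_deriv_powr(1) bound step_deriv_monotone that])
  obtain h where h: "h \<in> borel_measurable length_measure" "integrable length_measure (\<lambda>x. \<bar>h x\<bar> powr p)"
    "(\<lambda>n. LINT x|length_measure. \<bar>h x - step_deriv n x\<bar> powr p) \<longlonglongrightarrow> 0"
    using Lp_Cauchy_converges[OF p step_deriv_measurable step_deriv_powr(1) cauchy] by blast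
  have "(LINT z:edge w i|length_measure. h z) = increment w i" if wi: "w \<in> words n" "i \<in> {1..4}" for n w i
  proof (rule LIMSEQ_unique)
    have fin: "emeasure length_measure (edge w i) < \<infinity>" using emeasure_edge[OF wi] by simp
    show "(\<lambda>k. LINT z:edge w i|length_measure. step_deriv k z) \<longlonglongrightarrow> (LINT z:edge w i|length_measure. h z)"
      by (rule Lp_convergence_set_integral[OF p edge_length_sets[OF wi] fin step_deriv_measurable step_deriv_powr(1) h])
    \<comment> \<open>The integral over an edge of level n is exact only for slopes of level at
      least n, hence the shift of the index.\<close>
    have "(\<lambda>k. LINT z:edge w i|length_measure. step_deriv (k + n) z) \<longlonglongrightarrow> increment w i"
      using step_deriv_edge_integral[OF wi] by (simp add: add.commute)
    then show "(\<lambda>k. LINT z:edge w i|length_measure. step_deriv k z) \<longlonglongrightarrow> increment w i" by (rule LIMSEQ_offset)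
  qed
  then show ?thesis using h by (intro bexI[of _ h]) (auto simp: Lp_functions_def)
qed

end

lemma word_map_vertex_skeleton: "w \<in> words n \<Longrightarrow> i \<in> {1..5} \<Longrightarrow> word_map w (vicsek_pt i) \<in> skeleton"
  by (intro word_map_skeleton vicsek_pt_skeleton)

text \<open>The function just constructed is a witness for the choice. An oriented adjacent pair
  consists of the ends of one edge in one of two orders, and the sign \<open>orient\<close> matches
  the order.\<close>

lemma vicsek_deriv_spec:
  assumes p: "1 < p" and f: "f \<in> sobolev_space p"
  shows "vicsek_deriv p f \<in> Lp_functions p length_measure \<and>
     (\<forall>n u v. adjacent n u v \<and> vicsek_dist (vicsek_pt 5) u < vicsek_dist (vicsek_pt 5) v \<longrightarrow>
        f v - f u = (LINT z:closed_segment u v|length_measure. vicsek_deriv p f z))"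
proof -
  obtain C where C: "\<And>n. (\<Sum>w\<in>words n. \<Sum>i\<in>{1..4}. \<bar>f (word_map w (vicsek_pt i)) - f (word_map w 0)\<bar> powr p) \<le> C * ((1/3) powr (p - 1)) ^ n"
    using sobolev_energy_bound[OF p f] by blast
  obtain h where h: "h \<in> Lp_functions p length_measure"
    "\<And>n w i. w \<in> words n \<Longrightarrow> i \<in> {1..4} \<Longrightarrow> (LINT z:edge w i|length_measure. h z) = increment f w i"
    using derivative_exists[OF p C] by blast
  have "f v - f u = (LINT z:closed_segment u v|length_measure. h z)"
    if a: "adjacent n u v" and d: "vicsek_dist (vicsek_pt 5) u < vicsek_dist (vicsek_pt 5) v" for n u v
  proof -
    have "closed_segment u v \<in> edges n" using a by (simp add: adjacent_def)
    then obtain w i where wi: "w \<in> words n" "i \<in> {1..4}" "closed_segment u v = edge w i"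
      unfolding edges_conv edge_def by auto
    have i5: "i \<in> {1..5}" using wi(2) by auto
    have "closed_segment u v = closed_segment (word_map w 0) (word_map w (vicsek_pt i))"
      using wi(3) unfolding edge_def word_map_segment .
    then have uv: "u = word_map w 0 \<and> v = word_map w (vicsek_pt i) \<or> u = word_map w (vicsek_pt i) \<and> v = word_map w 0"
      by (auto simp: doubleton_eq_iff)
    have s: "word_map w 0 \<in> skeleton" "word_map w (vicsek_pt i) \<in> skeleton"
      using word_map_vertex_skeleton[OF wi(1) i5] word_map_skeleton[OF wi(1) zero_skeleton] by auto
    have "u \<in> skeleton" "v \<in> skeleton" using uv s by auto
    then have d': "skeleton_dist 0 u < skeleton_dist 0 v" using d zero_skeleton by (simp add: vicsek_dist_skeleton)
    have "skeleton_dist 0 (word_map w (vicsek_pt i)) = skeleton_dist 0 (word_map w 0) + orient w i / 3 ^ n"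
      using orient_affine(2)[OF wi(1,2), of 1] by simp
    then have "increment f w i = f v - f u"
      using uv d' orient_affine(1)[OF wi(1,2)] by (auto simp: increment_def[OF p])
    then show ?thesis using h(2)[OF wi(1,2)] wi(3) by simp
  qed
  then have "\<exists>g. g \<in> Lp_functions p length_measure \<and>
     (\<forall>n u v. adjacent n u v \<and> vicsek_dist (vicsek_pt 5) u < vicsek_dist (vicsek_pt 5) v \<longrightarrow>
        f v - f u = (LINT z:closed_segment u v|length_measure. g z))" using h(1) by blast
  then show ?thesis unfolding vicsek_deriv_def by (rule someI_ex)
qed

text \<open>Both orders of the end points are adjacent pairs and one of them is oriented. Absolute
  values spare further bookkeeping of signs.\<close>

lemma vicsek_deriv_edge:
  assumes p: "1 < p" and f: "f \<in> sobolev_space p" and w: "w \<in> words n" and i: "i \<in> {1..4}"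
  shows "\<bar>f (word_map w (vicsek_pt i)) - f (word_map w 0)\<bar> = \<bar>LINT z:edge w i|length_measure. vicsek_deriv p f z\<bar>"
proof -
  define u where "u = word_map w 0"
  define v where "v = word_map w (vicsek_pt i)"
  have i5: "i \<in> {1..5}" using i by auto
  have s: "u \<in> skeleton" "v \<in> skeleton"
    unfolding u_def v_def using word_map_vertex_skeleton[OF w i5] word_map_skeleton[OF w zero_skeleton] by auto
  have "u \<in> vertices n" "v \<in> vertices n"
    unfolding vertices_conv u_def v_def using w i5 image_eqI[of "word_map w 0" "\<lambda>(w, i). word_map w (vicsek_pt i)" "(w, 5)" "words n \<times> {1..5}"]
    by (simp, force)
  moreover have seg: "closed_segment u v = edge w i" unfolding u_def v_def edge_def word_map_segment ..
  moreover have "edge w i \<in> edges n" unfolding edges_conv edge_def using w i by auto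
  ultimately have a: "adjacent n u v" "adjacent n v u" by (auto simp: adjacent_def closed_segment_commute)
  have "skeleton_dist 0 v = skeleton_dist 0 u + orient w i / 3 ^ n"
    unfolding u_def v_def using orient_affine(2)[OF w i, of 1] by simp
  then have "skeleton_dist 0 u < skeleton_dist 0 v \<or> skeleton_dist 0 v < skeleton_dist 0 u"
    using orient_affine(1)[OF w i] by auto
  then consider "vicsek_dist (vicsek_pt 5) u < vicsek_dist (vicsek_pt 5) v" | "vicsek_dist (vicsek_pt 5) v < vicsek_dist (vicsek_pt 5) u"
    using s zero_skeleton by (auto simp: vicsek_dist_skeleton)
  then have "f v - f u = (LINT z:edge w i|length_measure. vicsek_deriv p f z) \<or> f u - f v = (LINT z:edge w i|length_measure. vicsek_deriv p f z)"
  proof cases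
    case 1
    then show ?thesis using vicsek_deriv_spec[OF p f] a(1) unfolding seg[symmetric] by blast
  next
    case 2
    then show ?thesis using vicsek_deriv_spec[OF p f] a(2) unfolding seg[symmetric] closed_segment_commute[of u v] by blast
  qed
  then show ?thesis unfolding u_def v_def by (metis abs_minus_commute)
qed

section \<open>The pointwise estimate\<close>

definition energy_root :: "real \<Rightarrow> (pt \<Rightarrow> real) \<Rightarrow> pt set \<Rightarrow> real" where
  "energy_root p f A = (LINT z:A|length_measure. \<bar>vicsek_deriv p f z\<bar> powr p) powr (1 / p)"

lemma energy_root_nonneg: "0 \<le> energy_root p f A"
  by (simp add: energy_root_def)

text \<open>The Hoelder factor gained with each level: an edge of length 3^(-m) contributes
  (3^(-m))^(1 - 1/p).\<close>

definition decay :: "real \<Rightarrow> real" where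
  "decay p = (1/3) powr (1 - 1 / p)"

lemma decay_bounds:
  assumes "1 < p" shows "0 < decay p" "decay p < 1"
  using assms powr_less_mono2[of "1 - 1/p" "1/3" "1::real"] by (auto simp: decay_def)

context
  fixes p :: real and f :: "pt \<Rightarrow> real" and A :: "pt set"
  assumes p: "1 < p" and f: "f \<in> sobolev_space p" and A: "A \<in> sets length_measure"
begin

lemma deriv_powr_integrable: "integrable length_measure (\<lambda>z. \<bar>vicsek_deriv p f z\<bar> powr p)"
  and deriv_measurable: "vicsek_deriv p f \<in> borel_measurable length_measure"
  using vicsek_deriv_spec[OF p f] by (auto simp: Lp_functions_def)

text \<open>Hoelder on an edge of length 3^(-m). The energy is then enlarged to all of A, so that
  one quantity serves every edge in the chain.\<close>

lemma edge_increment_le: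
  assumes v: "v \<in> words m" and i: "i \<in> {1..4}" and sub: "edge v i \<subseteq> A"
  shows "\<bar>f (word_map v (vicsek_pt i)) - f (word_map v 0)\<bar> \<le> decay p ^ m * energy_root p f A"
proof -
  define t where "t = \<bar>f (word_map v (vicsek_pt i)) - f (word_map v 0)\<bar>"
  define T where "T = (LINT z:A|length_measure. \<bar>vicsek_deriv p f z\<bar> powr p)"
  have fin: "emeasure length_measure (edge v i) < \<infinity>" using emeasure_edge[OF v i] by simp
  have "t powr p \<le> measure length_measure (edge v i) powr (p - 1) * (LINT z:edge v i|length_measure. \<bar>vicsek_deriv p f z\<bar> powr p)"
    unfolding t_def vicsek_deriv_edge[OF p f v i]
    by (rule set_powr_integral_mean(2)[OF p edge_length_sets[OF v i] fin deriv_measurable deriv_powr_integrable])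
  also have "\<dots> \<le> ((1/3) ^ m) powr (p - 1) * T"
    unfolding measure_edge[OF v i]
  proof (rule mult_left_mono)
    show "(LINT z:edge v i|length_measure. \<bar>vicsek_deriv p f z\<bar> powr p) \<le> T"
      unfolding T_def set_lebesgue_integral_def
      by (rule integral_mono[OF integrable_mult_indicator[OF edge_length_sets[OF v i] deriv_powr_integrable]
            integrable_mult_indicator[OF A deriv_powr_integrable]])
         (use sub in \<open>auto simp: indicator_def\<close>)
  qed simp
  finally have "(t powr p) powr (1/p) \<le> (((1/3) ^ m) powr (p - 1) * T) powr (1/p)"
    using p by (intro powr_mono2) auto
  moreover have "(t powr p) powr (1/p) = t" using p by (simp add: powr_powr t_def)
  moreover have "0 \<le> T"
    unfolding T_def set_lebesgue_integral_def by (intro integral_nonneg_AE AE_I2) simp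
  moreover have "(((1/3) ^ m) powr (p - 1)) powr (1/p) = decay p ^ m"
  proof -
    have "(p - 1) * (1/p) = 1 - 1/p" using p by (simp add: field_simps)
    then have "(((1/3) ^ m) powr (p - 1)) powr (1/p) = ((1/3::real) ^ m) powr (1 - 1/p)" by (simp only: powr_powr)
    also have "\<dots> = decay p ^ m" by (simp add: decay_def powr_powr powr_realpow[symmetric] mult.commute)
    finally show ?thesis .
  qed
  ultimately show ?thesis unfolding t_def[symmetric] energy_root_def T_def[symmetric] by (simp add: powr_mult)
qed

text \<open>The centre of the child i is 2/3 q_i inside the parent. It is joined to the centre of
  the parent through the corner 1/3 q_i by two edges of level m + 1.\<close>

lemma center_step:
  assumes v: "v \<in> words m" and i: "i \<in> {1..5}" and sub: "word_map v ` skeleton \<subseteq> A"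
  shows "\<bar>f (word_map (v @ [i]) 0) - f (word_map v 0)\<bar> \<le> 2 * decay p ^ m * energy_root p f A"
proof (cases "i = 5")
  case True
  then show ?thesis using decay_bounds[OF p] energy_root_nonneg by (simp add: vicsek_map_eq)
next
  case False
  then have i4: "i \<in> {1..4}" using i by auto
  have v5: "v @ [5] \<in> words (Suc m)" and vi: "v @ [i] \<in> words (Suc m)" using i by (auto intro!: words_snoc[OF v])
  have "edge v i \<subseteq> A" unfolding edge_def using arm_skeleton[OF i4] sub by blast
  then have e: "edge (v @ [5]) i \<subseteq> A" "edge (v @ [i]) (opp i) \<subseteq> A" using edge_children[OF i4, of v] by auto
  have "\<bar>f (word_map v ((1/3) *\<^sub>R vicsek_pt i)) - f (word_map v 0)\<bar> \<le> decay p ^ Suc m * energy_root p f A"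
    using edge_increment_le[OF v5 i4 e(1)] by (simp add: arm_points[OF i4])
  moreover have "\<bar>f (word_map v ((1/3) *\<^sub>R vicsek_pt i)) - f (word_map (v @ [i]) 0)\<bar> \<le> decay p ^ Suc m * energy_root p f A"
    using edge_increment_le[OF vi opp_in_4[OF i4] e(2)] by (simp add: arm_points[OF i4])
  moreover have "decay p ^ Suc m * energy_root p f A \<le> decay p ^ m * energy_root p f A"
    using decay_bounds[OF p] energy_root_nonneg by (intro mult_right_mono) auto
  ultimately show ?thesis by linarith
qed

text \<open>The geometric sum of the steps in closed form; keeping the subtracted power is what
  makes the induction on the word close.\<close>

lemma center_chain:
  assumes w: "w \<in> words n" and sub: "word_map w ` skeleton \<subseteq> A"
  shows "set u \<subseteq> {1..5} \<Longrightarrow> \<bar>f (word_map (w @ u) 0) - f (word_map w 0)\<bar> \<le> 2 / (1 - decay p) * (decay p ^ n - decay p ^ (n + length u)) * energy_root p f A"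
proof (induction u rule: rev_induct)
  case (snoc i u)
  have v: "w @ u \<in> words (n + length u)" using w snoc.prems by (intro words_append) (auto simp: words_def)
  have u: "u \<in> words (length u)" using snoc.prems by (auto simp: words_def)
  have "word_map (w @ u) ` skeleton \<subseteq> A" using sub word_map_skeleton[OF u] by auto
  then have 1: "\<bar>f (word_map ((w @ u) @ [i]) 0) - f (word_map (w @ u) 0)\<bar> \<le> 2 * decay p ^ (n + length u) * energy_root p f A"
    using snoc.prems by (intro center_step[OF v]) auto
  have 2: "\<bar>f (word_map (w @ u) 0) - f (word_map w 0)\<bar> \<le> 2 / (1 - decay p) * (decay p ^ n - decay p ^ (n + length u)) * energy_root p f A"
    using snoc by auto
  define K where "K = 2 / (1 - decay p)"
  have "2 * decay p ^ (n + length u) = K * (decay p ^ (n + length u) - decay p ^ (n + length (u @ [i])))"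
    unfolding K_def using decay_bounds[OF p] by (simp add: field_simps)
  then have "2 * decay p ^ (n + length u) * energy_root p f A + K * (decay p ^ n - decay p ^ (n + length u)) * energy_root p f A
    = K * (decay p ^ (n + length u) - decay p ^ (n + length (u @ [i]))) * energy_root p f A + K * (decay p ^ n - decay p ^ (n + length u)) * energy_root p f A"
    by (simp only:)
  also have "\<dots> = K * (decay p ^ n - decay p ^ (n + length (u @ [i]))) * energy_root p f A"
    by (simp only: algebra_simps)
  finally have "2 * decay p ^ (n + length u) * energy_root p f A + K * (decay p ^ n - decay p ^ (n + length u)) * energy_root p f A
    = K * (decay p ^ n - decay p ^ (n + length (u @ [i]))) * energy_root p f A" .
  then show ?case using 1 2 unfolding K_def[symmetric] by simp
qed simp

text \<open>The centres of the nested cells around x converge to x, and the chain bound for centres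
  does not depend on the depth. Continuity of f lets the error e go to zero.\<close>

lemma morrey_cell:
  assumes w: "w \<in> words n" and sub: "word_map w ` skeleton \<subseteq> A" and x: "x \<in> word_map w ` vicsek_set"
  shows "\<bar>f x - f (word_map w 0)\<bar> \<le> 2 / (1 - decay p) * decay p ^ n * energy_root p f A"
proof (rule field_le_epsilon)
  fix e :: real assume e: "0 < e"
  have cont: "continuous_on vicsek_set f" using f by (simp add: sobolev_space_def)
  obtain y where y: "y \<in> vicsek_set" "x = word_map w y" using x by blast
  have xK: "x \<in> vicsek_set" unfolding y by (rule word_map_vicsek_set[OF w y(1)])
  obtain d where d: "0 < d" "\<And>z. z \<in> vicsek_set \<Longrightarrow> dist z x < d \<Longrightarrow> dist (f z) (f x) < e"
    using cont xK e unfolding continuous_on_iff by metis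
  obtain k where k: "4 / 3 ^ k < d" using small_power_third[OF d(1)] .
  obtain u where u: "u \<in> words k" "y \<in> word_map u ` vicsek_set" using y(1) vicsek_set_words[of k] by blast
  have wu: "w @ u \<in> words (n + k)" by (rule words_append[OF w u(1)])
  have K0: "0 \<in> vicsek_set" using zero_skeleton skeleton_vicsek_set by blast
  have "x \<in> word_map (w @ u) ` vicsek_set" using u(2) y(2) by auto
  then have "dist (word_map (w @ u) 0) x \<le> 4 / 3 ^ (n + k)" using K0 by (intro word_map_diameter[OF wu]) auto
  also have "\<dots> \<le> 4 / 3 ^ k" by (intro divide_left_mono power_increasing) auto
  finally have "dist (word_map (w @ u) 0) x < d" using k by simp
  then have 1: "\<bar>f (word_map (w @ u) 0) - f x\<bar> < e"
    using d(2)[OF word_map_vicsek_set[OF wu K0]] by (simp add: dist_real_def)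
  have "\<bar>f (word_map (w @ u) 0) - f (word_map w 0)\<bar> \<le> 2 / (1 - decay p) * (decay p ^ n - decay p ^ (n + length u)) * energy_root p f A"
    using u(1) by (intro center_chain[OF w sub]) (auto simp: words_def)
  also have "\<dots> \<le> 2 / (1 - decay p) * decay p ^ n * energy_root p f A"
    using decay_bounds[OF p] energy_root_nonneg by (intro mult_right_mono mult_left_mono) auto
  finally show "\<bar>f x - f (word_map w 0)\<bar> \<le> 2 / (1 - decay p) * decay p ^ n * energy_root p f A + e" using 1 by linarith
qed

text \<open>Four applications of \<open>morrey_cell\<close>: from x to its centre, on to the shared
  corner, to the other centre, and to y. Hence the constant 8 = 4 * 2.\<close>

lemma morrey_adjacent_cells:
  assumes w: "w \<in> words n" "w' \<in> words n" and sub: "word_map w ` skeleton \<subseteq> A" "word_map w' ` skeleton \<subseteq> A"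
    and ij: "i \<in> {1..5}" "j \<in> {1..5}" "word_map w (vicsek_pt i) = word_map w' (vicsek_pt j)"
    and xy: "x \<in> word_map w ` vicsek_set" "y \<in> word_map w' ` vicsek_set"
  shows "\<bar>f x - f y\<bar> \<le> 8 / (1 - decay p) * decay p ^ n * energy_root p f A"
proof -
  have c: "word_map w (vicsek_pt i) \<in> word_map w ` vicsek_set" "word_map w' (vicsek_pt j) \<in> word_map w' ` vicsek_set"
    by (rule imageI[OF vicsek_pt_vicsek_set[OF ij(1)]], rule imageI[OF vicsek_pt_vicsek_set[OF ij(2)]])
  show ?thesis
    using morrey_cell[OF w(1) sub(1) xy(1)] morrey_cell[OF w(1) sub(1) c(1)]
      morrey_cell[OF w(2) sub(2) xy(2)] morrey_cell[OF w(2) sub(2) c(2)] ij(3) by simp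
qed

end

text \<open>Sharing a corner at level N bounds the distance by 4 / 3^N, so it must fail at deep
  levels. At the first level n + 1 where it fails, \<open>close_cells_share_vertex\<close> read
  backwards separates x and y by at least 2 \<open>half_side\<close> / 3^(n+1).\<close>

lemma separation_scale:
  assumes xy: "x \<in> vicsek_set" "y \<in> vicsek_set" "x \<noteq> y"
  obtains n w w' i j where "w \<in> words n" "w' \<in> words n" "i \<in> {1..5}" "j \<in> {1..5}"
    "word_map w (vicsek_pt i) = word_map w' (vicsek_pt j)" "x \<in> word_map w ` vicsek_set" "y \<in> word_map w' ` vicsek_set"
    "2 * half_side / 3 ^ Suc n \<le> dist x y"
proof -
  define P where "P n \<longleftrightarrow> (\<exists>w\<in>words n. \<exists>w'\<in>words n. \<exists>i\<in>{1..5}. \<exists>j\<in>{1..5}.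
    word_map w (vicsek_pt i) = word_map w' (vicsek_pt j) \<and> x \<in> word_map w ` vicsek_set \<and> y \<in> word_map w' ` vicsek_set)" for n
  have "P 0" using xy by (auto simp: P_def intro!: bexI[of _ 5])
  obtain N where N: "4 / 3 ^ N < dist x y" using small_power_third[of "dist x y" 4] xy by auto
  have "\<not> P N"
  proof
    assume "P N"
    then have "vicsek_dist x y \<le> 4 / 3 ^ N" unfolding P_def using vicsek_dist_shared_vertex by blast
    then show False using N dist_le_vicsek_dist[OF xy(1,2)] by simp
  qed
  \<comment> \<open>The least failing level; it is not 0, and its predecessor n satisfies P.\<close>
  define k where "k = (LEAST k. \<not> P k)"
  have k: "\<not> P k" unfolding k_def using \<open>\<not> P N\<close> by (rule LeastI)
  then obtain n where n: "k = Suc n" using \<open>P 0\<close> by (cases k) auto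
  have "P n" using not_less_Least[of n "\<lambda>k. \<not> P k"] n unfolding k_def by auto
  moreover have "2 * half_side / 3 ^ Suc n \<le> dist x y"
  proof (rule ccontr)
    assume far: "\<not> 2 * half_side / 3 ^ Suc n \<le> dist x y"
    obtain w s where w: "w \<in> words (Suc n)" "s \<in> vicsek_set" "x = word_map w s" using xy(1) vicsek_set_words[of "Suc n"] by blast
    obtain w' t where w': "w' \<in> words (Suc n)" "t \<in> vicsek_set" "y = word_map w' t" using xy(2) vicsek_set_words[of "Suc n"] by blast
    have "s \<in> vicsek_square" "t \<in> vicsek_square" using w(2) w'(2) vicsek_set_square by auto
    then have "\<exists>i\<in>{1..5}. \<exists>j\<in>{1..5}. word_map w (vicsek_pt i) = word_map w' (vicsek_pt j)"
      using far by (intro close_cells_share_vertex[OF w(1) w'(1), of s t]) (auto simp: w(3) w'(3))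
    then have "P (Suc n)" unfolding P_def using w w' by blast
    then show False using k n by simp
  qed
  ultimately show ?thesis using that unfolding P_def by blast
qed

text \<open>Phrased with a real number t below g_f(x), since g_f(x) itself may be infinite. The
  witness is the quotient under the supremum at r = 4 / 3^n, with n from
  \<open>separation_scale\<close>.\<close>

lemma sobolev_pointwise_estimate:
  assumes p: "1 < p" and f: "f \<in> sobolev_space p" and xy: "x \<in> vicsek_set" "y \<in> vicsek_set" "x \<noteq> y"
  shows "\<exists>t\<ge>0. ennreal t \<le> maximal_gradient p f x \<and>
    \<bar>f x - f y\<bar> \<le> 8 / (1 - decay p) * ball_constant 4 powr (1/p) * (3 / (2 * half_side)) powr sobolev_exponent p
      * vicsek_dist x y powr sobolev_exponent p * t"
proof -
  obtain n w w' i j where c: "w \<in> words n" "w' \<in> words n" "i \<in> {1..5}" "j \<in> {1..5}"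
    "word_map w (vicsek_pt i) = word_map w' (vicsek_pt j)" "x \<in> word_map w ` vicsek_set" "y \<in> word_map w' ` vicsek_set"
    "2 * half_side / 3 ^ Suc n \<le> dist x y"
    by (rule separation_scale[OF xy])
  define \<alpha> where "\<alpha> = sobolev_exponent p"
  define r where "r = (4::real) / 3 ^ n"
  define B where "B = vicsek_ball x r"
  define A where "A = B \<inter> skeleton"
  define m where "m = measure vicsek_measure B"
  define T where "T = energy_root p f A"
  define t where "t = 1 / m powr (1/p) * T"
  have "0 < hausdorff_dim" by (simp add: hausdorff_dim_def)
  moreover have "\<alpha> = 1 - 1/p + hausdorff_dim / p" by (simp add: \<alpha>_def sobolev_exponent_def)
  moreover have "0 < 1 - 1/p" using p by simp
  ultimately have \<alpha>: "0 < \<alpha>" "\<alpha> = (1 - 1/p) + hausdorff_dim * (1/p)" using p by (auto intro!: add_pos_pos)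
  have A: "A \<in> sets length_measure"
    using closed_vicsek_ball[OF xy(1), of r] by (auto simp: sets_length_measure_iff A_def B_def borel_closed)
  have wB: "word_map w ` vicsek_set \<subseteq> B" unfolding B_def r_def by (rule cell_subset_vicsek_ball[OF c(1,6)])
  \<comment> \<open>The radius 4 / 3^n is just enough for the neighbouring cell, which contains y
    and need not contain x.\<close>
  have wB': "word_map w' ` vicsek_set \<subseteq> B"
    using vicsek_dist_shared_vertex[OF c(1-6)] word_map_vicsek_set[OF c(2)] by (auto simp: B_def r_def vicsek_ball_def)
  have sub: "word_map w ` skeleton \<subseteq> A" "word_map w' ` skeleton \<subseteq> A"
    unfolding A_def using wB wB' skeleton_vicsek_set word_map_skeleton[OF c(1)] word_map_skeleton[OF c(2)] by blast+
  have m: "0 < m" "m \<le> ball_constant 4 * (1/5) ^ n"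
    using measure_vicsek_ball_le[OF xy(1), of 4 n] less_le_trans[OF _ measure_vicsek_ball_ge[OF xy(1), of n]]
    by (auto simp: m_def B_def r_def)
  have T0: "0 \<le> T" unfolding T_def by (rule energy_root_nonneg)
  have t0: "0 \<le> t" using T0 by (simp add: t_def)
  have "ennreal t \<le> maximal_gradient p f x"
    unfolding maximal_gradient_def t_def m_def T_def energy_root_def A_def B_def
    by (rule SUP_upper2[of r]) (auto simp: r_def)
  moreover have "\<bar>f x - f y\<bar> \<le> 8 / (1 - decay p) * ball_constant 4 powr (1/p) * (3 / (2 * half_side)) powr \<alpha> * vicsek_dist x y powr \<alpha> * t"
  proof -
    define K where "K = 8 / (1 - decay p)"
    have K: "0 \<le> K" unfolding K_def using decay_bounds[OF p] by simp
    \<comment> \<open>The separation is known at level n + 1, which accounts for the factor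
      3.\<close>
    have uv: "((1/3::real) ^ n) powr \<alpha> \<le> (3 / (2 * half_side) * vicsek_dist x y) powr \<alpha>"
    proof (rule powr_mono2)
      have "2 * half_side / 3 ^ Suc n \<le> vicsek_dist x y" using c(8) dist_le_vicsek_dist[OF xy(1,2)] by simp
      then have "3 / (2 * half_side) * (2 * half_side / 3 ^ Suc n) \<le> 3 / (2 * half_side) * vicsek_dist x y"
        using half_side_pos by (intro mult_left_mono) auto
      then show "(1/3) ^ n \<le> 3 / (2 * half_side) * vicsek_dist x y" using half_side_pos by (simp add: power_one_over)
    qed (use \<alpha> in auto)
    have "\<bar>f x - f y\<bar> \<le> K * decay p ^ n * T"
      unfolding K_def T_def by (rule morrey_adjacent_cells[OF p f A c(1,2) sub c(3-7)])
    also have "T = m powr (1/p) * t" using m by (simp add: t_def)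
    also have "K * decay p ^ n * (m powr (1/p) * t) \<le> K * decay p ^ n * ((ball_constant 4 * (1/5) ^ n) powr (1/p) * t)"
      using m p t0 K decay_bounds[OF p] by (intro mult_left_mono mult_right_mono powr_mono2) auto
    also have "\<dots> = K * ball_constant 4 powr (1/p) * (decay p ^ n * ((1/5) ^ n) powr (1/p)) * t"
      using ball_constant_pos[of 4] by (simp add: powr_mult mult_ac)
    also have "decay p ^ n * ((1/5) ^ n) powr (1/p) = ((1/3) ^ n) powr \<alpha>"
    proof -
      have "decay p ^ n = ((1/3::real) ^ n) powr (1 - 1/p)"
        by (simp add: decay_def powr_powr powr_realpow[symmetric] mult.commute)
      moreover have "((1/5::real) ^ n) powr (1/p) = ((1/3) ^ n) powr (hausdorff_dim * (1/p))"
        unfolding third_powr_hausdorff_dim[symmetric] by (rule powr_powr)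
      ultimately show ?thesis unfolding \<alpha>(2) powr_add by simp
    qed
    also have "K * ball_constant 4 powr (1/p) * ((1/3) ^ n) powr \<alpha> * t
      \<le> K * ball_constant 4 powr (1/p) * (3 / (2 * half_side) * vicsek_dist x y) powr \<alpha> * t"
      using K t0 by (intro mult_right_mono mult_left_mono uv) auto
    also have "(3 / (2 * half_side) * vicsek_dist x y) powr \<alpha> = (3 / (2 * half_side)) powr \<alpha> * vicsek_dist x y powr \<alpha>"
      using half_side_pos order_trans[OF zero_le_dist dist_le_vicsek_dist[OF xy(1,2)]] by (intro powr_mult)
    finally show ?thesis by (simp only: K_def mult.assoc)
  qed
  ultimately show ?thesis using t0 unfolding \<alpha>_def by blast
qed

theorem proposition4p6:
  fixes p :: real
  assumes "1 < p"
  shows "\<exists>C::real. \<forall>f\<in>sobolev_space p. \<forall>x\<in>vicsek_set. \<forall>y\<in>vicsek_set.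
    ennreal \<bar>f x - f y\<bar> \<le>
      ennreal C * ennreal (vicsek_dist x y powr sobolev_exponent p) *
        (maximal_gradient p f x + maximal_gradient p f y)"
proof (intro exI ballI)
  fix f x y assume f: "f \<in> sobolev_space p" and xy: "x \<in> vicsek_set" "y \<in> vicsek_set"
  define C where "C = 8 / (1 - decay p) * ball_constant 4 powr (1/p) * (3 / (2 * half_side)) powr sobolev_exponent p"
  show "ennreal \<bar>f x - f y\<bar> \<le> ennreal (8 / (1 - decay p) * ball_constant 4 powr (1/p) * (3 / (2 * half_side)) powr sobolev_exponent p)
      * ennreal (vicsek_dist x y powr sobolev_exponent p) * (maximal_gradient p f x + maximal_gradient p f y)"
    unfolding C_def[symmetric]
  \<comment> \<open>For x = y the left side is 0, so the inequality holds whatever the product on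
    the right.\<close>
  proof (cases "x = y")
    case False
    obtain t where t: "0 \<le> t" "ennreal t \<le> maximal_gradient p f x" "\<bar>f x - f y\<bar> \<le> C * vicsek_dist x y powr sobolev_exponent p * t"
      using sobolev_pointwise_estimate[OF assms f xy False] unfolding C_def by blast
    have "0 \<le> C" unfolding C_def using decay_bounds(2)[OF assms] by simp
    then have "ennreal (C * vicsek_dist x y powr sobolev_exponent p * t) = ennreal C * ennreal (vicsek_dist x y powr sobolev_exponent p) * ennreal t"
      using t(1) by (simp add: ennreal_mult)
    then have "ennreal \<bar>f x - f y\<bar> \<le> ennreal C * ennreal (vicsek_dist x y powr sobolev_exponent p) * ennreal t"
      using ennreal_leI[OF t(3)] by simp
    also have "\<dots> \<le> ennreal C * ennreal (vicsek_dist x y powr sobolev_exponent p) * (maximal_gradient p f x + maximal_gradient p f y)"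
      using t(2) by (intro mult_left_mono add_increasing2) auto
    finally show "ennreal \<bar>f x - f y\<bar> \<le> ennreal C * ennreal (vicsek_dist x y powr sobolev_exponent p) * (maximal_gradient p f x + maximal_gradient p f y)" .
  qed simp
qed

end
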